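(* Let $(L,\Delta)$ be a differentially closed field of characteristic zero with $m$ commuting derivations $\Delta$, and let $R$ be a local finite-dimensional $L$-algebra equipped with commuting derivations (also denoted $\Delta$) extending those of $L$, such that the maximal ideal $\mathfrak m$ of $R$ is a $\Delta$-ideal. Let $\Lambda=\{f_1,\dots,f_s\}\subset R\{x\}$ be a coherent set of differential polynomials in one variable $x$ over $R$. Suppose $a\in L$ satisfies $\operatorname{res}(f)(a)=0$ for all $f\in\Lambda$ and $\operatorname{res}(H_\Lambda)(a)\neq0$. Then there exists $b\in R$ with $\operatorname{res}(b)=a$ and $f(b)=0$ for all $f\in\Lambda$.
   Context: Since $L$ is algebraically closed, the residue field $R/\mathfrak m$ is $L$; $\operatorname{res}:R\to L$ is the residue map, extended coefficientwise to $R\{x\}\to L\{x\}$. All rings are commutative and unital. $R\{x\}=R[\Theta x]$ is the differential polynomial ring, with $\Theta$ the free commutative monoid on $\Delta=\{\delta_1,\dots,\delta_m\}$ and $\Theta x=\{\theta x:\theta\in\Theta\}$. Indeterminates are ranked by $\delta_m^{e_m}\cdots\delta_1^{e_1}x<\delta_m^{r_m}\cdots\delta_1^{r_1}x$ iff $(\sum e_k,e_m,\dots,e_1)<(\sum r_k,r_m,\dots,r_1)$ lexicographically. For $f\in R\{x\}\setminus R$: the leader $v_f$ is the highest-ranked indeterminate in $f$, $d_f$ its degree in $f$, the separant $S_f=\partial f/\partial v_f$, the initial $I_f$ the leading coefficient of $f$ in $v_f$; $H_\Lambda:=\prod_{f\in\Lambda}I_fS_f$. A subset $\Lambda\subset R\{x\}\setminus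 R$ is coherent if (1) for all $f\neq g$ in $\Lambda$, no proper derivative of $v_f$ appears in $g$, and if $v_f$ appears in $g$ then with degree $<d_f$; and (2) whenever $f\neq g$ in $\Lambda$ and $\theta_f,\theta_g\in\Theta$ with $\theta_fv_f=\theta_gv_g=:v$, $v$ least such, there is $N$ with $H_\Lambda^N(S_g\theta_ff-S_f\theta_gg)\in(\Lambda)_v$, the ideal generated by $\{\theta f:f\in\Lambda,\theta\in\Theta,v_{\theta f}<v\}$. *)

theory Defs
  imports "HOL-Library.Poly_Mapping" "HOL-Algebra.Ring"
begin

text \<open>A polynomial over coefficients of type 'c in variables of type 'v is an element of
  ('v =>0 nat) =>0 'c : a finitely supported map from monomials (finitely supported
  exponent vectors) to coefficients. Multiplication is the convolution product of Poly_Mapping.\<close>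

definition pvars :: "(('v \<Rightarrow>\<^sub>0 nat) \<Rightarrow>\<^sub>0 'c::zero) \<Rightarrow> 'v set" where
  "pvars f = (\<Union>mon\<in>Poly_Mapping.keys f. Poly_Mapping.keys mon)"

definition pvar :: "'v \<Rightarrow> ('v \<Rightarrow>\<^sub>0 nat) \<Rightarrow>\<^sub>0 'c::{zero,one}" where
  "pvar v = Poly_Mapping.single (Poly_Mapping.single v 1) 1"

definition pdiff :: "'v \<Rightarrow> (('v \<Rightarrow>\<^sub>0 nat) \<Rightarrow>\<^sub>0 'c::comm_ring_1) \<Rightarrow> ('v \<Rightarrow>\<^sub>0 nat) \<Rightarrow>\<^sub>0 'c" where
  "pdiff v f = (\<Sum>mon\<in>Poly_Mapping.keys f.
      Poly_Mapping.single (mon - Poly_Mapping.single v 1) (of_nat (Poly_Mapping.lookup mon v) * Poly_Mapping.lookup f mon))"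

definition deg_in :: "'v \<Rightarrow> (('v \<Rightarrow>\<^sub>0 nat) \<Rightarrow>\<^sub>0 'c::zero) \<Rightarrow> nat" where
  "deg_in v f = Max (insert 0 ((\<lambda>mon. Poly_Mapping.lookup mon v) ` Poly_Mapping.keys f))"

definition peval :: "('v \<Rightarrow> 'c::comm_ring_1) \<Rightarrow> (('v \<Rightarrow>\<^sub>0 nat) \<Rightarrow>\<^sub>0 'c) \<Rightarrow> 'c" where
  "peval val f = (\<Sum>mon\<in>Poly_Mapping.keys f. Poly_Mapping.lookup f mon * (\<Prod>v\<in>Poly_Mapping.keys mon. val v ^ Poly_Mapping.lookup mon v))"

definition map_coeffs :: "('b::zero \<Rightarrow> 'c::zero) \<Rightarrow> (('v \<Rightarrow>\<^sub>0 nat) \<Rightarrow>\<^sub>0 'b) \<Rightarrow> ('v \<Rightarrow>\<^sub>0 nat) \<Rightarrow>\<^sub>0 'c" where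
  "map_coeffs \<phi> f = Poly_Mapping.map \<phi> f"

definition ideal_gen :: "'a::comm_ring_1 set \<Rightarrow> 'a set" where
  "ideal_gen S = {p. \<exists>F c. finite F \<and> F \<subseteq> S \<and> p = (\<Sum>s\<in>F. c s * s)}"

text \<open>The derivations delta_1, ..., delta_m are indexed by 0, ..., m-1 (index i-1 is delta_i).
  An element theta of Theta (a derivative operator delta_m^e_m ... delta_1^e_1) is represented
  by its exponent vector theta :: nat =>0 nat with Poly_Mapping.keys in {..<m}.\<close>

definition Theta :: "nat \<Rightarrow> (nat \<Rightarrow>\<^sub>0 nat) set" where
  "Theta m = {\<theta>. Poly_Mapping.keys \<theta> \<subseteq> {..<m}}"

definition comm_derivations :: "nat \<Rightarrow> (nat \<Rightarrow> 'a::comm_ring_1 \<Rightarrow> 'a) \<Rightarrow> bool" where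
  "comm_derivations m D \<longleftrightarrow>
     (\<forall>i<m. \<forall>x y. D i (x + y) = D i x + D i y \<and> D i (x * y) = D i x * y + x * D i y) \<and>
     (\<forall>i<m. \<forall>j<m. \<forall>x. D i (D j x) = D j (D i x))"

definition theta_val :: "nat \<Rightarrow> (nat \<Rightarrow> 'a \<Rightarrow> 'a) \<Rightarrow> (nat \<Rightarrow>\<^sub>0 nat) \<Rightarrow> 'a \<Rightarrow> 'a" where
  "theta_val m D \<theta> y = foldr (\<lambda>i z. (D i ^^ Poly_Mapping.lookup \<theta> i) z) [0..<m] y"

definition is_ideal :: "'a::comm_ring_1 set \<Rightarrow> bool" where
  "is_ideal I \<longleftrightarrow> 0 \<in> I \<and> (\<forall>x\<in>I. \<forall>y\<in>I. x + y \<in> I) \<and> (\<forall>r. \<forall>x\<in>I. r * x \<in> I)"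

definition maximal_ideal :: "'a::comm_ring_1 set \<Rightarrow> bool" where
  "maximal_ideal I \<longleftrightarrow> is_ideal I \<and> I \<noteq> UNIV \<and>
     (\<forall>J. is_ideal J \<and> I \<subseteq> J \<longrightarrow> J = I \<or> J = UNIV)"

definition local_ring :: "'a::comm_ring_1 itself \<Rightarrow> bool" where
  "local_ring _ \<longleftrightarrow> (\<exists>!I::'a set. maximal_ideal I)"

definition fin_dim_algebra :: "('a::field \<Rightarrow> 'r::comm_ring_1) \<Rightarrow> bool" where
  "fin_dim_algebra \<iota> \<longleftrightarrow>
     (\<forall>x y. \<iota> (x + y) = \<iota> x + \<iota> y) \<and> (\<forall>x y. \<iota> (x * y) = \<iota> x * \<iota> y) \<and> \<iota> 1 = 1 \<and>
     (\<exists>B. finite B \<and> (\<forall>r. \<exists>c. r = (\<Sum>b\<in>B. \<iota> (c b) * b)))"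

definition res :: "('a \<Rightarrow> 'r::comm_ring_1) \<Rightarrow> 'r set \<Rightarrow> 'r \<Rightarrow> 'a" where
  "res \<iota> M r = (THE a. r - \<iota> a \<in> M)"

definition diff_field_ext ::
  "nat \<Rightarrow> (nat \<Rightarrow> 'a::field \<Rightarrow> 'a) \<Rightarrow> 'k ring \<Rightarrow> (nat \<Rightarrow> 'k \<Rightarrow> 'k) \<Rightarrow> ('a \<Rightarrow> 'k) \<Rightarrow> bool" where
  "diff_field_ext m D K d h \<longleftrightarrow> field K \<and> (\<forall>x. h x \<in> carrier K) \<and> inj h \<and>
     (\<forall>x y. h (x + y) = h x \<oplus>\<^bsub>K\<^esub> h y) \<and> (\<forall>x y. h (x * y) = h x \<otimes>\<^bsub>K\<^esub> h y) \<and>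
     h 1 = \<one>\<^bsub>K\<^esub> \<and>
     (\<forall>i<m. (\<forall>x\<in>carrier K. d i x \<in> carrier K) \<and>
        (\<forall>x\<in>carrier K. \<forall>y\<in>carrier K.
           d i (x \<oplus>\<^bsub>K\<^esub> y) = d i x \<oplus>\<^bsub>K\<^esub> d i y \<and>
           d i (x \<otimes>\<^bsub>K\<^esub> y) = (d i x \<otimes>\<^bsub>K\<^esub> y) \<oplus>\<^bsub>K\<^esub> (x \<otimes>\<^bsub>K\<^esub> d i y)) \<and>
        (\<forall>x. d i (h x) = h (D i x))) \<and>
     (\<forall>i<m. \<forall>j<m. \<forall>x\<in>carrier K. d i (d j x) = d j (d i x))"

definition keval :: "'k ring \<Rightarrow> ('a::zero \<Rightarrow> 'k) \<Rightarrow> ('v \<Rightarrow> 'k) \<Rightarrow> (('v \<Rightarrow>\<^sub>0 nat) \<Rightarrow>\<^sub>0 'a) \<Rightarrow> 'k" where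
  "keval K h val f = finsum K (\<lambda>mon. h (Poly_Mapping.lookup f mon) \<otimes>\<^bsub>K\<^esub>
        finprod K (\<lambda>v. val v [^]\<^bsub>K\<^esub> Poly_Mapping.lookup mon v) (Poly_Mapping.keys mon)) (Poly_Mapping.keys f)"

definition differentially_closed :: "nat \<Rightarrow> (nat \<Rightarrow> 'a::field_char_0 \<Rightarrow> 'a) \<Rightarrow> bool" where
  "differentially_closed m D \<longleftrightarrow> comm_derivations m D \<and>
    (\<forall>(F :: (((nat \<times> (nat \<Rightarrow>\<^sub>0 nat)) \<Rightarrow>\<^sub>0 nat) \<Rightarrow>\<^sub>0 'a) set) g.
       finite F \<and> (\<forall>f\<in>insert g F. \<forall>(j, \<theta>)\<in>pvars f. \<theta> \<in> Theta m) \<and>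
       (\<exists>(K :: ('a \<times> nat) ring) d h y. diff_field_ext m D K d h \<and> (\<forall>j. y j \<in> carrier K) \<and>
          (\<forall>f\<in>F. keval K h (\<lambda>(j, \<theta>). theta_val m d \<theta> (y j)) f = \<zero>\<^bsub>K\<^esub>) \<and>
          keval K h (\<lambda>(j, \<theta>). theta_val m d \<theta> (y j)) g \<noteq> \<zero>\<^bsub>K\<^esub>)
       \<longrightarrow> (\<exists>z. (\<forall>f\<in>F. peval (\<lambda>(j, \<theta>). theta_val m D \<theta> (z j)) f = 0) \<and>
                peval (\<lambda>(j, \<theta>). theta_val m D \<theta> (z j)) g \<noteq> 0))"

text \<open>R{x} is represented by ((nat =>0 nat) =>0 nat) =>0 'r : the indeterminate theta x is
  represented by the exponent vector theta; elements of R{x} are those whose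
  indeterminates all lie in Theta m.\<close>
type_synonym 'r dpoly = "((nat \<Rightarrow>\<^sub>0 nat) \<Rightarrow>\<^sub>0 nat) \<Rightarrow>\<^sub>0 'r"

definition dpolys :: "nat \<Rightarrow> 'r::zero dpoly set" where
  "dpolys m = {f. pvars f \<subseteq> Theta m}"

text \<open>The derivation delta_i on R{x}: delta_i(theta x) = (delta_i theta) x, extended from the
  derivation delta_i of the coefficient ring.\<close>
definition dder :: "(nat \<Rightarrow> 'r::comm_ring_1 \<Rightarrow> 'r) \<Rightarrow> nat \<Rightarrow> 'r dpoly \<Rightarrow> 'r dpoly" where
  "dder \<delta> i f = (\<Sum>mon\<in>Poly_Mapping.keys f. Poly_Mapping.single mon (\<delta> i (Poly_Mapping.lookup f mon))) +
                 (\<Sum>v\<in>pvars f. pdiff v f * pvar (v + Poly_Mapping.single i 1))"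

definition theta_poly :: "nat \<Rightarrow> (nat \<Rightarrow> 'r::comm_ring_1 \<Rightarrow> 'r) \<Rightarrow> (nat \<Rightarrow>\<^sub>0 nat) \<Rightarrow> 'r dpoly \<Rightarrow> 'r dpoly" where
  "theta_poly m \<delta> \<theta> f = theta_val m (dder \<delta>) \<theta> f"

definition deval :: "nat \<Rightarrow> (nat \<Rightarrow> 'r::comm_ring_1 \<Rightarrow> 'r) \<Rightarrow> 'r dpoly \<Rightarrow> 'r \<Rightarrow> 'r" where
  "deval m \<delta> f b = peval (\<lambda>\<theta>. theta_val m \<delta> \<theta> b) f"

definition rank_key :: "nat \<Rightarrow> (nat \<Rightarrow>\<^sub>0 nat) \<Rightarrow> nat list" where
  "rank_key m \<theta> = (\<Sum>i<m. Poly_Mapping.lookup \<theta> i) # map (Poly_Mapping.lookup \<theta>) (rev [0..<m])"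

definition rank_less :: "nat \<Rightarrow> (nat \<Rightarrow>\<^sub>0 nat) \<Rightarrow> (nat \<Rightarrow>\<^sub>0 nat) \<Rightarrow> bool" where
  "rank_less m v w \<longleftrightarrow> (rank_key m v, rank_key m w) \<in> lex less_than"

definition leader :: "nat \<Rightarrow> 'r::zero dpoly \<Rightarrow> nat \<Rightarrow>\<^sub>0 nat" where
  "leader m f = (THE v. v \<in> pvars f \<and> (\<forall>w\<in>pvars f. w \<noteq> v \<longrightarrow> rank_less m w v))"

definition ldeg :: "nat \<Rightarrow> 'r::zero dpoly \<Rightarrow> nat" where
  "ldeg m f = deg_in (leader m f) f"

definition separant :: "nat \<Rightarrow> 'r::comm_ring_1 dpoly \<Rightarrow> 'r dpoly" where
  "separant m f = pdiff (leader m f) f"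

definition initial :: "nat \<Rightarrow> 'r::comm_ring_1 dpoly \<Rightarrow> 'r dpoly" where
  "initial m f = (\<Sum>mon\<in>{mon\<in>Poly_Mapping.keys f. Poly_Mapping.lookup mon (leader m f) = ldeg m f}.
      Poly_Mapping.single (mon - Poly_Mapping.single (leader m f) (ldeg m f)) (Poly_Mapping.lookup f mon))"

definition H_prod :: "nat \<Rightarrow> 'r::comm_ring_1 dpoly set \<Rightarrow> 'r dpoly" where
  "H_prod m \<Lambda> = (\<Prod>f\<in>\<Lambda>. initial m f * separant m f)"

definition below_ideal :: "nat \<Rightarrow> (nat \<Rightarrow> 'r::comm_ring_1 \<Rightarrow> 'r) \<Rightarrow> 'r dpoly set \<Rightarrow> (nat \<Rightarrow>\<^sub>0 nat) \<Rightarrow> 'r dpoly set" where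
  "below_ideal m \<delta> \<Lambda> v = ideal_gen {theta_poly m \<delta> \<theta> f | f \<theta>.
      f \<in> \<Lambda> \<and> \<theta> \<in> Theta m \<and> rank_less m (leader m (theta_poly m \<delta> \<theta> f)) v}"

definition coherent :: "nat \<Rightarrow> (nat \<Rightarrow> 'r::comm_ring_1 \<Rightarrow> 'r) \<Rightarrow> 'r dpoly set \<Rightarrow> bool" where
  "coherent m \<delta> \<Lambda> \<longleftrightarrow>
    \<Lambda> \<subseteq> dpolys m \<and> (\<forall>f\<in>\<Lambda>. pvars f \<noteq> {}) \<and>
    (\<forall>f\<in>\<Lambda>. \<forall>g\<in>\<Lambda>. f \<noteq> g \<longrightarrow>
       (\<forall>\<theta>\<in>Theta m. \<theta> \<noteq> 0 \<longrightarrow> \<theta> + leader m f \<notin> pvars g) \<and>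
       (leader m f \<in> pvars g \<longrightarrow> deg_in (leader m f) g < ldeg m f)) \<and>
    (\<forall>f\<in>\<Lambda>. \<forall>g\<in>\<Lambda>. f \<noteq> g \<longrightarrow>
       (\<forall>\<theta>f\<in>Theta m. \<forall>\<theta>g\<in>Theta m.
          \<theta>f + leader m f = \<theta>g + leader m g \<and>
          (\<forall>\<theta>f'\<in>Theta m. \<forall>\<theta>g'\<in>Theta m. \<theta>f' + leader m f = \<theta>g' + leader m g \<longrightarrow>
              \<not> rank_less m (\<theta>f' + leader m f) (\<theta>f + leader m f))
          \<longrightarrow> (\<exists>N. H_prod m \<Lambda> ^ N *
                  (separant m g * theta_poly m \<delta> \<theta>f f - separant m f * theta_poly m \<delta> \<theta>g g)
                \<in> below_ideal m \<delta> \<Lambda> (\<theta>f + leader m f))))"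

end

theory Submission
  imports Defs "HOL-Library.Countable" "HOL-Computational_Algebra.Polynomial"
begin

text \<open>
  Two steps produce the solution. First, an \<^emph>\<open>algebraic\<close> solution: values in the algebra for all
  derivatives of the indeterminate, lifting the derivatives of the given residual zero and annihilating every
  derivative of every element of the coherent set. They are chosen by recursion along the ranking. At a
  derivative of a leader the value is forced by Hensel's lemma, since the separant is a unit there and the
  maximal ideal is nil; coherence makes all elements that force the value agree (Rosenfeld's argument).

  Second, write the unknown in a basis of the algebra with differential indeterminates over the base field as
  coordinates. The algebraic solution becomes a point of the differential polynomial ring in the coordinates.
  The polynomials all of whose derivatives vanish at this point form a prime differential ideal, because the
  characteristic is zero. It contains the coordinates of the system, so these have a common zero in the
  fraction field of the quotient, and hence in the differentially closed base field.
\<close>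

subsection \<open>Ring homomorphisms and polynomials\<close>

text \<open>An algebraic solution is only a family of values, one per derivative operator, and the
  value at a derivative need not be the derivative of a value: it may come from no element of the
  algebra. Passing to the polynomials all of whose derivatives vanish repairs this: in the quotient
  the classes of the indeterminates are differentiated correctly, at the price of leaving the base
  field.

  The delicate point is that the derivations also move the basis of the algebra, so an equation over
  the algebra cannot be differentiated coordinate by coordinate. That its coordinates still lie in
  the prime ideal is shown by adding one derivation at a time and by induction on its order: a term
  with a differentiated basis element contains only lower derivatives of the coordinates.

  The condition that the solution reduces to \<open>a\<close> becomes one more equation, on the
  residue of the generic element. Two obligations come from the definitions: differential closedness
  speaks of fields on the type \<open>'a \<times> nat\<close>, so the fraction field is coded there,
  and the equality of the residue field with the base field has to be derived.\<close>

definition is_rhom :: "('b::comm_ring_1 \<Rightarrow> 'c::comm_ring_1) \<Rightarrow> bool" where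
  "is_rhom \<phi> \<longleftrightarrow> \<phi> 1 = 1 \<and> (\<forall>x y. \<phi> (x + y) = \<phi> x + \<phi> y) \<and> (\<forall>x y. \<phi> (x * y) = \<phi> x * \<phi> y)"

definition is_der :: "('b::comm_ring_1 \<Rightarrow> 'b) \<Rightarrow> bool" where
  "is_der d \<longleftrightarrow> (\<forall>x y. d (x + y) = d x + d y) \<and> (\<forall>x y. d (x * y) = d x * y + x * d y)"

lemma rhom_one: "is_rhom \<phi> \<Longrightarrow> \<phi> 1 = 1"
  and rhom_add: "is_rhom \<phi> \<Longrightarrow> \<phi> (x + y) = \<phi> x + \<phi> y"
  and rhom_mult: "is_rhom \<phi> \<Longrightarrow> \<phi> (x * y) = \<phi> x * \<phi> y"
  by (auto simp: is_rhom_def)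

lemma rhom_zero: "is_rhom \<phi> \<Longrightarrow> \<phi> 0 = 0"
  using rhom_add[of \<phi> 0 0] by simp

lemma rhom_minus: "is_rhom \<phi> \<Longrightarrow> \<phi> (- x) = - \<phi> x"
  using rhom_add[of \<phi> x "- x"] by (simp add: rhom_zero eq_neg_iff_add_eq_0 add.commute)

lemma rhom_diff: "is_rhom \<phi> \<Longrightarrow> \<phi> (x - y) = \<phi> x - \<phi> y"
  using rhom_add[of \<phi> x "- y"] by (simp add: rhom_minus)

lemma rhom_sum: "is_rhom \<phi> \<Longrightarrow> \<phi> (sum g A) = (\<Sum>x\<in>A. \<phi> (g x))"
  by (induction A rule: infinite_finite_induct) (auto simp: rhom_zero rhom_add)

lemma rhom_prod: "is_rhom \<phi> \<Longrightarrow> \<phi> (prod g A) = (\<Prod>x\<in>A. \<phi> (g x))"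
  by (induction A rule: infinite_finite_induct) (auto simp: rhom_one rhom_mult)

lemma rhom_power: "is_rhom \<phi> \<Longrightarrow> \<phi> (x ^ n) = \<phi> x ^ n"
  by (induction n) (auto simp: rhom_one rhom_mult)

lemmas rhom_simps = rhom_one rhom_add rhom_mult rhom_zero rhom_minus rhom_diff rhom_sum rhom_prod rhom_power

lemma rhom_comp: "is_rhom \<phi> \<Longrightarrow> is_rhom \<psi> \<Longrightarrow> is_rhom (\<lambda>x. \<phi> (\<psi> x))"
  by (simp add: is_rhom_def)

lemma rhom_id: "is_rhom (\<lambda>x. x)"
  by (simp add: is_rhom_def)

lemma der_add: "is_der d \<Longrightarrow> d (x + y) = d x + d y"
  and der_mult: "is_der d \<Longrightarrow> d (x * y) = d x * y + x * d y"
  by (auto simp: is_der_def)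

lemma der_zero: "is_der d \<Longrightarrow> d 0 = 0"
  using der_add[of d 0 0] by simp

lemma der_one: "is_der d \<Longrightarrow> d 1 = 0"
  using der_mult[of d 1 1] by simp

lemma der_minus: "is_der d \<Longrightarrow> d (- x) = - d x"
  using der_add[of d x "- x"] by (simp add: der_zero eq_neg_iff_add_eq_0 add.commute)

lemma der_diff: "is_der d \<Longrightarrow> d (x - y) = d x - d y"
  using der_add[of d x "- y"] by (simp add: der_minus)

lemma der_sum: "is_der d \<Longrightarrow> d (sum g A) = (\<Sum>x\<in>A. d (g x))"
  by (induction A rule: infinite_finite_induct) (auto simp: der_zero der_add)

lemma poly_mapping_sum_single:
  fixes f :: "'k \<Rightarrow>\<^sub>0 'c::comm_monoid_add"
  shows "f = (\<Sum>k\<in>Poly_Mapping.keys f. Poly_Mapping.single k (Poly_Mapping.lookup f k))"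
proof (rule poly_mapping_eqI)
  fix k
  have "(\<Sum>j\<in>Poly_Mapping.keys f. Poly_Mapping.lookup (Poly_Mapping.single j (Poly_Mapping.lookup f j)) k)
      = (\<Sum>j\<in>Poly_Mapping.keys f. if k = j then Poly_Mapping.lookup f j else 0)"
    by (intro sum.cong) (auto simp: lookup_single when_def)
  also have "\<dots> = Poly_Mapping.lookup f k"
    by (simp add: in_keys_iff)
  finally show "Poly_Mapping.lookup f k =
      Poly_Mapping.lookup (\<Sum>k\<in>Poly_Mapping.keys f. Poly_Mapping.single k (Poly_Mapping.lookup f k)) k"
    by (simp add: lookup_sum)
qed

lemma poly_mapping_single_induct [case_names zero single add]:
  fixes f :: "'k \<Rightarrow>\<^sub>0 'c::comm_monoid_add"
  assumes "P 0" and "\<And>k c. P (Poly_Mapping.single k c)" and "\<And>f g. P f \<Longrightarrow> P g \<Longrightarrow> P (f + g)"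
  shows "P f"
proof -
  have "P (\<Sum>k\<in>A. Poly_Mapping.single k (Poly_Mapping.lookup f k))" for A
    by (induction A rule: infinite_finite_induct) (auto intro: assms)
  then show ?thesis
    by (subst poly_mapping_sum_single)
qed

text \<open>Constants and indeterminates generate the ring. Identities between homomorphisms or
  derivations are checked below on these generators only.\<close>

lemma poly_ring_induct [case_names const var add mult]:
  fixes f :: "('v \<Rightarrow>\<^sub>0 nat) \<Rightarrow>\<^sub>0 'c::comm_ring_1"
  assumes const: "\<And>c. P (Poly_Mapping.single 0 c)" and var: "\<And>v. P (pvar v)"
    and add: "\<And>f g. P f \<Longrightarrow> P g \<Longrightarrow> P (f + g)" and mult: "\<And>f g. P f \<Longrightarrow> P g \<Longrightarrow> P (f * g)"
  shows "P f"
proof (induction f rule: poly_mapping_single_induct)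
  case zero
  show ?case using const[of 0] by simp
next
  case (single \<mu> c)
  have "P (Poly_Mapping.single \<mu> 1)"
  proof (induction \<mu> rule: poly_mapping_single_induct)
    case zero
    show ?case by (rule const)
  next
    case (single v n)
    show ?case
    proof (induction n)
      case 0
      show ?case using const[of 1] by simp
    next
      case (Suc n)
      have "Poly_Mapping.single (Poly_Mapping.single v (Suc n)) (1::'c)
          = pvar v * Poly_Mapping.single (Poly_Mapping.single v n) 1"
        by (simp add: pvar_def mult_single flip: single_add)
      then show ?case using mult[OF var Suc] by simp
    qed
  next
    case (add \<mu> \<nu>)
    then show ?case using mult[OF add] by (simp add: mult_single)
  qed
  from mult[OF const this, of c] show ?case by (simp add: mult_single)
next
  case (add f g)
  then show ?case by (rule assms(3))
qed

text \<open>Cancellation may make the support of \<open>f + g\<close> smaller than the union of the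
  two supports; this is harmless because a zero coefficient contributes nothing.\<close>

lemma keys_sum_add:
  assumes "\<And>k. F k 0 = 0" and "\<And>k x y. F k (x + y) = F k x + F k y"
  shows "(\<Sum>k\<in>Poly_Mapping.keys (f + g). F k (Poly_Mapping.lookup (f + g) k))
    = (\<Sum>k\<in>Poly_Mapping.keys f. F k (Poly_Mapping.lookup f k)) + (\<Sum>k\<in>Poly_Mapping.keys g. F k (Poly_Mapping.lookup g k))"
  by (rule setsum_keys_plus_distrib) (use assms in auto)

lemma keys_sum_single:
  assumes "F k 0 = 0"
  shows "(\<Sum>j\<in>Poly_Mapping.keys (Poly_Mapping.single k c). F j (Poly_Mapping.lookup (Poly_Mapping.single k c) j)) = F k c"
  using assms by (cases "c = 0") auto

section \<open>Evaluation homomorphisms of polynomial rings\<close>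

definition mon_eval :: "('v \<Rightarrow> 'c::comm_ring_1) \<Rightarrow> ('v \<Rightarrow>\<^sub>0 nat) \<Rightarrow> 'c" where
  "mon_eval val \<mu> = (\<Prod>v\<in>Poly_Mapping.keys \<mu>. val v ^ Poly_Mapping.lookup \<mu> v)"

lemma mon_eval_superset:
  "finite A \<Longrightarrow> Poly_Mapping.keys \<mu> \<subseteq> A \<Longrightarrow> mon_eval val \<mu> = (\<Prod>v\<in>A. val v ^ Poly_Mapping.lookup \<mu> v)"
  unfolding mon_eval_def by (rule prod.mono_neutral_left) (auto simp: in_keys_iff)

lemma mon_eval_zero [simp]: "mon_eval val 0 = 1"
  by (simp add: mon_eval_def)

lemma mon_eval_single [simp]: "mon_eval val (Poly_Mapping.single v n) = val v ^ n"
  by (cases "n = 0") (simp_all add: mon_eval_def)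

lemma mon_eval_add: "mon_eval val (\<mu> + \<nu>) = mon_eval val \<mu> * mon_eval val \<nu>"
proof -
  let ?A = "Poly_Mapping.keys \<mu> \<union> Poly_Mapping.keys \<nu>"
  have "mon_eval val (\<mu> + \<nu>) = (\<Prod>v\<in>?A. val v ^ Poly_Mapping.lookup (\<mu> + \<nu>) v)"
    by (rule mon_eval_superset) (simp_all add: keys_add)
  also have "\<dots> = mon_eval val \<mu> * mon_eval val \<nu>"
    by (subst (1 2) mon_eval_superset[of ?A]) (auto simp: lookup_add power_add prod.distrib)
  finally show ?thesis .
qed

text \<open>The universal property of the polynomial ring. Evaluation, change of coefficients and
  substitution of polynomials are all instances, so one set of rules serves them all.\<close>

definition poly_hom :: "('b \<Rightarrow> 'c) \<Rightarrow> ('v \<Rightarrow> 'c) \<Rightarrow> (('v \<Rightarrow>\<^sub>0 nat) \<Rightarrow>\<^sub>0 'b::comm_ring_1) \<Rightarrow> 'c::comm_ring_1" where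
  "poly_hom \<phi> val f = (\<Sum>\<mu>\<in>Poly_Mapping.keys f. \<phi> (Poly_Mapping.lookup f \<mu>) * mon_eval val \<mu>)"

lemma poly_hom_single: "is_rhom \<phi> \<Longrightarrow> poly_hom \<phi> val (Poly_Mapping.single \<mu> c) = \<phi> c * mon_eval val \<mu>"
  unfolding poly_hom_def by (rule keys_sum_single) (simp add: rhom_zero)

lemma poly_hom_const: "is_rhom \<phi> \<Longrightarrow> poly_hom \<phi> val (Poly_Mapping.single 0 c) = \<phi> c"
  by (simp add: poly_hom_single)

lemma poly_hom_pvar: "is_rhom \<phi> \<Longrightarrow> poly_hom \<phi> val (pvar v) = val v"
  by (simp add: poly_hom_single pvar_def rhom_one)

lemma poly_hom_add: "is_rhom \<phi> \<Longrightarrow> poly_hom \<phi> val (f + g) = poly_hom \<phi> val f + poly_hom \<phi> val g"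
  unfolding poly_hom_def by (rule keys_sum_add) (auto simp: rhom_zero rhom_add algebra_simps)

lemma poly_hom_mult:
  assumes "is_rhom \<phi>"
  shows "poly_hom \<phi> val (f * g) = poly_hom \<phi> val f * poly_hom \<phi> val g"
proof (induction f rule: poly_mapping_single_induct)
  case zero
  show ?case by (simp add: poly_hom_def)
next
  case (single \<mu> c)
  show ?case
    by (induction g rule: poly_mapping_single_induct)
      (simp_all add: assms poly_hom_single poly_hom_add mult_single mon_eval_add rhom_mult algebra_simps,
       simp add: poly_hom_def)
next
  case (add f g)
  then show ?case by (simp add: assms poly_hom_add algebra_simps)
qed

lemma rhom_poly_hom: "is_rhom \<phi> \<Longrightarrow> is_rhom (poly_hom \<phi> val)"
  using poly_hom_const[of \<phi> val 1]
  by (simp add: is_rhom_def[of "poly_hom \<phi> val"] poly_hom_add poly_hom_mult rhom_one)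

lemma rhom_const: "is_rhom (\<lambda>c. Poly_Mapping.single 0 c :: ('v \<Rightarrow>\<^sub>0 nat) \<Rightarrow>\<^sub>0 'c::comm_ring_1)"
  by (simp add: is_rhom_def single_add mult_single)

lemma rhom_poly_ext:
  assumes "is_rhom F" "is_rhom G" "\<And>c. F (Poly_Mapping.single 0 c) = G (Poly_Mapping.single 0 c)"
    and "\<And>v. F (pvar v) = G (pvar v)"
  shows "F f = G f"
  by (induction f rule: poly_ring_induct) (auto simp: assms rhom_add rhom_mult)

lemma peval_eq_poly_hom: "peval val = poly_hom (\<lambda>x. x) val"
  by (rule ext) (simp add: peval_def poly_hom_def mon_eval_def)

lemma rhom_peval: "is_rhom (peval val)"
  by (simp add: peval_eq_poly_hom rhom_poly_hom rhom_id)

lemma peval_const: "peval val (Poly_Mapping.single 0 c) = c"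
  and peval_pvar: "peval val (pvar v) = val v"
  by (simp_all add: peval_eq_poly_hom poly_hom_const poly_hom_pvar rhom_id)

lemma poly_hom_cong: "(\<And>v. v \<in> pvars f \<Longrightarrow> val v = val' v) \<Longrightarrow> poly_hom \<phi> val f = poly_hom \<phi> val' f"
  unfolding poly_hom_def mon_eval_def pvars_def
  by (intro sum.cong arg_cong2[of _ _ _ _ "(*)"] prod.cong refl) (auto; metis)

lemma peval_cong: "(\<And>v. v \<in> pvars f \<Longrightarrow> val v = val' v) \<Longrightarrow> peval val f = peval val' f"
  unfolding peval_eq_poly_hom by (rule poly_hom_cong)

lemma lookup_map_coeffs: "\<phi> 0 = 0 \<Longrightarrow> Poly_Mapping.lookup (map_coeffs \<phi> f) \<mu> = \<phi> (Poly_Mapping.lookup f \<mu>)"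
  unfolding map_coeffs_def by transfer (simp add: when_def)

lemma pvars_map_coeffs: "\<phi> 0 = 0 \<Longrightarrow> pvars (map_coeffs \<phi> f) \<subseteq> pvars f"
  unfolding pvars_def by (intro UN_mono subset_refl) (auto simp: in_keys_iff lookup_map_coeffs)

lemma poly_hom_map_coeffs:
  assumes "is_rhom \<psi>" "\<phi> 0 = 0"
  shows "poly_hom \<psi> val (map_coeffs \<phi> f) = poly_hom (\<lambda>c. \<psi> (\<phi> c)) val f"
proof -
  have "Poly_Mapping.keys (map_coeffs \<phi> f) \<subseteq> Poly_Mapping.keys f"
    using assms(2) by (auto simp: in_keys_iff lookup_map_coeffs)
  then show ?thesis
    unfolding poly_hom_def using assms rhom_zero[OF assms(1)]
    by (intro sum.mono_neutral_cong_left) (auto simp: in_keys_iff lookup_map_coeffs)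
qed

lemma peval_map_coeffs: "is_rhom \<phi> \<Longrightarrow> peval val (map_coeffs \<phi> f) = poly_hom \<phi> val f"
  by (simp add: peval_eq_poly_hom poly_hom_map_coeffs rhom_id rhom_zero)

lemma poly_hom_const_pvar: "poly_hom (\<lambda>c. Poly_Mapping.single 0 c) pvar f = f"
  by (rule rhom_poly_ext[of _ "\<lambda>f. f"]) (simp_all add: rhom_poly_hom rhom_const rhom_id poly_hom_const poly_hom_pvar)

lemma rhom_peval_poly_hom:
  assumes "is_rhom \<phi>" and "is_rhom \<psi>"
  shows "\<psi> (poly_hom \<phi> val f) = poly_hom (\<lambda>x. \<psi> (\<phi> x)) (\<lambda>v. \<psi> (val v)) f"
  by (rule rhom_poly_ext[where F="\<lambda>f. \<psi> (poly_hom \<phi> val f)"])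
    (simp_all add: assms rhom_comp rhom_poly_hom poly_hom_const poly_hom_pvar)

subsection \<open>Variables\<close>

lemma finite_pvars [simp]: "finite (pvars f)"
  by (simp add: pvars_def)

lemma pvars_zero [simp]: "pvars 0 = {}"
  by (simp add: pvars_def)

lemma pvars_const [simp]: "pvars (Poly_Mapping.single 0 c) = {}"
  by (auto simp: pvars_def split: if_splits)

lemma pvars_one [simp]: "pvars 1 = {}"
  by (simp add: pvars_def)

lemma pvars_pvar: "pvars (pvar v :: _ \<Rightarrow>\<^sub>0 'c::comm_ring_1) = {v}"
  by (simp add: pvars_def pvar_def)

lemma pvars_add: "pvars (f + g) \<subseteq> pvars f \<union> pvars g"
  using keys_add[of f g] by (auto simp: pvars_def)

lemma pvars_mult: "pvars (f * g :: _ \<Rightarrow>\<^sub>0 'c::comm_ring_1) \<subseteq> pvars f \<union> pvars g"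
proof
  fix v assume "v \<in> pvars (f * g)"
  then obtain \<mu> where \<mu>: "\<mu> \<in> Poly_Mapping.keys (f * g)" "v \<in> Poly_Mapping.keys \<mu>"
    by (auto simp: pvars_def)
  from subsetD[OF keys_mult \<mu>(1)] obtain \<alpha> \<beta> where
    "\<mu> = \<alpha> + \<beta>" "\<alpha> \<in> Poly_Mapping.keys f" "\<beta> \<in> Poly_Mapping.keys g" by auto
  with \<mu>(2) show "v \<in> pvars f \<union> pvars g"
    using keys_add[of \<alpha> \<beta>] by (auto simp: pvars_def)
qed

lemma pvars_uminus [simp]: "pvars (- f :: _ \<Rightarrow>\<^sub>0 'c::comm_ring_1) = pvars f"
  by (simp add: pvars_def in_keys_iff keys_def)

lemma pvars_sum_le: "(\<And>x. x \<in> A \<Longrightarrow> pvars (g x) \<subseteq> V) \<Longrightarrow> pvars (sum g A) \<subseteq> V"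
  by (induction A rule: infinite_finite_induct) (auto dest!: subsetD[OF pvars_add])

lemma pvars_prod_le: "(\<And>x. x \<in> A \<Longrightarrow> pvars (g x :: _ \<Rightarrow>\<^sub>0 'c::comm_ring_1) \<subseteq> V) \<Longrightarrow> pvars (prod g A) \<subseteq> V"
  by (induction A rule: infinite_finite_induct) (auto dest!: subsetD[OF pvars_mult])

lemma pvars_power_le: "pvars (f ^ n :: _ \<Rightarrow>\<^sub>0 'c::comm_ring_1) \<subseteq> pvars f"
  by (induction n) (auto dest!: subsetD[OF pvars_mult])

lemma pvars_subst_le:
  fixes val :: "'v \<Rightarrow> ('w \<Rightarrow>\<^sub>0 nat) \<Rightarrow>\<^sub>0 'c::comm_ring_1"
  assumes "\<And>v. v \<in> pvars f \<Longrightarrow> pvars (val v) \<subseteq> V"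
  shows "pvars (poly_hom (\<lambda>c. Poly_Mapping.single 0 (\<phi> c)) val f) \<subseteq> V"
  unfolding poly_hom_def mon_eval_def
proof (intro pvars_sum_le order.trans[OF pvars_mult] Un_least pvars_prod_le order.trans[OF pvars_power_le])
  fix \<mu> v assume "\<mu> \<in> Poly_Mapping.keys f" "v \<in> Poly_Mapping.keys \<mu>"
  then show "pvars (val v) \<subseteq> V" by (intro assms) (auto simp: pvars_def)
qed simp

subsection \<open>Derivations of polynomial rings\<close>

lemma pdiff_single:
  "pdiff v (Poly_Mapping.single \<mu> c) =
    Poly_Mapping.single (\<mu> - Poly_Mapping.single v 1) (of_nat (Poly_Mapping.lookup \<mu> v) * c)"
  unfolding pdiff_def by (rule keys_sum_single) simp

lemma pdiff_const [simp]: "pdiff v (Poly_Mapping.single 0 c) = 0"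
  by (simp add: pdiff_single)

lemma pdiff_pvar: "pdiff v (pvar w) = (if v = w then 1 else 0)"
  by (auto simp: pdiff_single pvar_def lookup_single when_def)

lemma pdiff_add: "pdiff v (f + g) = pdiff v f + pdiff v g"
  unfolding pdiff_def by (rule keys_sum_add) (simp_all add: algebra_simps single_add)

text \<open>Both sides of Leibniz' rule are biadditive, so single terms suffice.\<close>

lemma additive_leibnizI:
  fixes T :: "('m::comm_monoid_add \<Rightarrow>\<^sub>0 'c::comm_ring_1) \<Rightarrow> _"
  assumes add: "\<And>f g. T (f + g) = T f + T g"
    and leibniz: "\<And>\<mu> \<nu> c e. T (Poly_Mapping.single \<mu> c * Poly_Mapping.single \<nu> e) =
      T (Poly_Mapping.single \<mu> c) * Poly_Mapping.single \<nu> e + Poly_Mapping.single \<mu> c * T (Poly_Mapping.single \<nu> e)"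
  shows "is_der T"
proof -
  have zero: "T 0 = 0" using add[of 0 0] by simp
  have "T (f * g) = T f * g + f * T g" for f g
  proof (induction f rule: poly_mapping_single_induct)
    case (single \<mu> c)
    show ?case
      by (induction g rule: poly_mapping_single_induct) (simp_all add: zero leibniz add algebra_simps)
  qed (simp_all add: zero add algebra_simps)
  then show ?thesis by (simp add: is_der_def add)
qed

lemma der_pdiff: "is_der (pdiff v)"
proof (rule additive_leibnizI, rule pdiff_add)
  fix \<mu> \<nu> :: "'a \<Rightarrow>\<^sub>0 nat" and c e :: 'b
  let ?e = "Poly_Mapping.single v (1::nat)"
  \<comment> \<open>Subtraction of exponents is truncated, so it commutes with adding
    \<open>\<nu>\<close> only where \<open>v\<close> occurs in \<open>\<mu>\<close>. Where it does
    not, the factor \<open>of_nat 0\<close> kills the term.\<close>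
  have *: "\<mu> + \<nu> - ?e = \<mu> - ?e + \<nu>" if "Poly_Mapping.lookup \<mu> v \<noteq> 0" for \<mu> \<nu> :: "'a \<Rightarrow>\<^sub>0 nat"
    using that by (intro poly_mapping_eqI) (auto simp: lookup_add lookup_minus lookup_single when_def)
  have 1: "Poly_Mapping.single (\<mu> + \<nu> - ?e) (of_nat (Poly_Mapping.lookup \<mu> v) * (c * e))
      = Poly_Mapping.single (\<mu> - ?e + \<nu>) (of_nat (Poly_Mapping.lookup \<mu> v) * (c * e))"
    using *[of \<mu> \<nu>] by (cases "Poly_Mapping.lookup \<mu> v = 0") auto
  have 2: "Poly_Mapping.single (\<mu> + \<nu> - ?e) (of_nat (Poly_Mapping.lookup \<nu> v) * (c * e))
      = Poly_Mapping.single (\<mu> + (\<nu> - ?e)) (of_nat (Poly_Mapping.lookup \<nu> v) * (c * e))"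
    using *[of \<nu> \<mu>] by (cases "Poly_Mapping.lookup \<nu> v = 0") (auto simp: add.commute)
  show "pdiff v (Poly_Mapping.single \<mu> c * Poly_Mapping.single \<nu> e) =
      pdiff v (Poly_Mapping.single \<mu> c) * Poly_Mapping.single \<nu> e + Poly_Mapping.single \<mu> c * pdiff v (Poly_Mapping.single \<nu> e)"
    using 1 2 by (simp only: mult_single pdiff_single lookup_add distrib_right single_add of_nat_add)
      (simp only: mult.assoc mult.left_commute[of c])
qed

lemma pdiff_not_in_pvars: "v \<notin> pvars f \<Longrightarrow> pdiff v f = 0"
  unfolding pdiff_def by (rule sum.neutral) (auto simp: pvars_def in_keys_iff)

lemma pvars_pdiff: "pvars (pdiff v f) \<subseteq> pvars f"
  unfolding pdiff_def
proof (rule pvars_sum_le)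
  fix \<mu> assume "\<mu> \<in> Poly_Mapping.keys f"
  then show "pvars (Poly_Mapping.single (\<mu> - Poly_Mapping.single v 1) (of_nat (Poly_Mapping.lookup \<mu> v) * Poly_Mapping.lookup f \<mu>)) \<subseteq> pvars f"
    by (auto simp: pvars_def in_keys_iff lookup_minus split: if_splits)
qed

text \<open>The derivation that extends \<open>d\<close> and sends the indeterminate
  \<open>v\<close> to \<open>s v\<close>. Both \<open>dder\<close> and the derivation of the ring in
  several differential indeterminates are instances.\<close>

definition poly_der :: "('c \<Rightarrow> 'c) \<Rightarrow> ('v \<Rightarrow> ('v \<Rightarrow>\<^sub>0 nat) \<Rightarrow>\<^sub>0 'c) \<Rightarrow> (('v \<Rightarrow>\<^sub>0 nat) \<Rightarrow>\<^sub>0 'c::comm_ring_1) \<Rightarrow> ('v \<Rightarrow>\<^sub>0 nat) \<Rightarrow>\<^sub>0 'c" where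
  "poly_der d s f = (\<Sum>\<mu>\<in>Poly_Mapping.keys f. Poly_Mapping.single \<mu> (d (Poly_Mapping.lookup f \<mu>))) +
     (\<Sum>v\<in>pvars f. pdiff v f * s v)"

lemma dder_eq_poly_der: "dder \<delta> i = poly_der (\<delta> i) (\<lambda>v. pvar (v + Poly_Mapping.single i 1))"
  by (rule ext) (simp add: dder_def poly_der_def)

text \<open>Over a common index set the sums for \<open>f\<close>, \<open>g\<close>,
  \<open>f + g\<close> and \<open>f * g\<close> can be compared term by term; their own sets
  \<open>pvars\<close> differ.\<close>

lemma poly_der_superset:
  assumes "finite A" "pvars f \<subseteq> A"
  shows "poly_der d s f = (\<Sum>\<mu>\<in>Poly_Mapping.keys f. Poly_Mapping.single \<mu> (d (Poly_Mapping.lookup f \<mu>))) +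
     (\<Sum>v\<in>A. pdiff v f * s v)"
  unfolding poly_der_def using assms
  by (intro arg_cong2[of _ _ _ _ "(+)"] refl sum.mono_neutral_left) (auto simp: pdiff_not_in_pvars)

lemma coeff_der_add:
  assumes "is_der d"
  shows "(\<Sum>\<mu>\<in>Poly_Mapping.keys (f + g). Poly_Mapping.single \<mu> (d (Poly_Mapping.lookup (f + g) \<mu>)))
    = (\<Sum>\<mu>\<in>Poly_Mapping.keys f. Poly_Mapping.single \<mu> (d (Poly_Mapping.lookup f \<mu>)))
    + (\<Sum>\<mu>\<in>Poly_Mapping.keys g. Poly_Mapping.single \<mu> (d (Poly_Mapping.lookup g \<mu>)))"
  by (rule keys_sum_add) (simp_all add: der_zero der_add assms single_add)

lemma der_coeff_der:
  assumes "is_der d"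
  shows "is_der (\<lambda>f. \<Sum>\<mu>\<in>Poly_Mapping.keys f. Poly_Mapping.single (\<mu> :: 'v \<Rightarrow>\<^sub>0 nat) (d (Poly_Mapping.lookup f \<mu>)))"
    (is "is_der ?T")
proof (rule additive_leibnizI, rule coeff_der_add[OF assms])
  have single: "?T (Poly_Mapping.single \<mu> c) = Poly_Mapping.single \<mu> (d c)" for \<mu> c
    by (rule keys_sum_single) (simp add: der_zero assms)
  show "?T (Poly_Mapping.single \<mu> c * Poly_Mapping.single \<nu> e) =
      ?T (Poly_Mapping.single \<mu> c) * Poly_Mapping.single \<nu> e + Poly_Mapping.single \<mu> c * ?T (Poly_Mapping.single \<nu> e)"
    for \<mu> \<nu> c e
    by (simp only: mult_single single der_mult[OF assms] single_add)
qed

lemma der_poly_der: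
  assumes d: "is_der d"
  shows "is_der (poly_der d s)"
proof -
  let ?A = "\<lambda>f g. pvars f \<union> pvars g"
  note sup = poly_der_superset[of "?A f g" for f g]
  have "poly_der d s (f + g) = poly_der d s f + poly_der d s g" for f g
    by (subst (1 2 3) sup[of f g])
      (auto simp: coeff_der_add[OF d] pdiff_add distrib_right sum.distrib dest: subsetD[OF pvars_add])
  moreover have "poly_der d s (f * g) = poly_der d s f * g + f * poly_der d s g" for f g
    by (subst (1 2 3) sup[of f g])
      (auto simp: der_mult[OF der_coeff_der[OF d]] der_mult[OF der_pdiff] algebra_simps sum.distrib sum_distrib_left
         dest: subsetD[OF pvars_mult])
  ultimately show ?thesis by (simp add: is_der_def)
qed

lemma poly_der_const: "is_der d \<Longrightarrow> poly_der d s (Poly_Mapping.single 0 c) = Poly_Mapping.single 0 (d c)"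
  by (simp add: poly_der_def der_zero)

lemma poly_der_pvar: "is_der d \<Longrightarrow> poly_der d s (pvar v) = s v"
  by (subst poly_der_superset[of "{v}"])
    (simp_all add: pvars_pvar pdiff_pvar, simp add: pvar_def der_one)

lemma pvars_poly_der: "pvars (poly_der d s f) \<subseteq> pvars f \<union> (\<Union>v\<in>pvars f. pvars (s v))"
  unfolding poly_der_def
proof (intro order.trans[OF pvars_add] Un_least pvars_sum_le)
  fix \<mu> assume "\<mu> \<in> Poly_Mapping.keys f"
  then show "pvars (Poly_Mapping.single \<mu> (d (Poly_Mapping.lookup f \<mu>))) \<subseteq> pvars f \<union> (\<Union>v\<in>pvars f. pvars (s v))"
    by (auto simp: pvars_def split: if_splits)
next
  fix v assume "v \<in> pvars f"
  then show "pvars (pdiff v f * s v) \<subseteq> pvars f \<union> (\<Union>v\<in>pvars f. pvars (s v))"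
    using pvars_mult[of "pdiff v f" "s v"] pvars_pdiff[of v f] by blast
qed

text \<open>The commutator of two derivations is a derivation, hence vanishes once it vanishes on
  generators.\<close>

lemma poly_der_commute:
  assumes "is_der d" "is_der d'" "\<And>x. d (d' x) = d' (d x)"
    and "\<And>v. poly_der d s (s' v) = poly_der d' s' (s v)"
  shows "poly_der d s (poly_der d' s' f) = poly_der d' s' (poly_der d s f)"
  by (induction f rule: poly_ring_induct)
    (simp_all add: assms poly_der_const poly_der_pvar der_add[OF der_poly_der] der_mult[OF der_poly_der] algebra_simps)

text \<open>The last hypothesis says that the point \<open>val\<close> is compatible with the
  derivations. This is exactly what an algebraic solution may fail to satisfy and a differential one
  satisfies.\<close>

lemma poly_hom_poly_der:
  assumes \<phi>: "is_rhom \<phi>" and d: "is_der d" and e: "is_der e"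
    and "\<And>c. e (\<phi> c) = \<phi> (d c)" and "\<And>v. e (val v) = poly_hom \<phi> val (s v)"
  shows "poly_hom \<phi> val (poly_der d s f) = e (poly_hom \<phi> val f)"
  by (induction f rule: poly_ring_induct)
    (simp_all add: assms poly_der_const poly_der_pvar der_add[OF der_poly_der] der_mult[OF der_poly_der]
      der_add[OF e] der_mult[OF e] poly_hom_const poly_hom_pvar poly_hom_add poly_hom_mult)

text \<open>The quadratic remainder is left unspecified. It is thus available over any commutative
  ring, with no division by 2, and passes through products.\<close>

lemma peval_update_taylor:
  "\<exists>r. peval (val(v := x + h)) f = peval (val(v := x)) f + h * peval (val(v := x)) (pdiff v f) + h ^ 2 * r"
proof (induction f rule: poly_ring_induct)
  case (const c)
  show ?case by (rule exI[of _ 0]) (simp add: peval_const rhom_zero[OF rhom_peval])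
next
  case (var w)
  show ?case by (rule exI[of _ 0]) (simp add: peval_pvar pdiff_pvar rhom_zero[OF rhom_peval] rhom_one[OF rhom_peval])
next
  case (add f g)
  then obtain r1 r2 where
    "peval (val(v := x + h)) f = peval (val(v := x)) f + h * peval (val(v := x)) (pdiff v f) + h ^ 2 * r1"
    "peval (val(v := x + h)) g = peval (val(v := x)) g + h * peval (val(v := x)) (pdiff v g) + h ^ 2 * r2" by blast
  then show ?case
    by (intro exI[of _ "r1 + r2"]) (simp only: rhom_add[OF rhom_peval] pdiff_add distrib_left add_ac)
next
  case (mult f g)
  let ?e = "peval (val(v := x))"
  have *: "\<exists>r. (F + h * F' + h ^ 2 * r1) * (G + h * G' + h ^ 2 * r2) = F * G + h * (F' * G + F * G') + h ^ 2 * r" for F F' G G' r1 r2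
    by (intro exI[of _ "r1 * (G + h * G' + h ^ 2 * r2) + r2 * (F + h * F') + F' * G'"])
      (simp add: algebra_simps power2_eq_square)
  from mult obtain r1 r2 where
    "peval (val(v := x + h)) f = ?e f + h * ?e (pdiff v f) + h ^ 2 * r1"
    "peval (val(v := x + h)) g = ?e g + h * ?e (pdiff v g) + h ^ 2 * r2" by blast
  then show ?case
    unfolding rhom_mult[OF rhom_peval] der_mult[OF der_pdiff] rhom_add[OF rhom_peval]
    by (simp only: *)
qed

subsection \<open>Derivative operators and the ranking\<close>

lemma zero_in_Theta [simp]: "0 \<in> Theta m"
  by (simp add: Theta_def)

lemma Theta_add: "\<theta> \<in> Theta m \<Longrightarrow> \<theta>' \<in> Theta m \<Longrightarrow> \<theta> + \<theta>' \<in> Theta m"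
  using keys_add[of \<theta> \<theta>'] by (auto simp: Theta_def)

lemma single_in_Theta: "i < m \<Longrightarrow> Poly_Mapping.single i n \<in> Theta m"
  by (simp add: Theta_def)

lemma Theta_minus: "\<theta> \<in> Theta m \<Longrightarrow> \<theta> - \<theta>' \<in> Theta m"
  by (auto simp: Theta_def in_keys_iff subset_iff lookup_minus)

lemma poly_mapping_minus_add:
  fixes \<theta> \<theta>' :: "'k \<Rightarrow>\<^sub>0 nat"
  assumes "\<And>k. Poly_Mapping.lookup \<theta>' k \<le> Poly_Mapping.lookup \<theta> k"
  shows "\<theta> - \<theta>' + \<theta>' = \<theta>"
  using assms by (intro poly_mapping_eqI) (simp add: lookup_add lookup_minus)

lemma Theta_induct [consumes 1, case_names zero step]:
  assumes "\<theta> \<in> Theta m" and zero: "P 0"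
    and step: "\<And>\<theta> i. \<theta> \<in> Theta m \<Longrightarrow> i < m \<Longrightarrow> P \<theta> \<Longrightarrow> P (\<theta> + Poly_Mapping.single i 1)"
  shows "P \<theta>"
  using assms(1)
proof (induction "\<Sum>k<m. Poly_Mapping.lookup \<theta> k" arbitrary: \<theta>)
  case 0
  then have "\<theta> = 0"
    by (intro poly_mapping_eqI) (auto simp: Theta_def in_keys_iff)
  then show ?case using zero by simp
next
  case (Suc n)
  then obtain i where i: "i < m" "Poly_Mapping.lookup \<theta> i \<noteq> 0"
    by (metis (no_types, lifting) Zero_not_Suc lessThan_iff sum.neutral)
  let ?\<theta> = "\<theta> - Poly_Mapping.single i 1"
  have eq: "?\<theta> + Poly_Mapping.single i 1 = \<theta>"
    using i by (intro poly_mapping_minus_add) (auto simp: lookup_single when_def)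
  have "(\<Sum>k<m. Poly_Mapping.lookup (?\<theta> + Poly_Mapping.single i 1) k) = (\<Sum>k<m. Poly_Mapping.lookup ?\<theta> k) + 1"
    using i by (simp add: lookup_add sum.distrib lookup_single when_def)
  then have "n = (\<Sum>k<m. Poly_Mapping.lookup ?\<theta> k)"
    using Suc(2) eq by simp
  from step[OF Theta_minus i(1) Suc(1)[OF this Theta_minus]] show ?case
    using Suc(3) eq by simp
qed

lemma theta_val_zero [simp]: "theta_val m D 0 y = y"
proof -
  have "foldr (\<lambda>i z. (D i ^^ Poly_Mapping.lookup 0 i) z) xs y = y" for xs
    by (induction xs) auto
  then show ?thesis by (simp add: theta_val_def)
qed

text \<open>The fold applies the derivations in a fixed order, so the additional one has to be moved
  outwards past those of smaller index. Everything is relative to \<open>C\<close> because the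
  derivations of the fraction field are controlled only on its carrier.\<close>

lemma theta_val_add_single_on:
  assumes "i < m" and y: "y \<in> C"
    and closed: "\<And>j x. j < m \<Longrightarrow> x \<in> C \<Longrightarrow> D j x \<in> C"
    and comm: "\<And>j x. j < m \<Longrightarrow> x \<in> C \<Longrightarrow> D i (D j x) = D j (D i x)"
  shows "theta_val m D (\<theta> + Poly_Mapping.single i 1) y = D i (theta_val m D \<theta> y)"
proof -
  define F where "F = (\<lambda>\<theta> xs. foldr (\<lambda>i z. (D i ^^ Poly_Mapping.lookup \<theta> i) z) xs y)"
  have pow_closed: "(D j ^^ n) x \<in> C" if "j < m" "x \<in> C" for j n x
    using that by (induction n) (auto intro: closed)
  have F_closed: "F \<theta> xs \<in> C" if "set xs \<subseteq> {..<m}" for \<theta> xs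
    using that by (induction xs) (auto simp: F_def y intro: pow_closed)
  have pow_comm: "D i ((D j ^^ n) x) = (D j ^^ n) (D i x)" if "j < m" "x \<in> C" for j n x
    using that by (induction n) (auto simp: comm pow_closed)
  have 1: "F (\<theta> + Poly_Mapping.single i 1) xs = F \<theta> xs" if "i \<notin> set xs" for xs
    using that by (induction xs) (auto simp: F_def lookup_add lookup_single)
  have "F (\<theta> + Poly_Mapping.single i 1) xs = D i (F \<theta> xs)"
    if "distinct xs" "set xs \<subseteq> {..<m}" "i \<in> set xs" for xs
    using that
  proof (induction xs)
    case (Cons j xs)
    show ?case
    proof (cases "i = j")
      case True
      with Cons 1[of xs] show ?thesis by (simp add: F_def lookup_add)
    next
      case False
      then have "F (\<theta> + Poly_Mapping.single i 1) xs = D i (F \<theta> xs)" using Cons by auto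
      with False Cons(3) F_closed[of xs \<theta>] show ?thesis
        by (simp add: F_def lookup_add lookup_single pow_comm)
    qed
  qed simp
  from this[of "[0..<m]"] show ?thesis using assms(1) by (simp add: F_def theta_val_def atLeast0LessThan)
qed

lemma comm_derivations_der: "comm_derivations m D \<Longrightarrow> i < m \<Longrightarrow> is_der (D i)"
  and comm_derivations_commute: "comm_derivations m D \<Longrightarrow> i < m \<Longrightarrow> j < m \<Longrightarrow> D i (D j x) = D j (D i x)"
  by (auto simp: comm_derivations_def is_der_def)

lemma comm_derivationsI:
  "(\<And>i. i < m \<Longrightarrow> is_der (D i)) \<Longrightarrow> (\<And>i j x. i < m \<Longrightarrow> j < m \<Longrightarrow> D i (D j x) = D j (D i x)) \<Longrightarrow> comm_derivations m D"
  by (auto simp: comm_derivations_def is_der_def)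

lemma theta_val_add_single:
  "comm_derivations m D \<Longrightarrow> i < m \<Longrightarrow> theta_val m D (\<theta> + Poly_Mapping.single i 1) y = D i (theta_val m D \<theta> y)"
  by (rule theta_val_add_single_on[of _ _ _ UNIV]) (auto simp: comm_derivations_commute)

section \<open>The ranking as a well-founded linear order compatible with multiplication\<close>

lemma lex_less_than_add:
  "(xs, ys) \<in> lex less_than \<Longrightarrow> length zs = length xs \<Longrightarrow> (map2 (+) xs zs, map2 (+) ys zs) \<in> lex (less_than :: (nat \<times> nat) set)"
proof (induction xs arbitrary: ys zs)
  case (Cons x xs)
  then show ?case by (cases ys; cases zs) auto
qed simp

lemma lex_less_than_linear:
  "length xs = length ys \<Longrightarrow> xs \<noteq> ys \<Longrightarrow> (xs, ys) \<in> lex less_than \<or> (ys, xs) \<in> lex (less_than :: (nat \<times> nat) set)"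
  by (induction rule: list_induct2) auto

lemma length_rank_key [simp]: "length (rank_key m v) = Suc m"
  by (simp add: rank_key_def)

lemma rank_key_add: "rank_key m (v + w) = map2 (+) (rank_key m v) (rank_key m w)"
  by (simp add: rank_key_def lookup_add sum.distrib map2_map_map)

lemma rank_less_add: "rank_less m v w \<Longrightarrow> rank_less m (v + u) (w + u)"
  unfolding rank_less_def rank_key_add by (rule lex_less_than_add) simp_all

lemma wf_rank_less: "wf {(v, w). rank_less m v w}"
proof -
  have "{(v, w). rank_less m v w} = inv_image (lex less_than) (rank_key m)"
    by (auto simp: rank_less_def inv_image_def)
  then show ?thesis by (simp add: wf_lex)
qed

lemma rank_less_irrefl [simp]: "\<not> rank_less m v v"
  using wf_irrefl[OF wf_rank_less] by blast

lemma lex_length: "(xs, ys) \<in> lex r \<Longrightarrow> length xs = length ys"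
  by (auto simp: lex_conv)

lemma lex_less_than_trans:
  "(xs, ys) \<in> lex less_than \<Longrightarrow> (ys, zs) \<in> lex less_than \<Longrightarrow> (xs, zs) \<in> lex (less_than :: (nat \<times> nat) set)"
proof (induction xs arbitrary: ys zs)
  case (Cons x xs)
  then show ?case by (cases ys; cases zs) (auto dest: lex_length)
qed simp

lemma rank_less_trans: "rank_less m u v \<Longrightarrow> rank_less m v w \<Longrightarrow> rank_less m u w"
  unfolding rank_less_def by (rule lex_less_than_trans)

lemma rank_key_inject:
  assumes "v \<in> Theta m" "w \<in> Theta m" "rank_key m v = rank_key m w"
  shows "v = w"
proof (rule poly_mapping_eqI)
  fix k
  show "Poly_Mapping.lookup v k = Poly_Mapping.lookup w k"
  proof (cases "k < m")
    case True
    then have "k \<in> set (rev [0..<m])" by simp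
    then show ?thesis using assms(3) by (auto simp: rank_key_def)
  next
    case False
    then show ?thesis using assms(1,2) by (auto simp: Theta_def in_keys_iff subset_iff) (metis not_gr0)
  qed
qed

lemma rank_less_linear: "v \<in> Theta m \<Longrightarrow> w \<in> Theta m \<Longrightarrow> v \<noteq> w \<Longrightarrow> rank_less m v w \<or> rank_less m w v"
  unfolding rank_less_def by (rule lex_less_than_linear) (auto dest: rank_key_inject)

lemma rank_less_add_single:
  assumes "i < m"
  shows "rank_less m v (v + Poly_Mapping.single i 1)"
proof -
  have "(\<Sum>k<m. Poly_Mapping.lookup (v + Poly_Mapping.single i 1) k) = (\<Sum>k<m. Poly_Mapping.lookup v k) + 1"
    using assms by (simp add: lookup_add sum.distrib lookup_single when_def)
  then show ?thesis by (simp add: rank_less_def rank_key_def)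
qed

lemma rank_less_add_right: "\<theta> \<in> Theta m \<Longrightarrow> v = \<theta> + v \<or> rank_less m v (\<theta> + v)"
proof (induction rule: Theta_induct)
  case (step \<theta> i)
  have "rank_less m (\<theta> + v) (\<theta> + v + Poly_Mapping.single i 1)"
    by (rule rank_less_add_single[OF step(2)])
  with step(3) show ?case
    by (metis (no_types, lifting) rank_less_trans add.assoc add.commute)
qed simp

text \<open>Values are chosen one at a time along the ranking. The first hypothesis is locality:
  \<open>P v\<close> looks only at the values at \<open>v\<close> and below; the second says that
  the next value can always be chosen.\<close>

lemma rank_recursion:
  fixes P :: "(nat \<Rightarrow>\<^sub>0 nat) \<Rightarrow> ((nat \<Rightarrow>\<^sub>0 nat) \<Rightarrow> 'x) \<Rightarrow> bool"
  assumes local: "\<And>v s s'. v \<in> Theta m \<Longrightarrow> P v s \<Longrightarrow> s v = s' v \<Longrightarrow> (\<And>w. w \<in> Theta m \<Longrightarrow> rank_less m w v \<Longrightarrow> s w = s' w) \<Longrightarrow> P v s'"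
    and ex: "\<And>v s. v \<in> Theta m \<Longrightarrow> (\<And>w. w \<in> Theta m \<Longrightarrow> rank_less m w v \<Longrightarrow> P w s) \<Longrightarrow> \<exists>x. P v (s(v := x))"
  shows "\<exists>s. \<forall>v\<in>Theta m. P v s"
proof -
  define R where "R = {(v, w). rank_less m v w}"
  define s where "s = wfrec R (\<lambda>s v. SOME x. P v (s(v := x)))"
  have s: "s v = (SOME x. P v ((cut s R v)(v := x)))" for v
    unfolding s_def by (subst wfrec) (simp_all add: R_def wf_rank_less)
  have "v \<in> Theta m \<longrightarrow> P v s" for v
  proof (induction v rule: wf_induct_rule[OF wf_rank_less[of m]])
    case (1 v)
    show ?case
    proof
      assume v: "v \<in> Theta m"
      \<comment> \<open>The recursion sees only \<open>cut s R v\<close>, which is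
        \<open>undefined\<close> from \<open>v\<close> upwards. Locality transports the property
        between it and \<open>s\<close>.\<close>
      have "\<exists>x. P v ((cut s R v)(v := x))"
      proof (rule ex[OF v])
        fix w assume w: "w \<in> Theta m" "rank_less m w v"
        with 1 have "P w s" by simp
        then show "P w (cut s R v)"
          by (rule local[OF w(1)]) (use w in \<open>auto simp: cut_def R_def intro: rank_less_trans\<close>)
      qed
      then have "P v ((cut s R v)(v := s v))"
        unfolding s[of v] by (rule someI_ex)
      then show "P v s"
        by (rule local[OF v]) (auto simp: cut_def R_def)
    qed
  qed
  then show ?thesis by blast
qed

subsection \<open>The fraction field of a quotient by a prime differential ideal\<close>

text \<open>The fractions with denominator outside \<^term>\<open>P\<close> are coded into the type \<^typ>\<open>'k\<close>
  by applying \<^term>\<open>enc\<close> to a chosen representative.\<close>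

locale prime_fractions =
  fixes P :: "'b::comm_ring_1 set" and enc :: "'b \<times> 'b \<Rightarrow> 'k" and m :: nat and d :: "nat \<Rightarrow> 'b \<Rightarrow> 'b"
  assumes ideal: "is_ideal P" and proper: "1 \<notin> P" and prime: "x * y \<in> P \<Longrightarrow> x \<in> P \<or> y \<in> P"
    and inj: "inj enc" and der: "comm_derivations m d" and stable: "i < m \<Longrightarrow> x \<in> P \<Longrightarrow> d i x \<in> P"
begin

text \<open>Membership in \<open>P\<close> is proved below by naming the coefficients
  \<open>r\<close> and \<open>s\<close>; the identity that remains is plain normalisation.\<close>

lemma comb: "x \<in> P \<Longrightarrow> y \<in> P \<Longrightarrow> z = r * x + s * y \<Longrightarrow> z \<in> P"
  and zero: "0 \<in> P"
  using ideal by (auto simp: is_ideal_def)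

lemma comb1: "x \<in> P \<Longrightarrow> z = r * x \<Longrightarrow> z \<in> P"
  using ideal by (auto simp: is_ideal_def)

lemma mult_notin: "x \<notin> P \<Longrightarrow> y \<notin> P \<Longrightarrow> x * y \<notin> P"
  using prime by blast

text \<open>Equivalent pairs satisfy the same predicate under \<open>SOME\<close>, so equal
  fractions receive the same code and equality in \<open>'k\<close> is equality of
  fractions.\<close>

definition fr :: "'b \<Rightarrow> 'b \<Rightarrow> 'k" where
  "fr p q = enc (SOME z. snd z \<notin> P \<and> p * snd z - fst z * q \<in> P)"

definition num :: "'k \<Rightarrow> 'b" where "num x = fst (inv_into UNIV enc x)"
definition den :: "'k \<Rightarrow> 'b" where "den x = snd (inv_into UNIV enc x)"

lemma fr_rep:
  assumes "q \<notin> P"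
  shows "den (fr p q) \<notin> P" and "p * den (fr p q) - num (fr p q) * q \<in> P"
proof -
  have "\<exists>z. snd z \<notin> P \<and> p * snd z - fst z * q \<in> P"
    by (rule exI[of _ "(p, q)"]) (use assms zero in simp)
  from someI_ex[OF this] show "den (fr p q) \<notin> P" "p * den (fr p q) - num (fr p q) * q \<in> P"
    by (simp_all add: den_def num_def fr_def inv_f_f[OF inj])
qed

text \<open>Cancellation of the middle denominator is where primality enters.\<close>

lemma cross_trans:
  assumes "q' \<notin> P" "p * q' - p' * q \<in> P" "p' * q'' - p'' * q' \<in> P"
  shows "p * q'' - p'' * q \<in> P"
proof -
  have "q' * (p * q'' - p'' * q) \<in> P"
    by (rule comb[OF assms(2,3), of _ q'' q]) (simp add: algebra_simps)
  with prime assms(1) show ?thesis by blast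
qed

lemma cross_sym: "p * q' - p' * q \<in> P \<Longrightarrow> p' * q - p * q' \<in> P"
  by (erule comb1[of _ _ "-1"]) simp

lemma fr_eq_iff:
  assumes "q \<notin> P" "q' \<notin> P"
  shows "fr p q = fr p' q' \<longleftrightarrow> p * q' - p' * q \<in> P"
proof
  assume eq: "fr p q = fr p' q'"
  show "p * q' - p' * q \<in> P"
    by (rule cross_trans[OF fr_rep(1)[OF assms(1)] fr_rep(2)[OF assms(1)]])
      (use cross_sym[OF fr_rep(2)[OF assms(2), of p']] eq in simp)
next
  assume *: "p * q' - p' * q \<in> P"
  have "(\<lambda>z. snd z \<notin> P \<and> p * snd z - fst z * q \<in> P) = (\<lambda>z. snd z \<notin> P \<and> p' * snd z - fst z * q' \<in> P)"
    using cross_trans[OF assms(2) *] cross_trans[OF assms(1) cross_sym[OF *]] by (intro ext) blast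
  then show "fr p q = fr p' q'" by (simp add: fr_def)
qed

definition K :: "'k ring" where
  "K = \<lparr>carrier = {fr p q | p q. q \<notin> P},
    Group.monoid.mult = (\<lambda>x y. fr (num x * num y) (den x * den y)), one = fr 1 1, zero = fr 0 1,
    add = (\<lambda>x y. fr (num x * den y + num y * den x) (den x * den y))\<rparr>"

definition dK :: "nat \<Rightarrow> 'k \<Rightarrow> 'k" where
  "dK i x = fr (d i (num x) * den x - num x * d i (den x)) (den x * den x)"

lemma carrier_K: "x \<in> carrier K \<longleftrightarrow> (\<exists>p q. q \<notin> P \<and> x = fr p q)"
  by (auto simp: K_def)

lemma carrier_K_E: "x \<in> carrier K \<Longrightarrow> (\<And>p q. q \<notin> P \<Longrightarrow> x = fr p q \<Longrightarrow> thesis) \<Longrightarrow> thesis"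
  by (auto simp: carrier_K)

lemma fr_carrier: "q \<notin> P \<Longrightarrow> fr p q \<in> carrier K"
  by (auto simp: carrier_K)

lemma one_K: "\<one>\<^bsub>K\<^esub> = fr 1 1" and zero_K: "\<zero>\<^bsub>K\<^esub> = fr 0 1"
  by (simp_all add: K_def)

text \<open>The operations of \<open>K\<close> work on decoded representatives; this shows
  independence of them. The coefficients arise by exchanging one factor at a time.\<close>

lemma mult_K:
  assumes "q \<notin> P" "q' \<notin> P"
  shows "fr p q \<otimes>\<^bsub>K\<^esub> fr p' q' = fr (p * p') (q * q')"
proof -
  let ?n = "num (fr p q)" and ?d = "den (fr p q)" and ?n' = "num (fr p' q')" and ?d' = "den (fr p' q')"
  have "(?n * ?n') * (q * q') - (p * p') * (?d * ?d') \<in> P"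
    by (rule comb[OF fr_rep(2)[OF assms(1), of p] fr_rep(2)[OF assms(2), of p'], of _ "- (?n' * q')" "- (p * ?d)"])
      (simp add: algebra_simps)
  then show ?thesis
    using assms by (simp add: K_def fr_eq_iff mult_notin fr_rep)
qed

lemma add_K:
  assumes "q \<notin> P" "q' \<notin> P"
  shows "fr p q \<oplus>\<^bsub>K\<^esub> fr p' q' = fr (p * q' + p' * q) (q * q')"
proof -
  let ?n = "num (fr p q)" and ?d = "den (fr p q)" and ?n' = "num (fr p' q')" and ?d' = "den (fr p' q')"
  have "(?n * ?d' + ?n' * ?d) * (q * q') - (p * q' + p' * q) * (?d * ?d') \<in> P"
    by (rule comb[OF fr_rep(2)[OF assms(1), of p] fr_rep(2)[OF assms(2), of p'], of _ "- (?d' * q')" "- (q * ?d)"])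
      (simp add: algebra_simps)
  then show ?thesis
    using assms by (simp add: K_def fr_eq_iff mult_notin fr_rep)
qed

text \<open>The quotient rule does not depend on the representative because \<open>P\<close>
  contains, with the relation between two representatives, also the derivative of that
  relation.\<close>

lemma dK_fr:
  assumes "i < m" "q \<notin> P"
  shows "dK i (fr p q) = fr (d i p * q - p * d i q) (q * q)"
proof -
  let ?n = "num (fr p q)" and ?d = "den (fr p q)"
  note D = comm_derivations_der[OF der assms(1)]
  have "(d i ?n * ?d - ?n * d i ?d) * (q * q) - (d i p * q - p * d i q) * (?d * ?d) \<in> P"
    by (rule comb[OF fr_rep(2)[OF assms(2), of p] stable[OF assms(1) fr_rep(2)[OF assms(2), of p]],
          of _ "d i q * ?d + q * d i ?d" "- (q * ?d)"])
      (simp add: der_diff[OF D] der_mult[OF D] algebra_simps)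
  then show ?thesis
    using assms by (simp add: dK_def fr_eq_iff mult_notin fr_rep)
qed

lemma fr_eqI: "q \<notin> P \<Longrightarrow> q' \<notin> P \<Longrightarrow> p * q' = p' * q \<Longrightarrow> fr p q = fr p' q'"
  by (simp add: fr_eq_iff zero)

lemma abelian_group_K: "abelian_group K"
proof (rule abelian_groupI)
  show "\<exists>y\<in>carrier K. y \<oplus>\<^bsub>K\<^esub> x = \<zero>\<^bsub>K\<^esub>" if "x \<in> carrier K" for x
  proof -
    from that obtain p q where x: "q \<notin> P" "x = fr p q" by (auto simp: carrier_K)
    then show ?thesis
      by (intro bexI[of _ "fr (- p) q"]) (auto simp: add_K zero_K fr_eq_iff mult_notin proper zero fr_carrier)
  qed
qed (auto elim!: carrier_K_E simp: fr_carrier add_K zero_K mult_notin proper algebra_simps intro!: fr_eqI)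

lemma comm_monoid_K: "Group.comm_monoid K"
  by (rule comm_monoidI)
    (auto elim!: carrier_K_E simp: fr_carrier mult_K one_K mult_notin proper algebra_simps intro!: fr_eqI)

lemma cring_K: "cring K"
proof (rule cringI[OF abelian_group_K comm_monoid_K])
  fix x y z assume "x \<in> carrier K" "y \<in> carrier K" "z \<in> carrier K"
  then obtain p q p' q' p'' q'' where *: "q \<notin> P" "q' \<notin> P" "q'' \<notin> P" "x = fr p q" "y = fr p' q'" "z = fr p'' q''"
    by (auto simp: carrier_K)
  show "(x \<oplus>\<^bsub>K\<^esub> y) \<otimes>\<^bsub>K\<^esub> z = x \<otimes>\<^bsub>K\<^esub> z \<oplus>\<^bsub>K\<^esub> y \<otimes>\<^bsub>K\<^esub> z"
    unfolding * using *(1-3) by (simp add: mult_K add_K mult_notin, intro fr_eqI) (simp_all add: mult_notin algebra_simps)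
qed

lemma fr_eq_zero_iff: "q \<notin> P \<Longrightarrow> fr p q = \<zero>\<^bsub>K\<^esub> \<longleftrightarrow> p \<in> P"
  by (simp add: zero_K fr_eq_iff proper)

lemma field_K: "field K"
proof (rule cring.cring_fieldI[OF cring_K])
  interpret cring K by (rule cring_K)
  have "x \<in> Units K" if "x \<in> carrier K" "x \<noteq> \<zero>\<^bsub>K\<^esub>" for x
  proof -
    from that obtain p q where x: "q \<notin> P" "x = fr p q" "p \<notin> P" by (auto simp: carrier_K fr_eq_zero_iff)
    then have "x \<otimes>\<^bsub>K\<^esub> fr q p = \<one>\<^bsub>K\<^esub>" "fr q p \<otimes>\<^bsub>K\<^esub> x = \<one>\<^bsub>K\<^esub>"
      by (auto simp: mult_K one_K mult_notin proper intro!: fr_eqI)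
    with x show ?thesis by (auto simp: Units_def intro!: bexI[of _ "fr q p"] fr_carrier)
  qed
  moreover have "\<one>\<^bsub>K\<^esub> \<noteq> \<zero>\<^bsub>K\<^esub>" by (simp add: one_K fr_eq_zero_iff proper)
  then have "\<zero>\<^bsub>K\<^esub> \<notin> Units K"
    by (metis Units_r_inv_ex l_null Units_closed)
  ultimately show "Units K = carrier K - {\<zero>\<^bsub>K\<^esub>}"
    by (auto intro: Units_closed)
qed

lemma dK_closed: "i < m \<Longrightarrow> x \<in> carrier K \<Longrightarrow> dK i x \<in> carrier K"
  by (auto elim!: carrier_K_E simp: dK_fr fr_carrier mult_notin)

lemma dK_add:
  assumes "i < m" "x \<in> carrier K" "y \<in> carrier K"
  shows "dK i (x \<oplus>\<^bsub>K\<^esub> y) = dK i x \<oplus>\<^bsub>K\<^esub> dK i y"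
proof -
  note D = comm_derivations_der[OF der assms(1)]
  from assms obtain p q p' q' where *: "q \<notin> P" "q' \<notin> P" "x = fr p q" "y = fr p' q'"
    by (auto simp: carrier_K)
  show ?thesis
    unfolding * using *(1,2) assms(1)
    by (simp add: add_K dK_fr mult_notin, intro fr_eqI)
      (simp_all add: mult_notin der_add[OF D] der_mult[OF D] algebra_simps)
qed

lemma dK_mult:
  assumes "i < m" "x \<in> carrier K" "y \<in> carrier K"
  shows "dK i (x \<otimes>\<^bsub>K\<^esub> y) = dK i x \<otimes>\<^bsub>K\<^esub> y \<oplus>\<^bsub>K\<^esub> x \<otimes>\<^bsub>K\<^esub> dK i y"
proof -
  note D = comm_derivations_der[OF der assms(1)]
  from assms obtain p q p' q' where *: "q \<notin> P" "q' \<notin> P" "x = fr p q" "y = fr p' q'"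
    by (auto simp: carrier_K)
  show ?thesis
    unfolding * using *(1,2) assms(1)
    by (simp add: add_K mult_K dK_fr mult_notin, intro fr_eqI)
      (simp_all add: mult_notin der_add[OF D] der_mult[OF D] algebra_simps)
qed

lemma dK_commute:
  assumes "i < m" "j < m" "x \<in> carrier K"
  shows "dK i (dK j x) = dK j (dK i x)"
proof -
  note D = comm_derivations_der[OF der assms(1)] and D' = comm_derivations_der[OF der assms(2)]
  from assms obtain p q where *: "q \<notin> P" "x = fr p q" by (auto simp: carrier_K)
  show ?thesis
    unfolding * using *(1) assms(1,2) comm_derivations_commute[OF der assms(1,2)]
    by (simp add: dK_fr mult_notin, intro fr_eqI)
      (simp_all add: mult_notin der_diff[OF D] der_mult[OF D] der_diff[OF D'] der_mult[OF D'] algebra_simps)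
qed

abbreviation cls :: "'b \<Rightarrow> 'k" where "cls p \<equiv> fr p 1"

lemma cls_carrier: "cls p \<in> carrier K"
  by (simp add: fr_carrier proper)

lemma cls_add: "cls (p + q) = cls p \<oplus>\<^bsub>K\<^esub> cls q"
  and cls_mult: "cls (p * q) = cls p \<otimes>\<^bsub>K\<^esub> cls q"
  by (simp_all add: add_K mult_K proper)

lemma dK_cls: "i < m \<Longrightarrow> dK i (cls p) = cls (d i p)"
  by (simp add: dK_fr proper der_one[OF comm_derivations_der[OF der]])

lemma cls_eq_zero_iff: "cls p = \<zero>\<^bsub>K\<^esub> \<longleftrightarrow> p \<in> P"
  by (simp add: fr_eq_zero_iff proper)

lemma cls_sum: "finite A \<Longrightarrow> cls (sum g A) = finsum K (\<lambda>x. cls (g x)) A"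
proof (induction A rule: finite_induct)
  case empty
  interpret cring K by (rule cring_K)
  show ?case by (simp add: zero_K)
next
  case (insert x A)
  interpret cring K by (rule cring_K)
  show ?case using insert by (simp add: cls_add cls_carrier Pi_def)
qed

lemma cls_power: "cls (x ^ n) = cls x [^]\<^bsub>K\<^esub> n"
proof -
  interpret cring K by (rule cring_K)
  show ?thesis by (induction n) (simp_all add: one_K cls_mult m_comm cls_carrier)
qed

lemma cls_prod: "finite A \<Longrightarrow> cls (prod g A) = finprod K (\<lambda>x. cls (g x)) A"
proof (induction A rule: finite_induct)
  case empty
  interpret cring K by (rule cring_K)
  show ?case by (simp add: one_K)
next
  case (insert x A)
  interpret cring K by (rule cring_K)
  show ?case using insert by (simp add: cls_mult cls_carrier Pi_def)
qed

end

subsection \<open>Zeros of prime differential ideals\<close>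

text \<open>Differential polynomials in many unknowns: the indeterminate
  \<open>(j, \<theta>)\<close> is the \<open>\<theta>\<close>-derivative of the \<open>j\<close>-th
  unknown, in the format used by \<open>differentially_closed\<close>.\<close>

definition ydder :: "(nat \<Rightarrow> 'c::comm_ring_1 \<Rightarrow> 'c) \<Rightarrow> nat \<Rightarrow>
    ((nat \<times> (nat \<Rightarrow>\<^sub>0 nat) \<Rightarrow>\<^sub>0 nat) \<Rightarrow>\<^sub>0 'c) \<Rightarrow> (nat \<times> (nat \<Rightarrow>\<^sub>0 nat) \<Rightarrow>\<^sub>0 nat) \<Rightarrow>\<^sub>0 'c" where
  "ydder D i = poly_der (D i) (\<lambda>(j, \<theta>). pvar (j, \<theta> + Poly_Mapping.single i 1))"

lemma comm_derivations_ydder: "comm_derivations m D \<Longrightarrow> comm_derivations m (ydder D)"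
  unfolding ydder_def
  by (rule comm_derivationsI)
    (auto intro!: der_poly_der poly_der_commute simp: comm_derivations_der comm_derivations_commute poly_der_pvar add_ac)

lemma comm_derivations_dder: "comm_derivations m D \<Longrightarrow> comm_derivations m (dder D)"
  unfolding dder_eq_poly_der
  by (rule comm_derivationsI)
    (auto intro!: der_poly_der poly_der_commute simp: comm_derivations_der comm_derivations_commute poly_der_pvar add_ac)

lemma ydder_const: "comm_derivations m D \<Longrightarrow> i < m \<Longrightarrow> ydder D i (Poly_Mapping.single 0 c) = Poly_Mapping.single 0 (D i c)"
  and ydder_pvar: "comm_derivations m D \<Longrightarrow> i < m \<Longrightarrow> ydder D i (pvar (j, \<theta>)) = pvar (j, \<theta> + Poly_Mapping.single i 1)"
  by (simp_all add: ydder_def poly_der_const poly_der_pvar comm_derivations_der)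

section \<open>Coding pairs of polynomials into the type \<open>'a \<times> nat\<close>\<close>

definition pm_list :: "('k \<Rightarrow>\<^sub>0 'c::zero) \<Rightarrow> ('k \<times> 'c) list" where
  "pm_list f = map (\<lambda>k. (k, Poly_Mapping.lookup f k)) (SOME xs. set xs = Poly_Mapping.keys f)"

lemma inj_pm_list: "inj (pm_list :: ('k \<Rightarrow>\<^sub>0 'c::zero) \<Rightarrow> _)"
proof (rule injI)
  fix f g :: "'k \<Rightarrow>\<^sub>0 'c" assume eq: "pm_list f = pm_list g"
  have set: "set (pm_list f) = (\<lambda>k. (k, Poly_Mapping.lookup f k)) ` Poly_Mapping.keys f" for f :: "'k \<Rightarrow>\<^sub>0 'c"
    using someI_ex[OF finite_list[OF finite_keys[of f]]] by (simp add: pm_list_def)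
  have *: "(k, c) \<in> set (pm_list f) \<longleftrightarrow> c \<noteq> 0 \<and> Poly_Mapping.lookup f k = c" for f :: "'k \<Rightarrow>\<^sub>0 'c" and k c
    unfolding set by (auto simp: in_keys_iff)
  show "f = g"
  proof (rule poly_mapping_eqI)
    fix k show "Poly_Mapping.lookup f k = Poly_Mapping.lookup g k"
      using *[of k "Poly_Mapping.lookup f k" f] *[of k "Poly_Mapping.lookup f k" g] *[of k "Poly_Mapping.lookup g k" f]
        *[of k "Poly_Mapping.lookup g k" g] eq by metis
  qed
qed

text \<open>Makes the monomials a countable type, so that the support of a polynomial can be coded
  by a natural number.\<close>

instance poly_mapping :: (countable, "{zero, countable}") countable
  by standard (rule exI[of _ "\<lambda>f. to_nat (pm_list f)"], auto intro!: injI dest: injD[OF inj_pm_list])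

lemma infinite_pair_inj:
  assumes "infinite (UNIV :: 'a set)"
  shows "\<exists>g :: 'a \<times> 'a \<Rightarrow> 'a. inj g"
  using card_of_Times_same_infinite[OF assms] card_of_ordLeq[of "UNIV \<times> UNIV :: ('a \<times> 'a) set" "UNIV :: 'a set"]
  by (auto dest!: ordIso_imp_ordLeq)

text \<open>All coefficients are packed into one element by an injection of
  \<open>'a \<times> 'a\<close> into \<open>'a\<close>, all monomials into one natural number. The
  target is the carrier type over which \<open>differentially_closed\<close> quantifies.\<close>

lemma poly_pair_inj:
  assumes "infinite (UNIV :: 'a::zero set)"
  shows "\<exists>enc :: ('k::countable \<Rightarrow>\<^sub>0 'a) \<times> ('k \<Rightarrow>\<^sub>0 'a) \<Rightarrow> 'a \<times> nat. inj enc"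
proof -
  from infinite_pair_inj[OF assms] obtain g :: "'a \<times> 'a \<Rightarrow> 'a" where g: "inj g" by blast
  \<comment> \<open>This folding forgets the length of the list. It is recovered from the list of
    monomials stored in the second component.\<close>
  define G where "G = (\<lambda>xs. foldr (\<lambda>x y. g (x, y)) xs undefined)"
  have G: "xs = ys" if "length xs = length ys" "G xs = G ys" for xs ys
    using that by (induction xs ys rule: list_induct2) (auto simp: G_def dest: injD[OF g])
  define E where "E = (\<lambda>f :: 'k \<Rightarrow>\<^sub>0 'a. (G (map snd (pm_list f)), to_nat (map fst (pm_list f))))"
  have E: "f = f'" if "E f = E f'" for f f'
  proof -
    from that have 1: "map fst (pm_list f) = map fst (pm_list f')" by (simp add: E_def)
    then have "length (pm_list f) = length (pm_list f')" by (metis length_map)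
    with that have "map snd (pm_list f) = map snd (pm_list f')" by (intro G) (auto simp: E_def)
    with 1 have "pm_list f = pm_list f'" by (metis zip_map_fst_snd)
    then show ?thesis by (rule injD[OF inj_pm_list])
  qed
  show ?thesis
    by (rule exI[of _ "\<lambda>(f, f'). (g (fst (E f), fst (E f')), to_nat (snd (E f), snd (E f')))"])
      (auto intro!: injI E prod_eqI dest!: injD[OF g])
qed

text \<open>In the fraction field of the quotient by \<open>P\<close> the classes of the
  indeterminates are a zero of every member of \<open>P\<close>; differential closedness brings a
  zero of the finite part \<open>F\<close> down to the base field.\<close>

lemma differentially_closed_zero:
  fixes D :: "nat \<Rightarrow> 'a::field_char_0 \<Rightarrow> 'a" and P :: "((nat \<times> (nat \<Rightarrow>\<^sub>0 nat) \<Rightarrow>\<^sub>0 nat) \<Rightarrow>\<^sub>0 'a) set"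
  assumes dc: "differentially_closed m D"
    and ideal: "is_ideal P" and proper: "1 \<notin> P" and prime: "\<And>x y. x * y \<in> P \<Longrightarrow> x \<in> P \<or> y \<in> P"
    and stable: "\<And>i x. i < m \<Longrightarrow> x \<in> P \<Longrightarrow> ydder D i x \<in> P"
    and F: "finite F" "F \<subseteq> P" and vars: "\<And>f. f \<in> F \<Longrightarrow> pvars f \<subseteq> UNIV \<times> Theta m"
  shows "\<exists>z. \<forall>f\<in>F. peval (\<lambda>(j, \<theta>). theta_val m D \<theta> (z j)) f = 0"
proof -
  have D: "comm_derivations m D" using dc by (simp add: differentially_closed_def)
  obtain enc :: "((nat \<times> (nat \<Rightarrow>\<^sub>0 nat) \<Rightarrow>\<^sub>0 nat) \<Rightarrow>\<^sub>0 'a) \<times> ((nat \<times> (nat \<Rightarrow>\<^sub>0 nat) \<Rightarrow>\<^sub>0 nat) \<Rightarrow>\<^sub>0 'a) \<Rightarrow> 'a \<times> nat"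
    where enc: "inj enc"
    using poly_pair_inj[OF infinite_UNIV_char_0] by blast
  interpret prime_fractions P enc m "ydder D"
    by unfold_locales (fact ideal proper prime enc comm_derivations_ydder[OF D] stable)+
  interpret K: field K by (rule field_K)
  define h where "h = (\<lambda>c. cls (Poly_Mapping.single 0 c))"
  define y where "y = (\<lambda>j. cls (pvar (j, 0)))"
  \<comment> \<open>A nonzero constant in \<open>P\<close> would, multiplied by its inverse, give 1
    in \<open>P\<close>.\<close>
  have h_diff: "h (x - x') = \<zero>\<^bsub>K\<^esub> \<longleftrightarrow> x = x'" for x x'
  proof
    assume "h (x - x') = \<zero>\<^bsub>K\<^esub>"
    then have "Poly_Mapping.single 0 (x - x') \<in> P" by (simp add: h_def cls_eq_zero_iff)
    then have "x \<noteq> x' \<longrightarrow> 1 \<in> P"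
      using comb1[of "Poly_Mapping.single 0 (x - x')" 1 "Poly_Mapping.single 0 (inverse (x - x'))"] by (simp add: mult_single)
    with proper show "x = x'" by blast
  qed (simp add: h_def cls_eq_zero_iff zero)
  have "inj h"
  proof (rule injI)
    fix x x' assume "h x = h x'"
    then have "Poly_Mapping.single 0 (x - x') \<in> P" by (simp add: h_def fr_eq_iff proper single_diff)
    then show "x = x'" using h_diff[of x x'] by (simp add: h_def cls_eq_zero_iff)
  qed
  then have ext: "diff_field_ext m D K dK h"
    unfolding diff_field_ext_def
    by (auto simp: field_K h_def cls_carrier single_add cls_add one_K dK_closed dK_add dK_mult dK_commute dK_cls
        ydder_const[OF D] mult_single simp flip: cls_mult)
  have theta: "theta_val m dK \<theta> (y j) = cls (pvar (j, \<theta>))" if "\<theta> \<in> Theta m" for \<theta> j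
    using that
  proof (induction rule: Theta_induct)
    case (step \<theta> i)
    have "theta_val m dK (\<theta> + Poly_Mapping.single i 1) (y j) = dK i (theta_val m dK \<theta> (y j))"
      by (rule theta_val_add_single_on[of _ _ _ "carrier K"]) (auto simp: step y_def cls_carrier dK_closed dK_commute)
    then show ?case using step(2,3) by (simp add: dK_cls ydder_pvar[OF D])
  qed (simp add: y_def)
  have keval: "keval K h (\<lambda>(j, \<theta>). theta_val m dK \<theta> (y j)) f = cls f" if "pvars f \<subseteq> UNIV \<times> Theta m" for f
  proof -
    have "cls f = cls (\<Sum>\<mu>\<in>Poly_Mapping.keys f. Poly_Mapping.single 0 (Poly_Mapping.lookup f \<mu>) * mon_eval pvar \<mu>)"
      using poly_hom_const_pvar[of f] by (simp add: poly_hom_def)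
    also have "\<dots> = finsum K (\<lambda>\<mu>. h (Poly_Mapping.lookup f \<mu>) \<otimes>\<^bsub>K\<^esub>
        finprod K (\<lambda>v. cls (pvar v) [^]\<^bsub>K\<^esub> Poly_Mapping.lookup \<mu> v) (Poly_Mapping.keys \<mu>)) (Poly_Mapping.keys f)"
      by (simp add: cls_sum cls_mult mon_eval_def cls_prod cls_power h_def)
    also have "\<dots> = keval K h (\<lambda>(j, \<theta>). theta_val m dK \<theta> (y j)) f"
      unfolding keval_def
    proof (intro K.finsum_cong' refl arg_cong2[of _ _ _ _ "(\<otimes>\<^bsub>K\<^esub>)"] K.finprod_cong')
      fix \<mu> v assume "\<mu> \<in> Poly_Mapping.keys f" "v \<in> Poly_Mapping.keys \<mu>"
      then have "snd v \<in> Theta m" using that by (auto simp: pvars_def)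
      then show "cls (pvar v) [^]\<^bsub>K\<^esub> Poly_Mapping.lookup \<mu> v =
          (case v of (j, \<theta>) \<Rightarrow> theta_val m dK \<theta> (y j)) [^]\<^bsub>K\<^esub> Poly_Mapping.lookup \<mu> v"
        by (cases v) (simp add: theta)
    next
      fix \<mu> assume \<mu>: "\<mu> \<in> Poly_Mapping.keys f"
      show "(\<lambda>v. (case v of (j, \<theta>) \<Rightarrow> theta_val m dK \<theta> (y j)) [^]\<^bsub>K\<^esub> Poly_Mapping.lookup \<mu> v) \<in> Poly_Mapping.keys \<mu> \<rightarrow> carrier K"
      proof (rule Pi_I)
        fix v assume "v \<in> Poly_Mapping.keys \<mu>"
        then have "snd v \<in> Theta m" using that \<mu> by (auto simp: pvars_def)
        then show "(case v of (j, \<theta>) \<Rightarrow> theta_val m dK \<theta> (y j)) [^]\<^bsub>K\<^esub> Poly_Mapping.lookup \<mu> v \<in> carrier K"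
          by (cases v) (simp add: theta cls_carrier)
      qed
    next
      show "(\<lambda>\<mu>. h (Poly_Mapping.lookup f \<mu>) \<otimes>\<^bsub>K\<^esub> finprod K (\<lambda>v. (case v of (j, \<theta>) \<Rightarrow> theta_val m dK \<theta> (y j)) [^]\<^bsub>K\<^esub> Poly_Mapping.lookup \<mu> v)
          (Poly_Mapping.keys \<mu>)) \<in> Poly_Mapping.keys f \<rightarrow> carrier K"
      proof (rule Pi_I)
        fix \<mu> assume \<mu>: "\<mu> \<in> Poly_Mapping.keys f"
        show "h (Poly_Mapping.lookup f \<mu>) \<otimes>\<^bsub>K\<^esub> finprod K (\<lambda>v. (case v of (j, \<theta>) \<Rightarrow> theta_val m dK \<theta> (y j)) [^]\<^bsub>K\<^esub> Poly_Mapping.lookup \<mu> v)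
          (Poly_Mapping.keys \<mu>) \<in> carrier K"
        proof (intro K.m_closed K.finprod_closed Pi_I)
          fix v assume "v \<in> Poly_Mapping.keys \<mu>"
          then have "snd v \<in> Theta m" using that \<mu> by (auto simp: pvars_def)
          then show "(case v of (j, \<theta>) \<Rightarrow> theta_val m dK \<theta> (y j)) [^]\<^bsub>K\<^esub> Poly_Mapping.lookup \<mu> v \<in> carrier K"
            by (cases v) (simp add: theta cls_carrier)
        qed (simp add: h_def cls_carrier)
      qed
    qed
    finally show ?thesis by simp
  qed
  \<comment> \<open>The inequation is taken to be that of the polynomial 1, whose class is nonzero
    because \<open>P\<close> is proper.\<close>
  have "\<exists>z. (\<forall>f\<in>F. peval (\<lambda>(j, \<theta>). theta_val m D \<theta> (z j)) f = 0) \<and>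
      peval (\<lambda>(j, \<theta>). theta_val m D \<theta> (z j)) 1 \<noteq> 0"
  proof (rule dc[unfolded differentially_closed_def, THEN conjunct2, rule_format], intro conjI exI)
    show "\<forall>f\<in>insert 1 F. \<forall>(j, \<theta>)\<in>pvars f. \<theta> \<in> Theta m" using vars by fastforce
    show "\<forall>f\<in>F. keval K h (\<lambda>(j, \<theta>). theta_val m dK \<theta> (y j)) f = \<zero>\<^bsub>K\<^esub>"
      using vars F by (auto simp: keval cls_eq_zero_iff)
    show "keval K h (\<lambda>(j, \<theta>). theta_val m dK \<theta> (y j)) 1 \<noteq> \<zero>\<^bsub>K\<^esub>"
      using proper by (simp add: keval cls_eq_zero_iff)
  qed (use F ext in \<open>auto simp: y_def cls_carrier\<close>)
  then show ?thesis by blast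
qed

subsection \<open>Local finite-dimensional algebras\<close>

text \<open>Krull's theorem: Zorn's lemma for the ideals above \<open>I\<close> that avoid 1, a
  condition preserved by unions of chains.\<close>

lemma proper_ideal_subset_maximal:
  fixes I :: "'r::comm_ring_1 set"
  assumes "is_ideal I" "1 \<notin> I"
  shows "\<exists>J. maximal_ideal J \<and> I \<subseteq> J"
proof -
  let ?A = "{J. is_ideal J \<and> I \<subseteq> J \<and> 1 \<notin> J}"
  have "\<exists>J\<in>?A. \<forall>X\<in>?A. J \<subseteq> X \<longrightarrow> X = J"
  proof (rule subset_Zorn_nonempty)
    fix C assume C: "C \<noteq> {}" "subset.chain ?A C"
    then have sub: "C \<subseteq> ?A" and lin: "\<And>X Y. X \<in> C \<Longrightarrow> Y \<in> C \<Longrightarrow> X \<subseteq> Y \<or> Y \<subseteq> X"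
      by (auto simp: subset.chain_def)
    have ideals: "is_ideal X" if "X \<in> C" for X using sub that by auto
    have "x + y \<in> \<Union>C" if "x \<in> \<Union>C" "y \<in> \<Union>C" for x y
    proof -
      from that obtain X Y where XY: "X \<in> C" "Y \<in> C" "x \<in> X" "y \<in> Y" by blast
      from lin[OF XY(1,2)] show ?thesis
      proof
        assume "X \<subseteq> Y"
        then have "x + y \<in> Y" using ideals[OF XY(2)] XY(3,4) by (auto simp: is_ideal_def)
        then show ?thesis using XY by blast
      next
        assume "Y \<subseteq> X"
        then have "x + y \<in> X" using ideals[OF XY(1)] XY(3,4) by (auto simp: is_ideal_def)
        then show ?thesis using XY by blast
      qed
    qed
    moreover have "r * x \<in> \<Union>C" if x: "x \<in> \<Union>C" for x r
    proof -
      from x obtain X where "X \<in> C" "x \<in> X" by blast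
      moreover from this have "r * x \<in> X" using ideals[of X] by (auto simp: is_ideal_def)
      ultimately show ?thesis by blast
    qed
    moreover have "0 \<in> \<Union>C"
    proof -
      from C(1) obtain X where "X \<in> C" by blast
      moreover from this have "0 \<in> X" using ideals[of X] by (auto simp: is_ideal_def)
      ultimately show ?thesis by blast
    qed
    ultimately have "is_ideal (\<Union>C)" by (simp add: is_ideal_def)
    with C(1) sub show "\<Union>C \<in> ?A" by blast
  qed (use assms in auto)
  then obtain J where "J \<in> ?A" and max: "\<forall>X\<in>?A. J \<subseteq> X \<longrightarrow> X = J" by (rule bexE)
  then have J: "is_ideal J" "I \<subseteq> J" "1 \<notin> J" by simp_all
  have "X = J \<or> X = UNIV" if X: "is_ideal X" "J \<subseteq> X" for X
  proof (cases "1 \<in> X")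
    case True
    then have "r * 1 \<in> X" for r using X(1) unfolding is_ideal_def by blast
    then have "X = UNIV" by auto
    then show ?thesis by blast
  next
    case False
    with X J have "X \<in> ?A" by auto
    then show ?thesis using max X(2) by blast
  qed
  with J have "maximal_ideal J" by (auto simp: maximal_ideal_def)
  with J show ?thesis by blast
qed

section \<open>Univariate polynomials evaluated through a homomorphism\<close>

lemma poly_map_poly_pCons:
  "is_rhom \<phi> \<Longrightarrow> poly (map_poly \<phi> (pCons a p)) x = \<phi> a + x * poly (map_poly \<phi> p) x"
  by (simp add: map_poly_pCons rhom_zero)

lemma rhom_poly_map_poly:
  assumes "is_rhom \<phi>"
  shows "is_rhom (\<lambda>p. poly (map_poly \<phi> p) x)"
proof -
  note pC = poly_map_poly_pCons[OF assms]
  have add: "poly (map_poly \<phi> (p + q)) x = poly (map_poly \<phi> p) x + poly (map_poly \<phi> q) x" for p q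
  proof (induction p arbitrary: q)
    case (pCons a p)
    obtain b q' where "q = pCons b q'" by (cases q)
    then show ?case by (simp add: pC pCons.IH rhom_add[OF assms] algebra_simps)
  qed simp
  have smult: "poly (map_poly \<phi> (smult c p)) x = \<phi> c * poly (map_poly \<phi> p) x" for c p
    by (induction p) (simp_all add: pC rhom_mult[OF assms] algebra_simps)
  have "poly (map_poly \<phi> (p * q)) x = poly (map_poly \<phi> p) x * poly (map_poly \<phi> q) x" for p q
    by (induction p) (simp_all add: pC add smult rhom_zero[OF assms] algebra_simps)
  with add pC[of 1 0] show ?thesis by (simp add: is_rhom_def rhom_one[OF assms] one_pCons)
qed

lemma rhom_comp_poly_map_poly:
  assumes "is_rhom \<phi>" "is_rhom \<psi>"
  shows "\<psi> (poly (map_poly \<phi> p) x) = poly (map_poly (\<lambda>c. \<psi> (\<phi> c)) p) (\<psi> x)"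
  by (induction p)
    (simp_all add: poly_map_poly_pCons[OF assms(1)] poly_map_poly_pCons[OF rhom_comp[OF assms(2,1)]] rhom_simps[OF assms(2)])

locale local_diff_algebra =
  fixes m :: nat
    and D :: "nat \<Rightarrow> 'a::field_char_0 \<Rightarrow> 'a"
    and \<iota> :: "'a \<Rightarrow> 'r::comm_ring_1"
    and \<delta> :: "nat \<Rightarrow> 'r \<Rightarrow> 'r"
    and M :: "'r set"
  assumes dc: "differentially_closed m D"
    and fin_dim: "fin_dim_algebra \<iota>"
    and local: "local_ring TYPE('r)"
    and maximal: "maximal_ideal M"
    and der_R: "comm_derivations m \<delta>"
    and der_ext: "i < m \<Longrightarrow> \<delta> i (\<iota> c) = \<iota> (D i c)"
    and M_stable: "i < m \<Longrightarrow> r \<in> M \<Longrightarrow> \<delta> i r \<in> M"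
begin

lemma der_L: "comm_derivations m D"
  using dc by (simp add: differentially_closed_def)

lemma rhom_\<iota>: "is_rhom \<iota>"
  using fin_dim by (simp add: fin_dim_algebra_def is_rhom_def)

lemma M_add: "x \<in> M \<Longrightarrow> y \<in> M \<Longrightarrow> x + y \<in> M"
  and M_mult: "x \<in> M \<Longrightarrow> r * x \<in> M"
  and M_zero: "0 \<in> M"
  using maximal by (auto simp: maximal_ideal_def is_ideal_def)

lemma M_mult': "x \<in> M \<Longrightarrow> x * r \<in> M"
  using M_mult[of x r] by (simp add: mult.commute)

lemma M_minus: "x \<in> M \<Longrightarrow> - x \<in> M"
  using M_mult[of x "-1"] by simp

lemma M_diff: "x \<in> M \<Longrightarrow> y \<in> M \<Longrightarrow> x - y \<in> M"
  using M_add[of x "- y"] M_minus[of y] by simp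

lemma one_notin_M: "1 \<notin> M"
proof
  assume "1 \<in> M"
  then have "r \<in> M" for r using M_mult[of 1 r] by simp
  then show False using maximal by (auto simp: maximal_ideal_def)
qed

text \<open>The multiples of a nonunit form a proper ideal, which lies in a maximal ideal, and
  \<open>M\<close> is the only one.\<close>

lemma unit:
  assumes "x \<notin> M"
  shows "\<exists>y. x * y = 1"
proof (rule ccontr)
  assume "\<not> ?thesis"
  then have 1: "1 \<notin> {y. \<exists>s. y = x * s}" by (auto dest: sym)
  have "is_ideal {y. \<exists>s. y = x * s}"
    unfolding is_ideal_def
  proof (intro conjI ballI allI)
    show "0 \<in> {y. \<exists>s. y = x * s}" by (auto intro: exI[of _ 0])
    show "y + z \<in> {y. \<exists>s. y = x * s}" if "y \<in> {y. \<exists>s. y = x * s}" "z \<in> {y. \<exists>s. y = x * s}" for y z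
      using that by (auto simp flip: distrib_left)
    show "r * y \<in> {y. \<exists>s. y = x * s}" if "y \<in> {y. \<exists>s. y = x * s}" for r y
    proof -
      from that obtain s where "y = x * s" by blast
      then have "r * y = x * (r * s)" by (simp add: mult.left_commute)
      then show ?thesis by blast
    qed
  qed
  from proper_ideal_subset_maximal[OF this 1] obtain J where J: "maximal_ideal J" "{y. \<exists>s. y = x * s} \<subseteq> J"
    by blast
  have "J = M" using local maximal J(1) by (auto simp: local_ring_def)
  moreover have "x \<in> J" using J(2) by (auto intro: exI[of _ 1])
  ultimately show False using assms by simp
qed

lemma M_prime:
  assumes "x * y \<in> M"
  shows "x \<in> M \<or> y \<in> M"
proof (rule ccontr)
  assume *: "\<not> ?thesis"
  with unit obtain x' where x': "x * x' = 1" by blast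
  have "y = x' * (x * y)" using x' by (metis mult.assoc mult.commute mult_1)
  with * M_mult[OF assms, of x'] show False by simp
qed

lemma \<iota>_in_M_iff: "\<iota> c \<in> M \<longleftrightarrow> c = 0"
proof
  assume "\<iota> c \<in> M"
  then have "c \<noteq> 0 \<longrightarrow> 1 \<in> M"
    using M_mult[of "\<iota> c" "\<iota> (inverse c)"] rhom_mult[OF rhom_\<iota>, of "inverse c" c] rhom_one[OF rhom_\<iota>] by auto
  with one_notin_M show "c = 0" by blast
qed (simp add: M_zero rhom_zero[OF rhom_\<iota>])

lemma vector_space: "vector_space (\<lambda>c x. \<iota> c * x)"
  by unfold_locales (simp_all add: rhom_simps[OF rhom_\<iota>] algebra_simps)

interpretation vs: vector_space "\<lambda>c x. \<iota> c * x"
  by (rule vector_space)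

lemma finite_span: "\<exists>B. finite B \<and> vs.span B = UNIV"
proof -
  from fin_dim obtain B where B: "finite B" "\<And>r. \<exists>c. r = (\<Sum>b\<in>B. \<iota> (c b) * b)"
    by (auto simp: fin_dim_algebra_def)
  have "r \<in> vs.span B" for r
  proof -
    from B(2)[of r] obtain c where "r = (\<Sum>b\<in>B. \<iota> (c b) * b)" by blast
    moreover have "(\<Sum>b\<in>B. \<iota> (c b) * b) \<in> vs.span B"
      by (intro vs.span_sum vs.span_scale vs.span_base)
    ultimately show ?thesis by simp
  qed
  with B(1) show ?thesis by blast
qed

text \<open>The algebra comes with generators that may be dependent. A basis makes coordinates
  unique, and its indexing by numbers lets \<open>j\<close> name the differential indeterminate of
  the \<open>j\<close>-th coordinate.\<close>

lemma basis_exists: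
  "\<exists>(n::nat) e co. (\<forall>r. r = (\<Sum>j<n. \<iota> (co r j) * e j)) \<and> (\<forall>c. (\<Sum>j<n. \<iota> (c j) * e j) = 0 \<longrightarrow> (\<forall>j<n. c j = 0))"
proof -
  from finite_span obtain B where B: "finite B" "vs.span B = UNIV" by blast
  obtain C where C: "C \<subseteq> UNIV" "vs.independent C" "UNIV \<subseteq> vs.span C"
    by (rule vs.maximal_independent_subset)
  with vs.independent_span_bound[OF B(1) C(2)] B(2) have fin: "finite C" by auto
  obtain e where e: "bij_betw e {..<card C} C"
    using ex_bij_betw_nat_finite[OF fin] by (auto simp: atLeast0LessThan)
  have sum: "(\<Sum>j<card C. \<iota> (f (e j)) * e j) = (\<Sum>b\<in>C. \<iota> (f b) * b)" for f
    by (rule sum.reindex_bij_betw[OF e])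
  have "\<exists>co. r = (\<Sum>j<card C. \<iota> (co j) * e j)" for r
  proof -
    have "r = (\<Sum>b\<in>C. \<iota> (vs.representation C r b) * b)"
      by (rule vs.sum_representation_eq[symmetric]) (use C fin in auto)
    with sum[of "vs.representation C r"] show ?thesis by (intro exI[of _ "\<lambda>j. vs.representation C r (e j)"]) simp
  qed
  then obtain co where "\<forall>r. r = (\<Sum>j<card C. \<iota> (co r j) * e j)" using choice[of "\<lambda>r co. r = (\<Sum>j<card C. \<iota> (co j) * e j)"] by blast
  moreover have "\<forall>c. (\<Sum>j<card C. \<iota> (c j) * e j) = 0 \<longrightarrow> (\<forall>j<card C. c j = 0)"
  proof (intro allI impI)
    fix c j assume 0: "(\<Sum>j<card C. \<iota> (c j) * e j) = 0" and j: "j < card C"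
    define f where "f = (\<lambda>b. c (the_inv_into {..<card C} e b))"
    have f: "f (e k) = c k" if "k < card C" for k
      using that e by (simp add: f_def bij_betw_def the_inv_into_f_f)
    have "(\<Sum>b\<in>C. \<iota> (f b) * b) = 0" using 0 f by (simp flip: sum)
    then have "f (e j) = 0"
      using vs.independentD[OF C(2) fin subset_refl] j e by (metis bij_betwE lessThan_iff)
    with f j show "c j = 0" by simp
  qed
  ultimately show ?thesis by (intro exI[of _ "card C"] exI[of _ e] exI[of _ co] conjI)
qed

text \<open>There is one more power of \<open>r\<close> than there are generators. Linear dependence
  is a property of sets, so a coincidence between two powers is treated separately.\<close>

lemma algebraic: "\<exists>p. p \<noteq> 0 \<and> poly (map_poly \<iota> p) r = 0"
proof -
  let ?E = "\<lambda>p. poly (map_poly \<iota> p) r"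
  note E = rhom_poly_map_poly[OF rhom_\<iota>, of r]
  have E_monom: "?E (monom c k) = \<iota> c * r ^ k" for c k
  proof (induction k)
    case 0
    show ?case by (simp add: monom_0 map_poly_pCons rhom_zero[OF rhom_\<iota>])
  next
    case (Suc k)
    then show ?case by (simp add: monom_Suc poly_map_poly_pCons[OF rhom_\<iota>] rhom_zero[OF rhom_\<iota>] mult_ac)
  qed
  from finite_span obtain B where B: "finite B" "vs.span B = UNIV" by blast
  let ?N = "card B"
  show ?thesis
  proof (cases "inj_on (\<lambda>k. r ^ k) {..?N}")
    case False
    then obtain i j where ij: "i \<noteq> j" "r ^ i = r ^ j" by (auto simp: inj_on_def)
    have "?E (monom 1 i - monom 1 j) = 0"
      using ij(2) by (simp add: rhom_diff[OF E] E_monom)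
    moreover have "monom 1 i - monom 1 j \<noteq> (0 :: 'a poly)"
      using ij(1) by (metis eq_iff_diff_eq_0 monom_eq_iff' zero_neq_one)
    ultimately show ?thesis by blast
  next
    case True
    let ?S = "(\<lambda>k. r ^ k) ` {..?N}"
    have "card ?S = Suc ?N" using True by (simp add: card_image)
    then have "vs.dependent ?S"
      using vs.independent_span_bound[OF B(1), of ?S] B(2) by fastforce
    then obtain u v where u: "v \<in> ?S" "u v \<noteq> 0" "(\<Sum>v\<in>?S. \<iota> (u v) * v) = 0"
      by (auto simp: vs.dependent_finite)
    then obtain k where k: "k \<le> ?N" "u (r ^ k) \<noteq> 0" by auto
    define p where "p = (\<Sum>k\<le>?N. monom (u (r ^ k)) k)"
    have "?E p = (\<Sum>v\<in>?S. \<iota> (u v) * v)"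
      by (simp add: p_def rhom_sum[OF E] E_monom sum.reindex[OF True])
    moreover have "coeff p k = u (r ^ k)"
      using k by (simp add: p_def coeff_sum)
    ultimately show ?thesis using u(3) k(2) by (intro exI[of _ p]) auto
  qed
qed

text \<open>Split an annihilating polynomial of \<open>x\<close> as a power of the variable times
  \<open>q\<close> with nonzero constant term. Modulo \<open>M\<close> the value of \<open>q\<close>
  at \<open>x\<close> is that constant, so it is a unit and the power of \<open>x\<close> is
  zero.\<close>

lemma M_nilpotent:
  assumes "x \<in> M"
  shows "\<exists>n. x ^ n = 0"
proof -
  let ?E = "\<lambda>p. poly (map_poly \<iota> p) x"
  note E = rhom_poly_map_poly[OF rhom_\<iota>, of x]
  from algebraic[of x] obtain p where p: "p \<noteq> 0" "?E p = 0" by blast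
  from order_decomp[OF p(1), of 0] obtain q where q: "p = [:- 0, 1:] ^ order 0 p * q" "\<not> [:- 0, 1:] dvd q" by blast
  obtain c q' where c: "q = pCons c q'" by (cases q)
  have "c \<noteq> 0" using q(2) c by (auto simp: dvd_iff_poly_eq_0)
  have "?E q \<notin> M"
  proof
    assume "?E q \<in> M"
    from M_diff[OF this M_mult'[OF assms, of "?E q'"]] have "\<iota> c \<in> M"
      by (simp add: c poly_map_poly_pCons[OF rhom_\<iota>])
    with \<open>c \<noteq> 0\<close> show False by (simp add: \<iota>_in_M_iff)
  qed
  then obtain y where y: "?E q * y = 1" using unit by blast
  have "x ^ order 0 p * ?E q = 0"
    using p(2) by (subst (asm) q(1)) (simp only: rhom_mult[OF E] rhom_power[OF E],
      simp add: map_poly_pCons rhom_zero[OF rhom_\<iota>] rhom_one[OF rhom_\<iota>])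
  then have "x ^ order 0 p * (?E q * y) = 0" by (simp flip: mult.assoc)
  then show ?thesis using y by auto
qed

text \<open>A polynomial over the base field of least degree vanishing at the residue of \<^term>\<open>r\<close> has a zero in the
  differential field of residues, hence in the base field, and is therefore linear.\<close>

lemma residue_exists: "\<exists>a. r - \<iota> a \<in> M"
proof -
  let ?E = "\<lambda>p. poly (map_poly \<iota> p) r"
  note E = rhom_poly_map_poly[OF rhom_\<iota>, of r]
  have "\<exists>p. p \<noteq> 0 \<and> ?E p \<in> M" using algebraic[of r] M_zero by metis
  then obtain p0 where "p0 \<noteq> 0 \<and> ?E p0 \<in> M" by blast
  from ex_has_least_nat[of "\<lambda>p. p \<noteq> 0 \<and> ?E p \<in> M", OF this, of degree]
  obtain p where p: "p \<noteq> 0" "?E p \<in> M" and min: "\<And>q. q \<noteq> 0 \<Longrightarrow> ?E q \<in> M \<Longrightarrow> degree p \<le> degree q" by auto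
  \<comment> \<open>All unknowns are sent to \<open>r\<close> and its derivatives, so
    \<open>h\<close> commutes with the derivations. As \<open>M\<close> is a prime differential
    ideal, so is its preimage.\<close>
  define h where "h = poly_hom \<iota> (\<lambda>(j :: nat, \<theta>). theta_val m \<delta> \<theta> r)"
  have h: "is_rhom h" by (simp add: h_def rhom_poly_hom rhom_\<iota>)
  define f :: "(nat \<times> (nat \<Rightarrow>\<^sub>0 nat) \<Rightarrow>\<^sub>0 nat) \<Rightarrow>\<^sub>0 'a"
    where "f = poly (map_poly (Poly_Mapping.single 0) p) (pvar (0, 0))"
  have h_f: "h f = ?E p"
    unfolding f_def by (subst rhom_comp_poly_map_poly[OF rhom_const h]) (simp add: h_def poly_hom_const poly_hom_pvar rhom_\<iota>)
  have f_vars: "pvars f \<subseteq> {(0, 0)}"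
    unfolding f_def
  proof (induction p)
    case (pCons a p)
    then show ?case
      unfolding poly_map_poly_pCons[OF rhom_const]
      by (intro order.trans[OF pvars_add] Un_least order.trans[OF pvars_mult]) (simp_all add: pvars_pvar)
  qed simp
  have "\<exists>z. \<forall>f\<in>{f}. peval (\<lambda>(j, \<theta>). theta_val m D \<theta> (z j)) f = 0"
  proof (rule differentially_closed_zero[OF dc, of "{q. h q \<in> M}"])
    show "is_ideal {q. h q \<in> M}"
      by (auto simp: is_ideal_def rhom_simps[OF h] M_zero M_add M_mult)
    show "ydder D i x \<in> {q. h q \<in> M}" if "i < m" "x \<in> {q. h q \<in> M}" for i x
    proof -
      have "h (ydder D i x) = \<delta> i (h x)"
        unfolding h_def ydder_def using that(1)
        by (intro poly_hom_poly_der) (auto simp: rhom_\<iota> comm_derivations_der[OF der_L] comm_derivations_der[OF der_R]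
            der_ext poly_hom_pvar theta_val_add_single[OF der_R] simp del: One_nat_def)
      then show ?thesis using M_stable that by simp
    qed
  qed (use p(2) h_f f_vars M_prime one_notin_M in \<open>auto simp: rhom_simps[OF h]\<close>)
  then obtain z where z: "peval (\<lambda>(j, \<theta>). theta_val m D \<theta> (z j)) f = 0" by blast
  have "map_poly (\<lambda>c. c) p = p" by (simp add: map_poly_idI)
  then have "poly p (z 0) = 0"
    using z by (simp add: f_def rhom_comp_poly_map_poly[OF rhom_const rhom_peval] peval_const peval_pvar)
  then obtain q where q: "p = [:- z 0, 1:] * q" by (auto simp: poly_eq_0_iff_dvd dvd_def)
  then have "(r - \<iota> (z 0)) * ?E q \<in> M"
    using p(2) by (simp add: rhom_mult[OF E] poly_map_poly_pCons[OF rhom_\<iota>] rhom_simps[OF rhom_\<iota>] del: mult_pCons_left)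
  \<comment> \<open>Otherwise \<open>q\<close>, of degree one less than \<open>p\<close>, would
    contradict minimality. Primality of \<open>M\<close> then leaves the linear factor.\<close>
  moreover have "?E q \<notin> M"
  proof
    assume "?E q \<in> M"
    moreover have "q \<noteq> 0" using p(1) q by auto
    ultimately have "degree p \<le> degree q" by (intro min)
    moreover have "degree p = Suc (degree q)" using \<open>q \<noteq> 0\<close> unfolding q by (subst degree_mult_eq) auto
    ultimately show False by simp
  qed
  ultimately show ?thesis using M_prime by blast
qed

abbreviation rs :: "'r \<Rightarrow> 'a" where "rs \<equiv> res \<iota> M"

text \<open>Existence of a residue is the previous lemma; uniqueness holds because \<open>M\<close>
  contains no nonzero scalar.\<close>

lemma rs_eq_iff: "rs r = a \<longleftrightarrow> r - \<iota> a \<in> M"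
proof -
  have uniq: "a = b" if "r - \<iota> a \<in> M" "r - \<iota> b \<in> M" for a b
  proof -
    have "\<iota> (a - b) \<in> M" using M_diff[OF that(2,1)] by (simp add: rhom_diff[OF rhom_\<iota>])
    then show ?thesis by (simp add: \<iota>_in_M_iff)
  qed
  then have "\<exists>!a. r - \<iota> a \<in> M" using residue_exists by blast
  from theI'[OF this] uniq show ?thesis unfolding res_def by blast
qed

lemma rs_diff_in_M: "r - \<iota> (rs r) \<in> M"
  using rs_eq_iff by blast

lemma rhom_rs: "is_rhom rs"
proof -
  have "rs (x + y) = rs x + rs y" for x y
    using M_add[OF rs_diff_in_M[of x] rs_diff_in_M[of y]]
    by (simp add: rs_eq_iff rhom_simps[OF rhom_\<iota>] algebra_simps)
  moreover have "rs (x * y) = rs x * rs y" for x y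
    using M_add[OF M_mult'[OF rs_diff_in_M[of x], of y] M_mult[OF rs_diff_in_M[of y], of "\<iota> (rs x)"]]
    by (simp add: rs_eq_iff rhom_simps[OF rhom_\<iota>] algebra_simps)
  ultimately show ?thesis by (simp add: is_rhom_def rs_eq_iff rhom_simps[OF rhom_\<iota>] M_zero)
qed

lemma rs_\<iota> [simp]: "rs (\<iota> c) = c"
  by (simp add: rs_eq_iff M_zero)

lemma rs_eq_0_iff: "rs r = 0 \<longleftrightarrow> r \<in> M"
  by (simp add: rs_eq_iff rhom_zero[OF rhom_\<iota>])

text \<open>Stability of \<open>M\<close> under the derivations is what makes the residue map
  differential.\<close>

lemma rs_\<delta>: "i < m \<Longrightarrow> rs (\<delta> i r) = D i (rs r)"
  using M_stable[OF _ rs_diff_in_M[of r], of i]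
  by (simp add: rs_eq_iff der_diff[OF comm_derivations_der[OF der_R]] der_ext)

text \<open>Newton's iteration. The error is divisible by growing powers of the initial error
  \<open>?N\<close>, which is nilpotent, so an exact zero is reached after finitely many steps,
  without completeness.\<close>

lemma hensel:
  assumes "peval (val(v := x)) f \<in> M" and "peval (val(v := x)) (pdiff v f) \<notin> M"
  shows "\<exists>y. y - x \<in> M \<and> peval (val(v := y)) f = 0"
proof -
  let ?e = "\<lambda>y. peval (val(v := y))"
  let ?N = "?e x f"
  have approx: "\<exists>y r. y - x \<in> M \<and> ?e y f = ?N ^ Suc k * r" for k
  proof (induction k)
    case 0
    show ?case by (intro exI[of _ x] exI[of _ 1]) (simp add: M_zero)
  next
    case (Suc k)
    then obtain y r where y: "y - x \<in> M" "?e y f = ?N ^ Suc k * r" by blast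
    \<comment> \<open>Since \<open>y\<close> and \<open>x\<close> agree modulo \<open>M\<close>, so
      do the derivatives there; the derivative at \<open>y\<close> is still a unit.\<close>
    from peval_update_taylor[of val v x "y - x" "pdiff v f"] obtain s where
      s: "?e y (pdiff v f) = ?e x (pdiff v f) + (y - x) * ?e x (pdiff v (pdiff v f)) + (y - x) ^ 2 * s" by auto
    have "?e y (pdiff v f) \<notin> M"
    proof
      assume "?e y (pdiff v f) \<in> M"
      moreover have "(y - x) * (?e x (pdiff v (pdiff v f)) + (y - x) * s) \<in> M"
        by (rule M_mult'[OF y(1)])
      ultimately have "?e y (pdiff v f) - (y - x) * (?e x (pdiff v (pdiff v f)) + (y - x) * s) \<in> M"
        by (rule M_diff)
      moreover have "?e y (pdiff v f) - (y - x) * (?e x (pdiff v (pdiff v f)) + (y - x) * s) = ?e x (pdiff v f)"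
        unfolding s power2_eq_square by (simp only: distrib_left mult.assoc) simp
      ultimately show False using assms(2) by (simp del: fun_upd_apply)
    qed
    then obtain u where u: "?e y (pdiff v f) * u = 1" using unit by blast
    \<comment> \<open>Newton's correction cancels the linear term. What remains,
      \<open>h ^ 2 * t\<close>, is divisible by \<open>?N ^ (2 * k + 2)\<close> and hence by the
      required \<open>?N ^ (k + 2)\<close>.\<close>
    define h where "h = - (?e y f * u)"
    from peval_update_taylor[of val v y h f] obtain t where
      t: "?e (y + h) f = ?e y f + h * ?e y (pdiff v f) + h ^ 2 * t" by blast
    have "h * ?e y (pdiff v f) = - (?e y f * (?e y (pdiff v f) * u))" by (simp add: h_def mult_ac)
    then have "?e (y + h) f = h ^ 2 * t" using t u by simp
    also have "\<dots> = ?N ^ Suc (Suc k) * (?N ^ k * r ^ 2 * u ^ 2 * t)"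
      by (simp add: h_def y(2) power2_eq_square mult_ac)
    finally have "?e (y + h) f = ?N ^ Suc (Suc k) * (?N ^ k * r ^ 2 * u ^ 2 * t)" .
    moreover have "h \<in> M"
    proof -
      have "?N ^ Suc k * r * u \<in> M" using M_mult'[OF assms(1)] by (simp add: mult.assoc)
      then show ?thesis unfolding h_def y(2) by (rule M_minus)
    qed
    then have "y + h - x \<in> M" using M_add[OF y(1)] by (simp add: algebra_simps)
    ultimately show ?case by blast
  qed
  from M_nilpotent[OF assms(1)] obtain n where "?N ^ n = 0" by blast
  then show ?thesis using approx[of n] by auto
qed

end

subsection \<open>Leaders of derivatives\<close>

definition rank_le :: "nat \<Rightarrow> (nat \<Rightarrow>\<^sub>0 nat) \<Rightarrow> (nat \<Rightarrow>\<^sub>0 nat) \<Rightarrow> bool" where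
  "rank_le m v w \<longleftrightarrow> v = w \<or> rank_less m v w"

lemma rank_le_less_trans: "rank_le m u v \<Longrightarrow> rank_less m v w \<Longrightarrow> rank_less m u w"
  by (auto simp: rank_le_def intro: rank_less_trans)

lemma rank_le_add: "rank_le m v w \<Longrightarrow> rank_le m (v + u) (w + u)"
  by (auto simp: rank_le_def intro: rank_less_add)

lemma pvars_dder: "pvars (dder \<delta> i f) \<subseteq> pvars f \<union> (\<lambda>v. v + Poly_Mapping.single i 1) ` pvars f"
  using pvars_poly_der[of "\<delta> i" "\<lambda>v. pvar (v + Poly_Mapping.single i 1)" f]
  by (auto simp: dder_eq_poly_der pvars_pvar)

text \<open>If the shifted indeterminate is new, it occurs in \<open>dder \<delta> i f\<close> only
  in the summand \<open>pdiff v f * pvar (v + Poly_Mapping.single i 1)\<close>, and there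
  linearly.\<close>

lemma pdiff_dder_top:
  assumes "v + Poly_Mapping.single i 1 \<notin> pvars f"
  shows "pdiff (v + Poly_Mapping.single i 1) (dder \<delta> i f) = pdiff v f"
proof -
  let ?w = "v + Poly_Mapping.single i 1"
  have "pvars (\<Sum>\<mu>\<in>Poly_Mapping.keys f. Poly_Mapping.single \<mu> (\<delta> i (Poly_Mapping.lookup f \<mu>))) \<subseteq> pvars f"
    by (rule pvars_sum_le) (auto simp: pvars_def split: if_splits)
  then have 1: "pdiff ?w (\<Sum>\<mu>\<in>Poly_Mapping.keys f. Poly_Mapping.single \<mu> (\<delta> i (Poly_Mapping.lookup f \<mu>))) = 0"
    using assms by (intro pdiff_not_in_pvars) blast
  have "pdiff ?w (pdiff u f) = 0" for u
    using assms pvars_pdiff[of u f] by (intro pdiff_not_in_pvars) blast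
  then have "pdiff ?w (pdiff u f * pvar (u + Poly_Mapping.single i 1)) = (if u = v then pdiff v f else 0)" for u
    by (auto simp: der_mult[OF der_pdiff] pdiff_pvar)
  then show ?thesis
    unfolding dder_def pdiff_add 1 by (simp add: der_sum[OF der_pdiff] pdiff_not_in_pvars)
qed

lemma theta_poly_zero [simp]: "theta_poly m \<delta> 0 f = f"
  by (simp add: theta_poly_def)

lemma theta_poly_add_single:
  "comm_derivations m \<delta> \<Longrightarrow> i < m \<Longrightarrow> theta_poly m \<delta> (\<theta> + Poly_Mapping.single i 1) f = dder \<delta> i (theta_poly m \<delta> \<theta> f)"
  unfolding theta_poly_def by (rule theta_val_add_single[OF comm_derivations_dder])

text \<open>The coefficient of the leader in a proper derivative is the separant of
  \<open>f\<close>, whatever the operator. The bound on the variables is carried along because it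
  guarantees that each newly created indeterminate is really new.\<close>

lemma theta_poly_top:
  assumes \<delta>: "comm_derivations m \<delta>" and f: "pvars f \<subseteq> Theta m" "\<And>w. w \<in> pvars f \<Longrightarrow> rank_le m w v"
    and "\<theta> \<in> Theta m"
  shows "pvars (theta_poly m \<delta> \<theta> f) \<subseteq> Theta m \<and> (\<forall>w\<in>pvars (theta_poly m \<delta> \<theta> f). rank_le m w (\<theta> + v))
    \<and> pdiff (\<theta> + v) (theta_poly m \<delta> \<theta> f) = pdiff v f"
  using assms(4)
proof (induction rule: Theta_induct)
  case zero
  show ?case using f by simp
next
  case (step \<theta> i)
  let ?e = "Poly_Mapping.single i (1::nat)" and ?g = "theta_poly m \<delta> \<theta> f"
  have eq: "theta_poly m \<delta> (\<theta> + ?e) f = dder \<delta> i ?g"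
    by (rule theta_poly_add_single[OF \<delta> step(2)])
  have le: "rank_less m w (\<theta> + v + ?e)" if "w \<in> pvars ?g" for w
    using step(3) that rank_less_add_single[OF step(2), of "\<theta> + v"] rank_le_less_trans by blast
  then have "\<theta> + v + ?e \<notin> pvars ?g" using rank_less_irrefl by blast
  from pdiff_dder_top[OF this] have 1: "pdiff (\<theta> + ?e + v) (dder \<delta> i ?g) = pdiff v f"
    using step(3) by (simp add: add_ac)
  have "w \<in> Theta m \<and> rank_le m w (\<theta> + ?e + v)" if w: "w \<in> pvars (dder \<delta> i ?g)" for w
    using subsetD[OF pvars_dder w]
  proof
    assume "w \<in> pvars ?g"
    with le[of w] step(3) show ?thesis by (auto simp: rank_le_def add_ac)
  next
    assume "w \<in> (\<lambda>v. v + ?e) ` pvars ?g"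
    then obtain u where u: "u \<in> pvars ?g" "w = u + ?e" by blast
    with step(3) have "rank_le m w (\<theta> + v + ?e)" by (auto intro: rank_le_add)
    moreover have "w \<in> Theta m" using u step(2,3) by (auto intro!: Theta_add single_in_Theta)
    ultimately show ?thesis by (simp add: add_ac)
  qed
  with 1 show ?case unfolding eq by blast
qed

lemma leader_eqI:
  assumes "v \<in> pvars f" "\<And>w. w \<in> pvars f \<Longrightarrow> rank_le m w v"
  shows "leader m f = v"
  unfolding leader_def
proof (rule the_equality)
  show "v \<in> pvars f \<and> (\<forall>w\<in>pvars f. w \<noteq> v \<longrightarrow> rank_less m w v)"
    using assms by (auto simp: rank_le_def)
  fix u assume u: "u \<in> pvars f \<and> (\<forall>w\<in>pvars f. w \<noteq> u \<longrightarrow> rank_less m w u)"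
  show "u = v"
  proof (rule ccontr)
    assume "u \<noteq> v"
    with u assms have "rank_less m v u" "rank_less m u v" by (auto simp: rank_le_def)
    then show False using rank_less_trans rank_less_irrefl by blast
  qed
qed

lemma finite_rank_max:
  assumes "finite V" "V \<noteq> {}" "V \<subseteq> Theta m"
  shows "\<exists>v\<in>V. \<forall>w\<in>V. rank_le m w v"
  using assms
proof (induction V rule: finite_ne_induct)
  case (insert x V)
  then obtain v where v: "v \<in> V" "\<forall>w\<in>V. rank_le m w v" by auto
  have "rank_le m x v \<or> rank_less m v x"
    using rank_less_linear[of x m v] insert.prems v(1) by (auto simp: rank_le_def)
  then show ?case
  proof
    assume "rank_less m v x"
    then have "\<forall>w\<in>insert x V. rank_le m w x" using v(2) rank_le_less_trans by (metis insert_iff rank_le_def)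
    then show ?thesis by blast
  qed (use v in auto)
qed (auto simp: rank_le_def)

lemma leader_max:
  assumes "pvars f \<subseteq> Theta m" "pvars f \<noteq> {}"
  shows "leader m f \<in> pvars f" and "w \<in> pvars f \<Longrightarrow> rank_le m w (leader m f)"
proof -
  obtain v where v: "v \<in> pvars f" "\<forall>w\<in>pvars f. rank_le m w v"
    using finite_rank_max[OF finite_pvars assms(2,1)] by blast
  with leader_eqI[of v f m] show "leader m f \<in> pvars f" "w \<in> pvars f \<Longrightarrow> rank_le m w (leader m f)" by auto
qed

section \<open>Generated ideals\<close>

lemma ideal_gen_base: "s \<in> S \<Longrightarrow> s \<in> ideal_gen S"
  unfolding ideal_gen_def by (intro CollectI exI[of _ "{s}"] exI[of _ "\<lambda>_. 1"]) simp

lemma is_ideal_ideal_gen: "is_ideal (ideal_gen S)"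
  unfolding is_ideal_def
proof (intro conjI ballI allI)
  show "0 \<in> ideal_gen S"
    unfolding ideal_gen_def by (intro CollectI exI[of _ "{}"]) simp
next
  fix x y assume "x \<in> ideal_gen S" "y \<in> ideal_gen S"
  then obtain F c G e where F: "finite F" "F \<subseteq> S" "x = (\<Sum>s\<in>F. c s * s)"
    and G: "finite G" "G \<subseteq> S" "y = (\<Sum>s\<in>G. e s * s)" by (auto simp: ideal_gen_def)
  let ?c = "\<lambda>s. if s \<in> F then c s else 0" and ?e = "\<lambda>s. if s \<in> G then e s else 0"
  have "x = (\<Sum>s\<in>F \<union> G. ?c s * s)"
    unfolding F(3) by (rule sum.mono_neutral_cong_left) (use F G in auto)
  moreover have "y = (\<Sum>s\<in>F \<union> G. ?e s * s)"
    unfolding G(3) by (rule sum.mono_neutral_cong_left) (use F G in auto)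
  ultimately have "x + y = (\<Sum>s\<in>F \<union> G. (?c s + ?e s) * s)"
    by (simp only: distrib_right sum.distrib)
  then show "x + y \<in> ideal_gen S"
    unfolding ideal_gen_def using F(1,2) G(1,2)
    by (intro CollectI exI[of _ "F \<union> G"] exI[of _ "\<lambda>s. ?c s + ?e s"] conjI) simp_all
next
  fix r x assume "x \<in> ideal_gen S"
  then obtain F c where F: "finite F" "F \<subseteq> S" "x = (\<Sum>s\<in>F. c s * s)" by (auto simp: ideal_gen_def)
  then have "r * x = (\<Sum>s\<in>F. (r * c s) * s)" by (simp add: sum_distrib_left mult.assoc)
  then show "r * x \<in> ideal_gen S"
    unfolding ideal_gen_def using F(1,2) by (intro CollectI exI[of _ F] exI[of _ "\<lambda>s. r * c s"] conjI)
qed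

lemma ideal_gen_least:
  assumes "is_ideal I" "S \<subseteq> I"
  shows "ideal_gen S \<subseteq> I"
proof
  fix x assume "x \<in> ideal_gen S"
  then obtain F c where F: "finite F" "F \<subseteq> S" "x = (\<Sum>s\<in>F. c s * s)" by (auto simp: ideal_gen_def)
  have "(\<Sum>s\<in>F. c s * s) \<in> I"
    using F(1,2) by (induction F rule: finite_induct) (use assms in \<open>auto simp: is_ideal_def\<close>)
  with F show "x \<in> I" by simp
qed

lemma ideal_comb: "is_ideal I \<Longrightarrow> x \<in> I \<Longrightarrow> y \<in> I \<Longrightarrow> z = r * x + s * y \<Longrightarrow> z \<in> I"
  by (auto simp: is_ideal_def)

subsection \<open>Algebraic solutions of a coherent system\<close>

locale coherent_system = local_diff_algebra m D \<iota> \<delta> M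
  for m and D :: "nat \<Rightarrow> 'a::field_char_0 \<Rightarrow> 'a" and \<iota> :: "'a \<Rightarrow> 'r::comm_ring_1" and \<delta> M +
  fixes \<Lambda> :: "'r dpoly set" and a :: 'a
  assumes fin: "finite \<Lambda>"
    and coherent: "coherent m \<delta> \<Lambda>"
    and zeros: "f \<in> \<Lambda> \<Longrightarrow> deval m D (map_coeffs (res \<iota> M) f) a = 0"
    and H_nonzero: "deval m D (map_coeffs (res \<iota> M) (H_prod m \<Lambda>)) a \<noteq> 0"
begin

abbreviation H where "H \<equiv> H_prod m \<Lambda>"
abbreviation th where "th \<equiv> theta_poly m \<delta>"
abbreviation ld where "ld \<equiv> leader m"
abbreviation S where "S \<equiv> separant m"

text \<open>The common reduction of all points over the algebra that lift the derivatives of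
  \<open>a\<close>. Conditions modulo \<open>M\<close> at such a point can be read off in the base
  field.\<close>

definition ev0 :: "'r dpoly \<Rightarrow> 'a" where
  "ev0 = poly_hom rs (\<lambda>v. theta_val m D v a)"

text \<open>Required at every exponent vector, also outside \<open>Theta m\<close>, so that
  reduction holds for arbitrary polynomials.\<close>

definition lifts :: "((nat \<Rightarrow>\<^sub>0 nat) \<Rightarrow> 'r) \<Rightarrow> bool" where
  "lifts s \<longleftrightarrow> (\<forall>v. rs (s v) = theta_val m D v a)"

lemma rhom_ev0: "is_rhom ev0"
  by (simp add: ev0_def rhom_poly_hom rhom_rs)

lemma ev0_eq_deval: "ev0 f = deval m D (map_coeffs rs f) a"
  by (simp add: ev0_def deval_def peval_map_coeffs rhom_rs)

lemma rs_peval: "lifts s \<Longrightarrow> rs (peval s f) = ev0 f"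
  by (simp add: peval_eq_poly_hom rhom_peval_poly_hom[OF rhom_id rhom_rs] ev0_def lifts_def)

lemma ev0_dder: "i < m \<Longrightarrow> ev0 (dder \<delta> i f) = D i (ev0 f)"
  unfolding ev0_def dder_eq_poly_der
  by (rule poly_hom_poly_der)
    (simp_all add: rhom_rs comm_derivations_der[OF der_L] comm_derivations_der[OF der_R] rs_\<delta> poly_hom_pvar
      theta_val_add_single[OF der_L] del: One_nat_def)

text \<open>Reduction turns \<open>dder\<close> into the derivation of the base field, so a residual
  zero of \<open>f\<close> is one of all its derivatives. This provides the starting values for
  Hensel's lemma.\<close>

lemma ev0_th:
  assumes "f \<in> \<Lambda>" "\<theta> \<in> Theta m"
  shows "ev0 (th \<theta> f) = 0"
  using assms(2)
proof (induction rule: Theta_induct)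
  case zero
  show ?case using zeros[OF assms(1)] by (simp add: ev0_eq_deval)
next
  case (step \<theta> i)
  then show ?case
    using der_zero[OF comm_derivations_der[OF der_L step(2)]]
    by (simp add: theta_poly_add_single[OF der_R] ev0_dder del: One_nat_def)
qed

lemma ev0_S: "f \<in> \<Lambda> \<Longrightarrow> ev0 (S f) \<noteq> 0"
  using H_nonzero fin unfolding ev0_eq_deval[symmetric] H_prod_def
  by (auto simp: rhom_prod[OF rhom_ev0] rhom_mult[OF rhom_ev0])

lemma S_nonzero: "f \<in> \<Lambda> \<Longrightarrow> S f \<noteq> 0"
  using ev0_S rhom_zero[OF rhom_ev0] by metis

lemma peval_S_notin_M: "lifts s \<Longrightarrow> f \<in> \<Lambda> \<Longrightarrow> peval s (S f) \<notin> M"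
  using ev0_S by (simp add: rs_peval flip: rs_eq_0_iff)

lemma peval_H_notin_M: "lifts s \<Longrightarrow> peval s H ^ N \<notin> M"
  using H_nonzero by (simp add: rs_peval ev0_eq_deval rhom_power[OF rhom_rs] flip: rs_eq_0_iff)

lemma cancel: "x \<notin> M \<Longrightarrow> x * y = 0 \<Longrightarrow> y = 0"
  by (metis unit mult.assoc mult.commute mult_1 mult_zero_right)

lemma \<Lambda>_vars: "f \<in> \<Lambda> \<Longrightarrow> pvars f \<subseteq> Theta m" "f \<in> \<Lambda> \<Longrightarrow> pvars f \<noteq> {}"
  using coherent by (auto simp: coherent_def dpolys_def)

lemma ld_Theta: "f \<in> \<Lambda> \<Longrightarrow> ld f \<in> Theta m"
  using leader_max(1) \<Lambda>_vars by blast

lemma th_top: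
  assumes "f \<in> \<Lambda>" "\<theta> \<in> Theta m"
  shows "pvars (th \<theta> f) \<subseteq> Theta m" and "w \<in> pvars (th \<theta> f) \<Longrightarrow> rank_le m w (\<theta> + ld f)"
    and "pdiff (\<theta> + ld f) (th \<theta> f) = S f"
  using theta_poly_top[OF der_R \<Lambda>_vars(1)[OF assms(1)] leader_max(2)[OF \<Lambda>_vars[OF assms(1)]] assms(2)]
  by (auto simp: separant_def)

text \<open>The expected leader does occur, because the partial derivative with respect to it is the
  separant, which is nonzero.\<close>

lemma ld_th:
  assumes "f \<in> \<Lambda>" "\<theta> \<in> Theta m"
  shows "ld (th \<theta> f) = \<theta> + ld f"
proof (rule leader_eqI)
  show "\<theta> + ld f \<in> pvars (th \<theta> f)"
    using th_top(3)[OF assms] S_nonzero[OF assms(1)] pdiff_not_in_pvars by fastforce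
qed (rule th_top(2)[OF assms])

section \<open>Common derivatives of leaders and the ideals below them\<close>

abbreviation J where "J \<equiv> below_ideal m \<delta> \<Lambda>"

lemma J_eq: "J v = ideal_gen {th \<theta> f | f \<theta>. f \<in> \<Lambda> \<and> \<theta> \<in> Theta m \<and> rank_less m (\<theta> + ld f) v}"
  unfolding below_ideal_def by (rule arg_cong[of _ _ ideal_gen]) (auto simp: ld_th cong: conj_cong; metis ld_th)

lemma J_ideal: "is_ideal (J v)"
  by (simp add: J_eq is_ideal_ideal_gen)

lemma th_in_J: "f \<in> \<Lambda> \<Longrightarrow> \<theta> \<in> Theta m \<Longrightarrow> rank_less m (\<theta> + ld f) v \<Longrightarrow> th \<theta> f \<in> J v"
  unfolding J_eq by (rule ideal_gen_base) blast

lemma J_vanish: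
  assumes "p \<in> J v" "\<And>f \<theta>. f \<in> \<Lambda> \<Longrightarrow> \<theta> \<in> Theta m \<Longrightarrow> rank_less m (\<theta> + ld f) v \<Longrightarrow> peval s (th \<theta> f) = 0"
  shows "peval s p = 0"
proof -
  have "J v \<subseteq> {p. peval s p = 0}"
    unfolding J_eq
    by (rule ideal_gen_least) (use assms(2) in \<open>auto simp: is_ideal_def rhom_simps[OF rhom_peval]\<close>)
  with assms(1) show ?thesis by blast
qed

lemma J_dder:
  assumes i: "i < m" and "p \<in> J v"
  shows "dder \<delta> i p \<in> J (v + Poly_Mapping.single i 1)"
proof -
  let ?v = "v + Poly_Mapping.single i 1"
  note d = comm_derivations_der[OF comm_derivations_dder[OF der_R] i]
  \<comment> \<open>Membership of \<open>p\<close> itself is proved together with that of its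
    derivative: differentiating \<open>r * p\<close> also produces a multiple of
    \<open>p\<close>.\<close>
  have "J v \<subseteq> {p. p \<in> J ?v \<and> dder \<delta> i p \<in> J ?v}"
    unfolding J_eq[of v]
  proof (rule ideal_gen_least)
    show "is_ideal {p. p \<in> J ?v \<and> dder \<delta> i p \<in> J ?v}"
      using J_ideal[of ?v] unfolding is_ideal_def by (auto simp: der_zero[OF d] der_add[OF d] der_mult[OF d])
    show "{th \<theta> f | f \<theta>. f \<in> \<Lambda> \<and> \<theta> \<in> Theta m \<and> rank_less m (\<theta> + ld f) v} \<subseteq> {p. p \<in> J ?v \<and> dder \<delta> i p \<in> J ?v}"
    proof clarify
      fix f \<theta> assume *: "f \<in> \<Lambda>" "\<theta> \<in> Theta m" "rank_less m (\<theta> + ld f) v"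
      have "rank_less m (\<theta> + ld f) ?v" using *(3) rank_less_add_single[OF i] by (rule rank_less_trans)
      moreover have "rank_less m (\<theta> + Poly_Mapping.single i 1 + ld f) ?v"
        using rank_less_add[OF *(3), of "Poly_Mapping.single i 1"] by (simp add: add_ac)
      ultimately show "th \<theta> f \<in> J ?v \<and> dder \<delta> i (th \<theta> f) \<in> J ?v"
        using * i by (simp add: th_in_J Theta_add single_in_Theta del: One_nat_def flip: theta_poly_add_single[OF der_R])
    qed
  qed
  with assms(2) show ?thesis by blast
qed

text \<open>Differentiating the relation \<open>N\<close> yields the wanted expression plus
  multiples of \<open>th \<theta>f f\<close> and \<open>th \<theta>g g\<close>. Their leader
  \<open>v\<close> lies strictly below the new bound, so these extra terms belong to the new ideal,
  with the same exponent.\<close>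

lemma spair_step:
  assumes fg: "f \<in> \<Lambda>" "g \<in> \<Lambda>" and \<theta>: "\<theta>f \<in> Theta m" "\<theta>g \<in> Theta m" "\<theta>f + ld f = v" "\<theta>g + ld g = v" and i: "i < m"
    and N: "H ^ N * (S g * th \<theta>f f - S f * th \<theta>g g) \<in> J v"
  shows "H ^ N * (S g * dder \<delta> i (th \<theta>f f) - S f * dder \<delta> i (th \<theta>g g)) \<in> J (v + Poly_Mapping.single i 1)"
proof -
  let ?v = "v + Poly_Mapping.single i 1" and ?F = "th \<theta>f f" and ?G = "th \<theta>g g" and ?d = "dder \<delta> i"
  note d = comm_derivations_der[OF comm_derivations_dder[OF der_R] i]
  have F: "?F \<in> J ?v" and G: "?G \<in> J ?v"
    using rank_less_add_single[OF i, of v] \<theta> fg by (auto intro!: th_in_J)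
  have "?d (H ^ N) * S g * ?F + ?d (S g) * H ^ N * ?F - (?d (H ^ N) * S f * ?G + ?d (S f) * H ^ N * ?G) \<in> J ?v"
    by (rule ideal_comb[OF J_ideal F G, of _ "?d (H ^ N) * S g + ?d (S g) * H ^ N" "- (?d (H ^ N) * S f + ?d (S f) * H ^ N)"])
      (simp add: algebra_simps)
  from ideal_comb[OF J_ideal J_dder[OF i N] this, of _ 1 "-1"] show ?thesis
    by (simp add: der_mult[OF d] der_diff[OF d] algebra_simps)
qed

text \<open>Coherence speaks only of the least common derivative of two leaders. Every other one is
  a derivative of it and is reached by repeated differentiation.\<close>

lemma spair:
  assumes fg: "f \<in> \<Lambda>" "g \<in> \<Lambda>" "f \<noteq> g" and \<theta>: "\<theta>f \<in> Theta m" "\<theta>g \<in> Theta m" "\<theta>f + ld f = \<theta>g + ld g"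
  shows "\<exists>N. H ^ N * (S g * th \<theta>f f - S f * th \<theta>g g) \<in> J (\<theta>f + ld f)"
proof -
  \<comment> \<open>With truncated subtraction, \<open>\<sigma>f + ld f\<close> and
    \<open>\<sigma>g + ld g\<close> are both the componentwise maximum of the two leaders, their
    least common multiple.\<close>
  define \<sigma>f \<sigma>g where "\<sigma>f = ld g - ld f" and "\<sigma>g = ld f - ld g"
  have \<sigma>: "\<sigma>f \<in> Theta m" "\<sigma>g \<in> Theta m" "\<sigma>f + ld f = \<sigma>g + ld g"
    by (auto simp: \<sigma>f_def \<sigma>g_def Theta_minus ld_Theta fg lookup_add lookup_minus intro!: poly_mapping_eqI)
  have quot: "\<exists>\<tau>\<in>Theta m. \<theta>f' = \<tau> + \<sigma>f \<and> \<theta>g' = \<tau> + \<sigma>g"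
    if "\<theta>f' \<in> Theta m" "\<theta>g' \<in> Theta m" "\<theta>f' + ld f = \<theta>g' + ld g" for \<theta>f' \<theta>g'
  proof -
    have eq: "Poly_Mapping.lookup \<theta>f' k + Poly_Mapping.lookup (ld f) k = Poly_Mapping.lookup \<theta>g' k + Poly_Mapping.lookup (ld g) k" for k
      using that(3) by (metis lookup_add)
    have "Poly_Mapping.lookup \<sigma>f k \<le> Poly_Mapping.lookup \<theta>f' k" for k
      using eq[of k] by (simp add: \<sigma>f_def lookup_minus)
    then have f': "\<theta>f' - \<sigma>f + \<sigma>f = \<theta>f'" by (rule poly_mapping_minus_add)
    then have "\<theta>f' - \<sigma>f + \<sigma>g + ld g = \<theta>g' + ld g"
      using that(3) \<sigma>(3) by (metis add.assoc)
    then have "\<theta>g' = \<theta>f' - \<sigma>f + \<sigma>g" by simp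
    with f' Theta_minus[OF that(1)] show ?thesis by (metis (no_types))
  qed
  have base: "\<exists>N. H ^ N * (S g * th \<sigma>f f - S f * th \<sigma>g g) \<in> J (\<sigma>f + ld f)"
  proof -
    have "\<not> rank_less m (\<theta>f' + ld f) (\<sigma>f + ld f)"
      if *: "\<theta>f' \<in> Theta m" "\<theta>g' \<in> Theta m" "\<theta>f' + ld f = \<theta>g' + ld g" for \<theta>f' \<theta>g'
    proof
      assume less: "rank_less m (\<theta>f' + ld f) (\<sigma>f + ld f)"
      from quot[OF *] obtain \<tau> where \<tau>: "\<tau> \<in> Theta m" "\<theta>f' = \<tau> + \<sigma>f" by blast
      from rank_less_add_right[OF \<tau>(1), of "\<sigma>f + ld f"] less \<tau>(2) show False
        by (metis add.assoc rank_less_irrefl rank_less_trans)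
    qed
    with coherent fg \<sigma> show ?thesis unfolding coherent_def by blast
  qed
  from quot[OF \<theta>] obtain \<tau> where \<tau>: "\<tau> \<in> Theta m" "\<theta>f = \<tau> + \<sigma>f" "\<theta>g = \<tau> + \<sigma>g" by blast
  from \<tau>(1) have "\<exists>N. H ^ N * (S g * th (\<tau> + \<sigma>f) f - S f * th (\<tau> + \<sigma>g) g) \<in> J (\<tau> + \<sigma>f + ld f)"
  proof (induction rule: Theta_induct)
    case zero
    show ?case using base by simp
  next
    case (step \<tau> i)
    then obtain N where N: "H ^ N * (S g * th (\<tau> + \<sigma>f) f - S f * th (\<tau> + \<sigma>g) g) \<in> J (\<tau> + \<sigma>f + ld f)" by blast
    have *: "\<tau> + Poly_Mapping.single i 1 + \<sigma> = \<tau> + \<sigma> + Poly_Mapping.single i 1" for \<sigma> by (simp add: add_ac)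
    have "\<tau> + \<sigma>g + ld g = \<tau> + \<sigma>f + ld f" using \<sigma>(3) by (simp add: add.assoc)
    from spair_step[OF fg(1,2) _ _ refl this step(2) N] show ?case
      unfolding * theta_poly_add_single[OF der_R step(2)]
      by (intro exI[of _ N]) (simp add: Theta_add \<sigma> step add_ac)
  qed
  then show ?thesis unfolding \<tau> .
qed

lemma algebraic_point:
  "\<exists>s. \<forall>v\<in>Theta m. rs (s v) = theta_val m D v a \<and> (\<forall>f\<in>\<Lambda>. \<forall>\<theta>\<in>Theta m. \<theta> + ld f = v \<longrightarrow> peval s (th \<theta> f) = 0)"
proof (rule rank_recursion)
  fix v and s s' :: "_ \<Rightarrow> 'r"
  assume P: "rs (s v) = theta_val m D v a \<and> (\<forall>f\<in>\<Lambda>. \<forall>\<theta>\<in>Theta m. \<theta> + ld f = v \<longrightarrow> peval s (th \<theta> f) = 0)"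
    and eq: "s v = s' v" "\<And>w. w \<in> Theta m \<Longrightarrow> rank_less m w v \<Longrightarrow> s w = s' w"
  have "peval s' (th \<theta> f) = peval s (th \<theta> f)" if "f \<in> \<Lambda>" "\<theta> \<in> Theta m" "\<theta> + ld f = v" for f \<theta>
    using th_top(1)[OF that(1,2)] th_top(2)[OF that(1,2)] eq that(3)
    by (intro peval_cong) (metis rank_le_def subsetD)
  with P eq(1) show "rs (s' v) = theta_val m D v a \<and> (\<forall>f\<in>\<Lambda>. \<forall>\<theta>\<in>Theta m. \<theta> + ld f = v \<longrightarrow> peval s' (th \<theta> f) = 0)"
    by simp
next
  fix v and s :: "_ \<Rightarrow> 'r"
  assume v: "v \<in> Theta m"
    and P: "\<And>w. w \<in> Theta m \<Longrightarrow> rank_less m w v \<Longrightarrow>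
      rs (s w) = theta_val m D w a \<and> (\<forall>f\<in>\<Lambda>. \<forall>\<theta>\<in>Theta m. \<theta> + ld f = w \<longrightarrow> peval s (th \<theta> f) = 0)"
  let ?a = "\<iota> (theta_val m D v a)"
  \<comment> \<open>The lower values are kept; all others are reset to a canonical lift, so that
    \<open>lifts\<close> holds globally. Those above \<open>v\<close> do not occur in the
    polynomials considered.\<close>
  define t where "t = (\<lambda>w. if w \<in> Theta m \<and> rank_less m w v then s w else \<iota> (theta_val m D w a))"
  have lifts: "lifts (t(v := x))" if "rs x = theta_val m D v a" for x
    using that P by (auto simp: lifts_def t_def)
  have below: "peval (t(v := x)) (th \<theta> f) = 0" if *: "f \<in> \<Lambda>" "\<theta> \<in> Theta m" "rank_less m (\<theta> + ld f) v" for f \<theta> x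
  proof -
    have less: "rank_less m w v" if "w \<in> pvars (th \<theta> f)" for w
      using th_top(2)[OF *(1,2) that] *(3) by (rule rank_le_less_trans)
    then have "v \<notin> pvars (th \<theta> f)" using rank_less_irrefl by blast
    with less have "peval (t(v := x)) (th \<theta> f) = peval s (th \<theta> f)"
      using th_top(1)[OF *(1,2)] by (intro peval_cong) (auto simp: t_def)
    also have "\<dots> = 0" using P[OF _ *(3)] * by (auto simp: Theta_add ld_Theta)
    finally show ?thesis .
  qed
  have "\<exists>x. rs x = theta_val m D v a \<and> (\<forall>f\<in>\<Lambda>. \<forall>\<theta>\<in>Theta m. \<theta> + ld f = v \<longrightarrow> peval (t(v := x)) (th \<theta> f) = 0)"
  proof (cases "\<exists>f\<in>\<Lambda>. \<exists>\<theta>\<in>Theta m. \<theta> + ld f = v")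
    \<comment> \<open>No equation has \<open>v\<close> on top, so any lift will do.\<close>
    case False
    then show ?thesis by (intro exI[of _ ?a]) auto
  next
    case True
    then obtain f \<theta> where f: "f \<in> \<Lambda>" "\<theta> \<in> Theta m" "\<theta> + ld f = v" by blast
    have "peval (t(v := ?a)) (th \<theta> f) \<in> M"
      using rs_peval[OF lifts] ev0_th[OF f(1,2)] by (simp flip: rs_eq_0_iff)
    moreover have "peval (t(v := ?a)) (pdiff v (th \<theta> f)) \<notin> M"
      using peval_S_notin_M[OF lifts f(1)] th_top(3)[OF f(1,2)] f(3) by simp
    ultimately obtain x where x: "x - ?a \<in> M" "peval (t(v := x)) (th \<theta> f) = 0"
      using hensel[of t v ?a "th \<theta> f"] by blast
    have rs_x: "rs x = theta_val m D v a" using x(1) by (simp add: rs_eq_iff)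
    note l = lifts[OF rs_x]
    have "peval (t(v := x)) (th \<theta>' g) = 0" if g: "g \<in> \<Lambda>" "\<theta>' \<in> Theta m" "\<theta>' + ld g = v" for g \<theta>'
    proof (cases "g = f")
      case True
      with g f have "\<theta>' = \<theta>" by (metis add_right_cancel)
      with True x(2) show ?thesis by simp
    next
      case False
      then obtain N where N: "H ^ N * (S g * th \<theta> f - S f * th \<theta>' g) \<in> J (\<theta> + ld f)"
        using spair[OF f(1) g(1) _ f(2) g(2)] f(3) g(3) by auto
      \<comment> \<open>Lower derivatives vanish, so the relation vanishes; as
        \<open>th \<theta> f\<close> is zero too, only \<open>H ^ N * S f * th \<theta>' g\<close>
        is left up to sign, with two unit factors in front.\<close>
      have "peval (t(v := x)) (H ^ N * (S g * th \<theta> f - S f * th \<theta>' g)) = 0"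
        by (rule J_vanish[OF N[unfolded f(3)] below])
      then have "peval (t(v := x)) H ^ N * (peval (t(v := x)) (S f) * peval (t(v := x)) (th \<theta>' g)) = 0"
        using x(2) by (simp add: rhom_simps[OF rhom_peval] del: fun_upd_apply)
      then show ?thesis
        using cancel[OF peval_H_notin_M[OF l]] cancel[OF peval_S_notin_M[OF l f(1)]] by blast
    qed
    with rs_x show ?thesis by blast
  qed
  then obtain x where x: "rs x = theta_val m D v a"
    "\<And>f \<theta>. f \<in> \<Lambda> \<Longrightarrow> \<theta> \<in> Theta m \<Longrightarrow> \<theta> + ld f = v \<Longrightarrow> peval (t(v := x)) (th \<theta> f) = 0" by blast
  have "peval (s(v := x)) (th \<theta> f) = peval (t(v := x)) (th \<theta> f)" if "f \<in> \<Lambda>" "\<theta> \<in> Theta m" "\<theta> + ld f = v" for f \<theta>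
    using th_top(1)[OF that(1,2)] th_top(2)[OF that(1,2)] that(3)
    by (intro peval_cong) (auto simp: rank_le_def t_def)
  with x show "\<exists>x. rs ((s(v := x)) v) = theta_val m D v a \<and>
      (\<forall>f\<in>\<Lambda>. \<forall>\<theta>\<in>Theta m. \<theta> + ld f = v \<longrightarrow> peval (s(v := x)) (th \<theta> f) = 0)"
    by (intro exI[of _ x]) simp
qed

end

subsection \<open>The largest differential ideal inside a prime ideal\<close>

lemma der_of_nat: "is_der d \<Longrightarrow> d (of_nat k) = 0"
  by (induction k) (simp_all add: der_zero der_add der_one)

lemma funpow_leibniz:
  assumes d: "is_der d"
  shows "(d ^^ n) (x * y) = (\<Sum>k\<le>n. of_nat (n choose k) * ((d ^^ k) x * (d ^^ (n - k)) y))"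
proof (induction n)
  case (Suc n)
  let ?a = "\<lambda>k. (d ^^ k) x" and ?b = "\<lambda>k. (d ^^ k) y"
  have "(d ^^ Suc n) (x * y) = (\<Sum>k\<le>n. of_nat (n choose k) * (?a (Suc k) * ?b (n - k))) + (\<Sum>k\<le>n. of_nat (n choose k) * (?a k * ?b (Suc n - k)))"
    by (simp add: Suc der_sum[OF d] der_mult[OF d] der_of_nat[OF d] distrib_left sum.distrib Suc_diff_le)
  also have "(\<Sum>k\<le>n. of_nat (n choose k) * (?a k * ?b (Suc n - k))) = (\<Sum>k\<le>Suc n. of_nat (n choose k) * (?a k * ?b (Suc n - k)))"
    by (simp add: binomial_eq_0)
  also have "\<dots> = ?a 0 * ?b (Suc n) + (\<Sum>k\<le>n. of_nat (n choose Suc k) * (?a (Suc k) * ?b (n - k)))"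
    by (simp only: sum.atMost_Suc_shift) simp
  finally show ?case
    by (simp only: sum.atMost_Suc_shift binomial_Suc_Suc of_nat_add distrib_right sum.distrib) (simp add: add_ac)
qed simp

lemma ideal_sum: "is_ideal I \<Longrightarrow> (\<And>x. x \<in> A \<Longrightarrow> g x \<in> I) \<Longrightarrow> sum g A \<in> I"
  by (induction A rule: infinite_finite_induct) (auto simp: is_ideal_def)

lemma ideal_mult: "is_ideal I \<Longrightarrow> x \<in> I \<Longrightarrow> r * x \<in> I"
  by (auto simp: is_ideal_def)

lemma funpow_add_der: "is_der d \<Longrightarrow> (d ^^ n) (x + y) = (d ^^ n) x + (d ^^ n) y"
  by (induction n) (simp_all add: der_add)

lemma funpow_zero_der: "is_der d \<Longrightarrow> (d ^^ n) 0 = 0"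
  by (induction n) (simp_all add: der_zero)

text \<open>Stage \<open>k\<close> asks that all derivatives by the first \<open>k\<close>
  derivations lie in \<open>Q\<close>. Adding one derivation at a time reduces primality and the
  comparison of coordinates to Leibniz' rule for powers of a single derivation.\<close>

primrec diff_core :: "(nat \<Rightarrow> 'b \<Rightarrow> 'b) \<Rightarrow> 'b set \<Rightarrow> nat \<Rightarrow> 'b set" where
  "diff_core d Q 0 = Q"
| "diff_core d Q (Suc i) = {p. \<forall>n. (d i ^^ n) p \<in> diff_core d Q i}"

lemma diff_core_subset: "p \<in> diff_core d Q k \<Longrightarrow> p \<in> Q"
proof (induction k arbitrary: p)
  case (Suc k)
  then have "(d k ^^ 0) p \<in> diff_core d Q k" by (simp only: diff_core.simps mem_Collect_eq)
  with Suc.IH show ?case by simp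
qed simp

text \<open>The way to prove membership: exhibit a stable set inside \<open>Q\<close> that contains
  the element.\<close>

lemma diff_core_supset:
  assumes "A \<subseteq> Q" "\<And>i p. i < k \<Longrightarrow> p \<in> A \<Longrightarrow> d i p \<in> A"
  shows "A \<subseteq> diff_core d Q k"
  using assms(2)
proof (induction k)
  case (Suc k)
  have "(d k ^^ n) p \<in> A" if "p \<in> A" for n p
    by (induction n) (use that Suc.prems in auto)
  with Suc show ?case by (auto simp: subset_iff)
qed (use assms(1) in simp)

lemma diff_core_ideal:
  assumes "is_ideal Q" "\<And>i. i < k \<Longrightarrow> is_der (d i)"
  shows "is_ideal (diff_core d Q k)"
  using assms(2)
proof (induction k)
  case (Suc k)
  then have I: "is_ideal (diff_core d Q k)" and d: "is_der (d k)" by auto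
  have mult: "(d k ^^ n) (r * x) \<in> diff_core d Q k" if "\<forall>n. (d k ^^ n) x \<in> diff_core d Q k" for n r x
    unfolding funpow_leibniz[OF d] by (intro ideal_sum ideal_mult I that[rule_format])
  have zero: "(d k ^^ n) 0 \<in> diff_core d Q k" for n
    unfolding funpow_zero_der[OF d] using I unfolding is_ideal_def by (rule conjunct1)
  have add: "(d k ^^ n) (x + y) \<in> diff_core d Q k"
    if "\<forall>n. (d k ^^ n) x \<in> diff_core d Q k" "\<forall>n. (d k ^^ n) y \<in> diff_core d Q k" for n x y
    unfolding funpow_add_der[OF d] using I that unfolding is_ideal_def by blast
  show ?case
    unfolding is_ideal_def diff_core.simps mem_Collect_eq Ball_def using zero add mult by blast
qed (use assms(1) in simp)

text \<open>The last derivation shifts the exponent \<open>n\<close> by one; an earlier one is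
  commuted past its powers and handled at the previous stage.\<close>

lemma diff_core_stable:
  assumes d: "comm_derivations m d" and "k \<le> m" "i < k" "p \<in> diff_core d Q k"
  shows "d i p \<in> diff_core d Q k"
  using assms(2-4)
proof (induction k arbitrary: p)
  case (Suc k)
  show ?case
  proof (cases "i = k")
    case True
    have "(d k ^^ n) (d k p) \<in> diff_core d Q k" for n
    proof -
      have "(d k ^^ Suc n) p \<in> diff_core d Q k"
        using Suc.prems(3) unfolding diff_core.simps by blast
      then show ?thesis by (simp only: funpow_Suc_right comp_apply)
    qed
    with True show ?thesis by simp
  next
    case False
    have "(d k ^^ n) (d i p) = d i ((d k ^^ n) p)" for n
      using Suc.prems(1,2) by (induction n) (simp_all add: comm_derivations_commute[OF d])
    with Suc False show ?thesis by simp
  qed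
qed simp

text \<open>Leibniz' rule at the first derivatives of \<^term>\<open>x\<close> and \<^term>\<open>y\<close> that leave \<^term>\<open>Q\<close>: all other
  terms lie in \<^term>\<open>Q\<close>, and the binomial coefficient is invertible modulo \<^term>\<open>Q\<close>.\<close>

lemma prime_step:
  assumes I: "is_ideal Q" and prime: "\<And>x y. x * y \<in> Q \<Longrightarrow> x \<in> Q \<or> y \<in> Q"
    and char: "\<And>n. n > 0 \<Longrightarrow> of_nat n \<notin> Q" and d: "is_der d"
    and xy: "\<And>n. (d ^^ n) (x * y) \<in> Q"
  shows "(\<forall>n. (d ^^ n) x \<in> Q) \<or> (\<forall>n. (d ^^ n) y \<in> Q)"
proof (rule ccontr)
  assume "\<not> ?thesis"
  then have ex: "\<exists>k. (d ^^ k) x \<notin> Q" "\<exists>l. (d ^^ l) y \<notin> Q" by blast+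
  define k l where "k = (LEAST k. (d ^^ k) x \<notin> Q)" and "l = (LEAST l. (d ^^ l) y \<notin> Q)"
  have k: "(d ^^ k) x \<notin> Q" and l: "(d ^^ l) y \<notin> Q"
    unfolding k_def l_def using LeastI_ex[OF ex(1)] LeastI_ex[OF ex(2)] by simp_all
  have k': "(d ^^ j) x \<in> Q" if "j < k" for j using not_less_Least[of j "\<lambda>k. (d ^^ k) x \<notin> Q"] that by (auto simp: k_def)
  have l': "(d ^^ j) y \<in> Q" if "j < l" for j using not_less_Least[of j "\<lambda>k. (d ^^ k) y \<notin> Q"] that by (auto simp: l_def)
  let ?t = "\<lambda>j. of_nat (k + l choose j) * ((d ^^ j) x * (d ^^ (k + l - j)) y)"
  have "?t j \<in> Q" if "j \<in> {..k + l} - {k}" for j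
  proof (cases "j < k")
    case True
    then show ?thesis using ideal_mult[OF I ideal_mult[OF I k'[of j]]] by (simp add: mult.commute[of "(d ^^ j) x"])
  next
    case False
    with that have "k + l - j < l" by auto
    then show ?thesis using ideal_mult[OF I ideal_mult[OF I l'[of "k + l - j"]]] by simp
  qed
  then have rest: "(\<Sum>j\<in>{..k + l} - {k}. ?t j) \<in> Q" by (rule ideal_sum[OF I])
  have "(d ^^ (k + l)) (x * y) = ?t k + (\<Sum>j\<in>{..k + l} - {k}. ?t j)"
    unfolding funpow_leibniz[OF d] by (rule sum.remove) auto
  then have "?t k = 1 * (d ^^ (k + l)) (x * y) + (- 1) * (\<Sum>j\<in>{..k + l} - {k}. ?t j)" by simp
  from ideal_comb[OF I xy rest this] have "?t k \<in> Q" .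
  then have "of_nat (k + l choose k) \<in> Q \<or> (d ^^ k) x \<in> Q \<or> (d ^^ l) y \<in> Q"
    using prime[of "of_nat (k + l choose k)" "(d ^^ k) x * (d ^^ l) y"] prime[of "(d ^^ k) x" "(d ^^ l) y"] by auto
  with k l char[of "k + l choose k"] show False by (simp add: zero_less_binomial)
qed

text \<open>Each stage is contained in \<open>Q\<close>, so positive integers stay outside it and
  the single-derivation argument applies again.\<close>

lemma diff_core_prime:
  assumes I: "is_ideal Q" and prime: "\<And>x y. x * y \<in> Q \<Longrightarrow> x \<in> Q \<or> y \<in> Q"
    and char: "\<And>n. n > 0 \<Longrightarrow> of_nat n \<notin> Q" and d: "\<And>i. i < k \<Longrightarrow> is_der (d i)"
  shows "x * y \<in> diff_core d Q k \<Longrightarrow> x \<in> diff_core d Q k \<or> y \<in> diff_core d Q k"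
  using d
proof (induction k arbitrary: x y)
  case (Suc k)
  have "(\<forall>n. (d k ^^ n) x \<in> diff_core d Q k) \<or> (\<forall>n. (d k ^^ n) y \<in> diff_core d Q k)"
  proof (rule prime_step)
    show "is_ideal (diff_core d Q k)" by (rule diff_core_ideal[OF I]) (use Suc.prems(2) in simp)
    show "of_nat n \<notin> diff_core d Q k" if "n > 0" for n using char[OF that] diff_core_subset[of "of_nat n" d Q k] by blast
    show "u \<in> diff_core d Q k \<or> w \<in> diff_core d Q k" if "u * w \<in> diff_core d Q k" for u w
      by (rule Suc.IH[OF that]) (use Suc.prems(2) in simp)
    show "is_der (d k)" using Suc.prems(2) by simp
    show "(d k ^^ n) (x * y) \<in> diff_core d Q k" for n using Suc.prems(1) unfolding diff_core.simps by blast
  qed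
  then show ?case unfolding diff_core.simps by blast
qed (use prime in simp)

subsection \<open>Descent to the base field\<close>

lemma lookup_const_mult: "Poly_Mapping.lookup (Poly_Mapping.single 0 c * f) \<mu> = c * Poly_Mapping.lookup f \<mu>"
  for f :: "('v \<Rightarrow>\<^sub>0 nat) \<Rightarrow>\<^sub>0 'c::comm_ring_1"
  using mult_map_scale_conv_mult[of c f] lookup_map_coeffs[of "(*) c" f \<mu>] by (simp add: map_coeffs_def)

lemma rhom_const_comp: "is_rhom \<phi> \<Longrightarrow> is_rhom (\<lambda>c. Poly_Mapping.single 0 (\<phi> c) :: ('v \<Rightarrow>\<^sub>0 nat) \<Rightarrow>\<^sub>0 'c::comm_ring_1)"
  by (rule rhom_comp[OF rhom_const])

lemma ydder_hom:
  assumes "is_rhom \<phi>" "comm_derivations m D" "comm_derivations m D'" "i < m" "\<And>c. D' i (\<phi> c) = \<phi> (D i c)"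
  shows "poly_hom (\<lambda>c. Poly_Mapping.single 0 (\<phi> c)) pvar (ydder D i p) = ydder D' i (poly_hom (\<lambda>c. Poly_Mapping.single 0 (\<phi> c)) pvar p)"
  unfolding ydder_def[of D]
  by (rule poly_hom_poly_der)
    (auto simp: assms rhom_const_comp comm_derivations_der[OF assms(2)] comm_derivations_der[OF comm_derivations_ydder[OF assms(3)]]
      ydder_const[OF assms(3,4)] ydder_pvar[OF assms(3,4)] poly_hom_pvar simp del: One_nat_def)

lemma pvars_ydder: "pvars (ydder D i p) \<subseteq> pvars p \<union> (\<lambda>(j, \<theta>). (j, \<theta> + Poly_Mapping.single i 1)) ` pvars p"
  using pvars_poly_der[of "D i" "\<lambda>(j, \<theta>). pvar (j, \<theta> + Poly_Mapping.single i 1)" p]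
  by (force simp: ydder_def pvars_pvar)

text \<open>The \<open>\<theta>\<close>-derivative of a generic element of the algebra, whose
  coordinates in \<open>e\<close> are differential indeterminates.\<close>

definition generic :: "nat \<Rightarrow> (nat \<Rightarrow> 'r::comm_ring_1 \<Rightarrow> 'r) \<Rightarrow> nat \<Rightarrow> (nat \<Rightarrow> 'r) \<Rightarrow> (nat \<Rightarrow>\<^sub>0 nat) \<Rightarrow>
    (nat \<times> (nat \<Rightarrow>\<^sub>0 nat) \<Rightarrow>\<^sub>0 nat) \<Rightarrow>\<^sub>0 'r" where
  "generic m \<delta> n e \<theta> = theta_val m (ydder \<delta>) \<theta> (\<Sum>j<n. Poly_Mapping.single 0 (e j) * pvar (j, 0))"

lemma generic_zero: "generic m \<delta> n e 0 = (\<Sum>j<n. Poly_Mapping.single 0 (e j) * pvar (j, 0))"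
  by (simp add: generic_def)

lemma generic_add_single:
  "comm_derivations m \<delta> \<Longrightarrow> i < m \<Longrightarrow> generic m \<delta> n e (\<theta> + Poly_Mapping.single i 1) = ydder \<delta> i (generic m \<delta> n e \<theta>)"
  unfolding generic_def by (rule theta_val_add_single[OF comm_derivations_ydder])

text \<open>Differentiating a basis element leaves its indeterminate at a lower rank. The
  coordinates at \<open>\<theta>\<close> therefore enter the \<open>\<theta>\<close>-derivative with
  the undifferentiated basis, which makes its value freely adjustable.\<close>

lemma generic_top:
  assumes \<delta>: "comm_derivations m \<delta>" and "\<theta> \<in> Theta m"
  shows "\<exists>g. generic m \<delta> n e \<theta> = (\<Sum>j<n. Poly_Mapping.single 0 (e j) * pvar (j, \<theta>)) + g
    \<and> pvars g \<subseteq> {(j, w). w \<in> Theta m \<and> rank_less m w \<theta>}"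
  using assms(2)
proof (induction rule: Theta_induct)
  case zero
  show ?case by (rule exI[of _ 0]) (simp add: generic_zero)
next
  case (step \<theta> i)
  let ?e = "Poly_Mapping.single i (1::nat)" and ?V = "\<lambda>\<theta>. {(j, w). w \<in> Theta m \<and> rank_less m w \<theta>} :: (nat \<times> _) set"
  note d = comm_derivations_der[OF comm_derivations_ydder[OF \<delta>] step(2)]
  have less: "rank_less m \<theta> (\<theta> + ?e)" by (rule rank_less_add_single[OF step(2)])
  from step obtain g where g: "generic m \<delta> n e \<theta> = (\<Sum>j<n. Poly_Mapping.single 0 (e j) * pvar (j, \<theta>)) + g" "pvars g \<subseteq> ?V \<theta>"
    by blast
  let ?g = "(\<Sum>j<n. Poly_Mapping.single 0 (\<delta> i (e j)) * pvar (j, \<theta>)) + ydder \<delta> i g"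
  have "generic m \<delta> n e (\<theta> + ?e) = (\<Sum>j<n. Poly_Mapping.single 0 (e j) * pvar (j, \<theta> + ?e)) + ?g"
    unfolding generic_add_single[OF \<delta> step(2)] g(1)
    by (simp add: der_add[OF d] der_sum[OF d] der_mult[OF d] ydder_const[OF \<delta> step(2)] ydder_pvar[OF \<delta> step(2)]
        sum.distrib add_ac del: One_nat_def)
  moreover have "pvars ?g \<subseteq> ?V (\<theta> + ?e)"
  proof (intro order.trans[OF pvars_add] Un_least pvars_sum_le order.trans[OF pvars_mult] order.trans[OF pvars_ydder])
    show "pvars g \<subseteq> ?V (\<theta> + ?e)" using g(2) less rank_less_trans by blast
    show "(\<lambda>(j, \<theta>). (j, \<theta> + ?e)) ` pvars g \<subseteq> ?V (\<theta> + ?e)"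
      using g(2) step(2) by (auto intro!: Theta_add single_in_Theta rank_less_add simp del: One_nat_def)
  qed (use step less in \<open>auto simp: pvars_pvar simp del: One_nat_def\<close>)
  ultimately show ?case by blast
qed

lemma generic_vars:
  assumes "comm_derivations m \<delta>" "\<theta> \<in> Theta m"
  shows "pvars (generic m \<delta> n e \<theta>) \<subseteq> {(j, w). w = \<theta> \<or> w \<in> Theta m \<and> rank_less m w \<theta>}"
proof -
  from generic_top[OF assms] obtain g where g: "generic m \<delta> n e \<theta> = (\<Sum>j<n. Poly_Mapping.single 0 (e j) * pvar (j, \<theta>)) + g"
    "pvars g \<subseteq> {(j, w). w \<in> Theta m \<and> rank_less m w \<theta>}" by blast
  show ?thesis
    unfolding g(1)
    by (intro order.trans[OF pvars_add] Un_least pvars_sum_le order.trans[OF pvars_mult]) (use g(2) in \<open>auto simp: pvars_pvar\<close>)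
qed

context coherent_system
begin

text \<open>Notation: \<open>\<Psi>\<close> and \<open>\<psi>\<close> evaluate at the algebraic
  point, \<open>\<zeta>\<close> and \<open>\<eta>\<close> at the differential one, over the algebra
  and the base field respectively. \<open>E\<close> and \<open>\<rho>\<close> extend
  \<open>\<iota>\<close> and the residue map to coefficients, and \<open>\<sigma>\<close>
  substitutes the generic element.\<close>

lemma differential_solution: "\<exists>b. rs b = a \<and> (\<forall>f\<in>\<Lambda>. deval m \<delta> f b = 0)"
proof -
  obtain n :: nat and e co where co: "\<And>r. r = (\<Sum>j<n. \<iota> (co r j) * e j)"
    and indep: "\<And>c. (\<Sum>j<n. \<iota> (c j) * e j) = 0 \<Longrightarrow> \<forall>j<n. c j = 0"
    using basis_exists by blast
  have co_zero: "co 0 j = 0" if "j < n" for j using indep[of "co 0"] co[of 0] that by simp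
  obtain s where s: "\<And>v. v \<in> Theta m \<Longrightarrow> rs (s v) = theta_val m D v a"
    "\<And>f \<theta>. f \<in> \<Lambda> \<Longrightarrow> \<theta> \<in> Theta m \<Longrightarrow> peval s (th \<theta> f) = 0"
    using algebraic_point by (metis Theta_add ld_Theta)

  define dA where "dA = ydder D"
  define dR where "dR = ydder \<delta>"
  have dA: "comm_derivations m dA" and dR: "comm_derivations m dR"
    by (simp_all add: dA_def dR_def comm_derivations_ydder der_L der_R)
  define Y where "Y = generic m \<delta> n e"
  have Y_add: "Y (\<theta> + Poly_Mapping.single i 1) = dR i (Y \<theta>)" if "i < m" for \<theta> i
    unfolding Y_def dR_def by (rule generic_add_single[OF der_R that])
  define E where "E = poly_hom (\<lambda>c. Poly_Mapping.single 0 (\<iota> c)) (pvar :: nat \<times> (nat \<Rightarrow>\<^sub>0 nat) \<Rightarrow> _)"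
  have E: "is_rhom E" by (simp add: E_def rhom_poly_hom rhom_const_comp rhom_\<iota>)
  have E_der: "E (dA i p) = dR i (E p)" if "i < m" for i p
    unfolding E_def dA_def dR_def by (rule ydder_hom) (use that in \<open>simp_all add: rhom_\<iota> der_L der_R der_ext\<close>)
  have E_map: "E p = map_coeffs \<iota> p" for p
    using poly_hom_map_coeffs[OF rhom_const, of \<iota> pvar p] by (simp add: E_def poly_hom_const_pvar rhom_zero[OF rhom_\<iota>])

  \<comment> \<open>The algebraic solution in coordinates. The system is triangular for the ranking:
    the coordinates at \<open>\<theta>\<close> absorb the difference between
    \<open>s \<theta>\<close> and the contribution of lower ones.\<close>
  have "\<exists>h. \<forall>\<theta>\<in>Theta m. peval (\<lambda>(j, w). \<iota> (h w j)) (Y \<theta>) = s \<theta>"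
  proof (rule rank_recursion)
    fix \<theta> and h h' :: "(nat \<Rightarrow>\<^sub>0 nat) \<Rightarrow> nat \<Rightarrow> 'a"
    assume \<theta>: "\<theta> \<in> Theta m" and P: "peval (\<lambda>(j, w). \<iota> (h w j)) (Y \<theta>) = s \<theta>"
      and eq: "h \<theta> = h' \<theta>" "\<And>w. w \<in> Theta m \<Longrightarrow> rank_less m w \<theta> \<Longrightarrow> h w = h' w"
    have "peval (\<lambda>(j, w). \<iota> (h' w j)) (Y \<theta>) = peval (\<lambda>(j, w). \<iota> (h w j)) (Y \<theta>)"
      using generic_vars[OF der_R \<theta>, of n e] eq by (intro peval_cong) (auto simp: Y_def)
    with P show "peval (\<lambda>(j, w). \<iota> (h' w j)) (Y \<theta>) = s \<theta>" by simp
  next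
    fix \<theta> and h :: "(nat \<Rightarrow>\<^sub>0 nat) \<Rightarrow> nat \<Rightarrow> 'a"
    assume \<theta>: "\<theta> \<in> Theta m"
    from generic_top[OF der_R \<theta>, of n e] obtain g
      where g: "Y \<theta> = (\<Sum>j<n. Poly_Mapping.single 0 (e j) * pvar (j, \<theta>)) + g"
        "pvars g \<subseteq> {(j, w). w \<in> Theta m \<and> rank_less m w \<theta>}" by (auto simp: Y_def)
    let ?G = "peval (\<lambda>(j, w). \<iota> (h w j)) g"
    let ?h = "h(\<theta> := co (s \<theta> - ?G))"
    have "peval (\<lambda>(j, w). \<iota> (?h w j)) g = ?G"
      using g(2) by (intro peval_cong) auto
    then have "peval (\<lambda>(j, w). \<iota> (?h w j)) (Y \<theta>) = (\<Sum>j<n. e j * \<iota> (co (s \<theta> - ?G) j)) + ?G"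
      unfolding g(1) by (simp add: rhom_simps[OF rhom_peval] peval_const peval_pvar)
    also have "\<dots> = s \<theta>" using co[of "s \<theta> - ?G"] by (simp add: mult.commute)
    finally show "\<exists>x. peval (\<lambda>(j, w). \<iota> ((h(\<theta> := x)) w j)) (Y \<theta>) = s \<theta>" by blast
  qed
  then obtain h where h: "\<And>\<theta>. \<theta> \<in> Theta m \<Longrightarrow> peval (\<lambda>(j, w). \<iota> (h w j)) (Y \<theta>) = s \<theta>" by blast
  define \<Psi> where "\<Psi> = peval (\<lambda>(j, w). \<iota> (h w j))"
  define \<psi> where "\<psi> = peval (\<lambda>(j, w). h w j)"
  have \<Psi>: "is_rhom \<Psi>" and \<psi>: "is_rhom \<psi>" by (simp_all add: \<Psi>_def \<psi>_def rhom_peval)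
  have \<Psi>E: "\<Psi> (E p) = \<iota> (\<psi> p)" for p
    by (rule rhom_poly_ext[where F="\<lambda>p. \<Psi> (E p)" and G="\<lambda>p. \<iota> (\<psi> p)"])
      (auto simp: rhom_comp \<Psi> E rhom_\<iota> \<psi>, auto simp: \<Psi>_def \<psi>_def E_def poly_hom_const poly_hom_pvar rhom_const_comp rhom_\<iota> peval_const peval_pvar)

  define \<sigma> where "\<sigma> = poly_hom (\<lambda>c. Poly_Mapping.single 0 c) Y"
  have \<sigma>_der: "\<sigma> (dder \<delta> i f) = dR i (\<sigma> f)" if "i < m" for i f
    unfolding \<sigma>_def dder_eq_poly_der
    by (rule poly_hom_poly_der)
      (use that in \<open>simp_all add: rhom_const comm_derivations_der[OF der_R] comm_derivations_der[OF comm_derivations_ydder[OF der_R]]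
        Y_add poly_hom_pvar dR_def ydder_const[OF der_R] del: One_nat_def\<close>)
  have hom_\<sigma>: "F (\<sigma> f) = peval (\<lambda>v. F (Y v)) f" if "is_rhom F" "\<And>c. F (Poly_Mapping.single 0 c) = c" for F f
    using rhom_peval_poly_hom[OF rhom_const that(1), of Y f] that(2) by (simp add: \<sigma>_def peval_eq_poly_hom)

  define Q where "Q = diff_core dA {p. \<psi> p = 0}"
  define QR where "QR = diff_core dR {p. \<Psi> p = 0}"
  have ideal_\<psi>: "is_ideal {p. \<psi> p = 0}" and ideal_\<Psi>: "is_ideal {p. \<Psi> p = 0}"
    by (auto simp: is_ideal_def rhom_simps[OF \<psi>] rhom_simps[OF \<Psi>])
  have Q_ideal: "is_ideal (Q k)" and QR_ideal: "is_ideal (QR k)" if "k \<le> m" for k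
    unfolding Q_def QR_def using that
    by (auto intro!: diff_core_ideal ideal_\<psi> ideal_\<Psi> comm_derivations_der[OF dA] comm_derivations_der[OF dR])
  have E_pow: "(dR i ^^ N) (E p) = E ((dA i ^^ N) p)" if "i < m" for i N p
    using that by (induction N) (simp_all add: E_der)
  have EQ: "E p \<in> QR k" if "k \<le> m" "p \<in> Q k" for k p
    using that
  proof (induction k arbitrary: p)
    case 0
    then show ?case by (simp add: Q_def QR_def \<Psi>E rhom_zero[OF rhom_\<iota>])
  next
    case (Suc k)
    then show ?case by (auto simp: Q_def QR_def E_pow)
  qed

  \<comment> \<open>Stage 0 is linear independence of the basis. At a later stage, induction on the
    order \<open>N\<close> of the new derivation disposes of the terms in which it has hit a basis
    element.\<close>
  have descend: "\<forall>j<n. p j \<in> Q k" if "k \<le> m" "(\<Sum>j<n. Poly_Mapping.single 0 (e j) * E (p j)) \<in> QR k" for k p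
    using that
  proof (induction k arbitrary: p)
    case 0
    then have "(\<Sum>j<n. \<iota> (\<psi> (p j)) * e j) = 0"
      by (simp add: QR_def rhom_simps[OF \<Psi>] \<Psi>E, simp add: \<Psi>_def peval_const mult.commute)
    from indep[OF this] show ?case by (simp add: Q_def)
  next
    case (Suc k)
    then have k: "k < m" "k \<le> m" by auto
    note d = comm_derivations_der[OF dR k(1)]
    have "\<forall>j<n. (dA k ^^ N) (p j) \<in> Q k" for N
    proof (induction N rule: less_induct)
      case (less N)
      let ?c = "\<lambda>j. Poly_Mapping.single 0 (e j)"
      let ?t = "\<lambda>j l. of_nat (N choose l) * ((dR k ^^ l) (?c j) * E ((dA k ^^ (N - l)) (p j)))"
      \<comment> \<open>Only terms with at least one derivative on the basis element, hence the
        shift to \<open>Suc l\<close>; they contain derivatives of \<open>p j\<close> of order below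
        \<open>N\<close>.\<close>
      have rest: "(\<Sum>j<n. \<Sum>l<N. ?t j (Suc l)) \<in> QR k"
      proof (intro ideal_sum QR_ideal k(2) ideal_mult)
        fix j l assume "j \<in> {..<n}" "l \<in> {..<N}"
        with less.IH[of "N - Suc l"] show "E ((dA k ^^ (N - Suc l)) (p j)) \<in> QR k" by (intro EQ k(2)) auto
      qed
      have all: "(dR k ^^ N) (\<Sum>j<n. ?c j * E (p j)) \<in> QR k"
        using Suc.prems(2) by (simp add: QR_def)
      have split: "(dR k ^^ N) (\<Sum>j<n. ?c j * E (p j)) = (\<Sum>j<n. ?c j * E ((dA k ^^ N) (p j))) + (\<Sum>j<n. \<Sum>l<N. ?t j (Suc l))"
      proof -
        have "(dR k ^^ N) (\<Sum>j\<in>A. ?c j * E (p j)) = (\<Sum>j\<in>A. (dR k ^^ N) (?c j * E (p j)))" for A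
          by (induction A rule: infinite_finite_induct) (simp_all add: funpow_zero_der[OF d] funpow_add_der[OF d])
        moreover have "(dR k ^^ N) (?c j * E (p j)) = ?c j * E ((dA k ^^ N) (p j)) + (\<Sum>l<N. ?t j (Suc l))" for j
          unfolding funpow_leibniz[OF d] E_pow[OF k(1)] by (simp add: sum.atMost_shift)
        ultimately show ?thesis by (simp add: sum.distrib)
      qed
      have "(\<Sum>j<n. ?c j * E ((dA k ^^ N) (p j)))
          = 1 * (dR k ^^ N) (\<Sum>j<n. ?c j * E (p j)) + (- 1) * (\<Sum>j<n. \<Sum>l<N. ?t j (Suc l))"
        unfolding split mult_1 mult_minus1 add_uminus_conv_diff add_diff_cancel_right' ..
      from ideal_comb[OF QR_ideal[OF k(2)] all rest this]
      have "(\<Sum>j<n. ?c j * E ((dA k ^^ N) (p j))) \<in> QR k" .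
      from Suc.IH[OF k(2) this] show ?case .
    qed
    then show ?case by (simp add: Q_def)
  qed

  \<comment> \<open>The equations over the base field: coordinates taken coefficient by coefficient
    in the equations for the generic element.\<close>
  define F where "F = (\<lambda>f j. map_coeffs (\<lambda>r. co r j) (\<sigma> f))"
  have F_decomp: "\<sigma> f = (\<Sum>j<n. Poly_Mapping.single 0 (e j) * E (F f j))" for f
  proof (rule poly_mapping_eqI)
    fix \<mu>
    have "(\<Sum>j<n. e j * \<iota> (co (Poly_Mapping.lookup (\<sigma> f) \<mu>) j)) = Poly_Mapping.lookup (\<sigma> f) \<mu>"
      using co[of "Poly_Mapping.lookup (\<sigma> f) \<mu>"] by (simp add: mult.commute)
    then show "Poly_Mapping.lookup (\<sigma> f) \<mu> = Poly_Mapping.lookup (\<Sum>j<n. Poly_Mapping.single 0 (e j) * E (F f j)) \<mu>"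
      by (simp add: lookup_sum lookup_const_mult E_map F_def lookup_map_coeffs rhom_zero[OF rhom_\<iota>] co_zero)
  qed
  \<comment> \<open>The stable set is the image under \<open>\<sigma>\<close> of all derivatives of
    \<open>f\<close>, each of which vanishes at the algebraic solution.\<close>
  have \<sigma>_in: "\<sigma> f \<in> QR m" if f: "f \<in> \<Lambda>" for f
  proof -
    let ?A = "{\<sigma> (th \<theta> f) | \<theta>. \<theta> \<in> Theta m}"
    have "?A \<subseteq> QR m"
      unfolding QR_def
    proof (rule diff_core_supset)
      show "?A \<subseteq> {p. \<Psi> p = 0}"
      proof clarify
        fix \<theta> assume \<theta>: "\<theta> \<in> Theta m"
        have "\<Psi> (\<sigma> (th \<theta> f)) = peval (\<lambda>v. \<Psi> (Y v)) (th \<theta> f)"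
          by (rule hom_\<sigma>[OF \<Psi>]) (simp add: \<Psi>_def peval_const)
        also have "\<dots> = peval s (th \<theta> f)"
          using th_top(1)[OF f \<theta>] h by (intro peval_cong) (auto simp: \<Psi>_def)
        finally show "\<Psi> (\<sigma> (th \<theta> f)) = 0" using s(2)[OF f \<theta>] by simp
      qed
      fix i p assume i: "i < m" and "p \<in> ?A"
      then obtain \<theta> where \<theta>: "p = \<sigma> (th \<theta> f)" "\<theta> \<in> Theta m" by blast
      have "dR i p = \<sigma> (th (\<theta> + Poly_Mapping.single i 1) f)"
        unfolding \<theta> theta_poly_add_single[OF der_R i] \<sigma>_der[OF i] ..
      moreover have "\<theta> + Poly_Mapping.single i 1 \<in> Theta m" by (intro Theta_add single_in_Theta i \<theta>)
      ultimately show "dR i p \<in> ?A" by blast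
    qed
    moreover have "\<sigma> f \<in> ?A" by (intro CollectI exI[of _ 0]) simp
    ultimately show ?thesis by blast
  qed
  have F_in: "F f j \<in> Q m" if "f \<in> \<Lambda>" "j < n" for f j
    using descend[of m "F f"] \<sigma>_in[OF that(1)] that(2) by (simp flip: F_decomp)

  define \<rho> where "\<rho> = poly_hom (\<lambda>c. Poly_Mapping.single 0 (rs c)) (pvar :: nat \<times> (nat \<Rightarrow>\<^sub>0 nat) \<Rightarrow> _)"
  have \<rho>: "is_rhom \<rho>" by (simp add: \<rho>_def rhom_poly_hom rhom_const_comp rhom_rs)
  have \<rho>_der: "\<rho> (dR i p) = dA i (\<rho> p)" if "i < m" for i p
    unfolding \<rho>_def dA_def dR_def by (rule ydder_hom) (use that in \<open>simp_all add: rhom_rs der_L der_R rs_\<delta>\<close>)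
  have \<psi>\<rho>: "\<psi> (\<rho> p) = rs (\<Psi> p)" for p
    by (rule rhom_poly_ext[where F="\<lambda>p. \<psi> (\<rho> p)" and G="\<lambda>p. rs (\<Psi> p)"])
      (auto simp: rhom_comp \<Psi> \<rho> rhom_rs \<psi>, auto simp: \<Psi>_def \<psi>_def \<rho>_def poly_hom_const poly_hom_pvar rhom_const_comp rhom_rs peval_const peval_pvar)
  \<comment> \<open>\<open>G 0\<close> expresses over the base field that the solution has residue
    \<open>a\<close>; the family of all \<open>G \<theta>\<close> is stable and vanishes at the
    point because \<open>s\<close> lifts the derivatives of \<open>a\<close>.\<close>
  define G where "G = (\<lambda>\<theta>. \<rho> (Y \<theta>) - Poly_Mapping.single 0 (theta_val m D \<theta> a))"
  have "{G \<theta> | \<theta>. \<theta> \<in> Theta m} \<subseteq> Q m"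
    unfolding Q_def
  proof (rule diff_core_supset)
    show "{G \<theta> | \<theta>. \<theta> \<in> Theta m} \<subseteq> {p. \<psi> p = 0}"
    proof clarify
      fix \<theta> assume \<theta>: "\<theta> \<in> Theta m"
      show "\<psi> (G \<theta>) = 0"
        using h[OF \<theta>] s(1)[OF \<theta>] by (simp add: G_def rhom_diff[OF \<psi>] \<psi>\<rho>, simp add: \<Psi>_def \<psi>_def peval_const)
    qed
    fix i p assume i: "i < m" and "p \<in> {G \<theta> | \<theta>. \<theta> \<in> Theta m}"
    then obtain \<theta> where \<theta>: "p = G \<theta>" "\<theta> \<in> Theta m" by blast
    have "dA i p = G (\<theta> + Poly_Mapping.single i 1)"
      unfolding \<theta> G_def Y_add[OF i] \<rho>_der[OF i] theta_val_add_single[OF der_L i] der_diff[OF comm_derivations_der[OF dA i]]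
      by (simp add: dA_def ydder_const[OF der_L i])
    moreover have "\<theta> + Poly_Mapping.single i 1 \<in> Theta m" by (intro Theta_add single_in_Theta i \<theta>)
    ultimately show "dA i p \<in> {G \<theta> | \<theta>. \<theta> \<in> Theta m}" by blast
  qed
  then have G_in: "G 0 \<in> Q m" using zero_in_Theta by blast

  let ?F = "insert (G 0) ((\<lambda>(f, j). F f j) ` (\<Lambda> \<times> {..<n}))"
  have "\<exists>z. \<forall>f\<in>?F. peval (\<lambda>(j, \<theta>). theta_val m D \<theta> (z j)) f = 0"
  proof (rule differentially_closed_zero[OF dc, of "Q m"])
    show "is_ideal (Q m)" by (rule Q_ideal) simp
    show "1 \<notin> Q m"
      using diff_core_subset[of 1 dA "{p. \<psi> p = 0}" m] by (auto simp: Q_def rhom_one[OF \<psi>])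
    show "x \<in> Q m \<or> y \<in> Q m" if "x * y \<in> Q m" for x y
      using that unfolding Q_def
    proof (rule diff_core_prime[rotated 4])
      show "of_nat n \<notin> {p. \<psi> p = 0}" if "n > 0" for n
      proof -
        have "\<psi> (of_nat n) = of_nat n" by (induction n) (simp_all add: rhom_simps[OF \<psi>])
        then show ?thesis using that by simp
      qed
    qed (auto simp: rhom_mult[OF \<psi>] ideal_\<psi> comm_derivations_der[OF dA])
    show "ydder D i x \<in> Q m" if "i < m" "x \<in> Q m" for i x
      using diff_core_stable[OF dA order.refl that(1)] that(2) by (simp add: Q_def dA_def)
    show "finite ?F" using fin by simp
    show "?F \<subseteq> Q m" using F_in G_in by auto
    have Y_vars: "pvars (Y \<theta>) \<subseteq> UNIV \<times> Theta m" if "\<theta> \<in> Theta m" for \<theta>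
      using generic_vars[OF der_R that, of n e] that by (auto simp: Y_def)
    have "pvars (F f j) \<subseteq> UNIV \<times> Theta m" if "f \<in> \<Lambda>" "j < n" for f j
    proof -
      have "pvars (F f j) \<subseteq> pvars (\<sigma> f)" unfolding F_def by (rule pvars_map_coeffs) (use co_zero that in simp)
      also have "\<dots> \<subseteq> UNIV \<times> Theta m"
        unfolding \<sigma>_def by (rule pvars_subst_le) (use \<Lambda>_vars(1)[OF that(1)] Y_vars in blast)
      finally show ?thesis .
    qed
    moreover have "pvars (G 0) \<subseteq> UNIV \<times> Theta m"
    proof -
      have "pvars (\<rho> (Y 0)) \<subseteq> UNIV \<times> Theta m"
        unfolding \<rho>_def by (rule pvars_subst_le) (use Y_vars[of 0] in \<open>auto simp: pvars_pvar\<close>)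
      then show ?thesis
        unfolding G_def diff_conv_add_uminus by (intro order.trans[OF pvars_add]) simp
    qed
    ultimately show "pvars f \<subseteq> UNIV \<times> Theta m" if "f \<in> ?F" for f using that by auto
  qed
  then obtain z where z: "\<And>f. f \<in> ?F \<Longrightarrow> peval (\<lambda>(j, \<theta>). theta_val m D \<theta> (z j)) f = 0" by blast

  define \<zeta> where "\<zeta> = peval (\<lambda>(j, \<theta>). \<iota> (theta_val m D \<theta> (z j)))"
  define \<eta> where "\<eta> = peval (\<lambda>(j, \<theta>). theta_val m D \<theta> (z j))"
  have \<zeta>: "is_rhom \<zeta>" and \<eta>: "is_rhom \<eta>" by (simp_all add: \<zeta>_def \<eta>_def rhom_peval)
  have \<zeta>E: "\<zeta> (E p) = \<iota> (\<eta> p)" for p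
    by (rule rhom_poly_ext[where F="\<lambda>p. \<zeta> (E p)" and G="\<lambda>p. \<iota> (\<eta> p)"])
      (auto simp: rhom_comp \<zeta> E rhom_\<iota> \<eta>, auto simp: \<zeta>_def \<eta>_def E_def poly_hom_const poly_hom_pvar rhom_const_comp rhom_\<iota> peval_const peval_pvar)
  have \<eta>\<rho>: "\<eta> (\<rho> p) = rs (\<zeta> p)" for p
    by (rule rhom_poly_ext[where F="\<lambda>p. \<eta> (\<rho> p)" and G="\<lambda>p. rs (\<zeta> p)"])
      (auto simp: rhom_comp \<zeta> \<rho> rhom_rs \<eta>, auto simp: \<zeta>_def \<eta>_def \<rho>_def poly_hom_const poly_hom_pvar rhom_const_comp rhom_rs peval_const peval_pvar)
  \<comment> \<open>Unlike \<open>\<Psi>\<close>, this evaluation commutes with the derivations,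
    since it uses genuine derivatives of the elements \<open>z j\<close>. So the
    \<open>Y \<theta>\<close> become the derivatives of \<open>b\<close>.\<close>
  have \<zeta>_der: "\<zeta> (dR i p) = \<delta> i (\<zeta> p)" if "i < m" for i p
    unfolding \<zeta>_def dR_def ydder_def peval_eq_poly_hom
    by (rule poly_hom_poly_der)
      (use that in \<open>auto simp: rhom_id comm_derivations_der[OF der_R] der_ext poly_hom_pvar theta_val_add_single[OF der_L] simp del: One_nat_def\<close>)
  define b where "b = \<zeta> (Y 0)"
  have "deval m \<delta> f b = 0" if f: "f \<in> \<Lambda>" for f
  proof -
    have Y_b: "\<zeta> (Y \<theta>) = theta_val m \<delta> \<theta> b" if "\<theta> \<in> Theta m" for \<theta>
      using that
    proof (induction rule: Theta_induct)
      case (step \<theta> i)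
      then show ?case by (simp add: Y_add \<zeta>_der theta_val_add_single[OF der_R] del: One_nat_def)
    qed (simp add: b_def)
    have "deval m \<delta> f b = peval (\<lambda>v. \<zeta> (Y v)) f"
      unfolding deval_def using \<Lambda>_vars(1)[OF f] by (intro peval_cong) (auto simp: Y_b)
    also have "\<dots> = \<zeta> (\<sigma> f)"
      by (rule hom_\<sigma>[OF \<zeta>, symmetric]) (simp add: \<zeta>_def peval_const)
    also have "\<dots> = (\<Sum>j<n. \<zeta> (Poly_Mapping.single 0 (e j)) * \<iota> (\<eta> (F f j)))"
      unfolding F_decomp by (simp add: rhom_sum[OF \<zeta>] rhom_mult[OF \<zeta>] \<zeta>E)
    also have "\<dots> = 0"
    proof (rule sum.neutral, rule ballI)
      fix j assume "j \<in> {..<n}"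
      then have "\<eta> (F f j) = 0" unfolding \<eta>_def using f by (intro z) auto
      then show "\<zeta> (Poly_Mapping.single 0 (e j)) * \<iota> (\<eta> (F f j)) = 0" by (simp add: rhom_zero[OF rhom_\<iota>])
    qed
    finally show ?thesis .
  qed
  moreover have "rs b = a"
  proof -
    have "\<eta> (G 0) = 0" unfolding \<eta>_def by (rule z) simp
    moreover have "\<eta> (Poly_Mapping.single 0 a) = a" by (simp add: \<eta>_def peval_const)
    ultimately show ?thesis by (simp add: G_def rhom_diff[OF \<eta>] \<eta>\<rho> b_def)
  qed
  ultimately show ?thesis by blast
qed

end

theorem theorem3p1:
  fixes m :: nat
    and D :: "nat \<Rightarrow> 'a::field_char_0 \<Rightarrow> 'a"
    and \<iota> :: "'a \<Rightarrow> 'r::comm_ring_1"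
    and \<delta> :: "nat \<Rightarrow> 'r \<Rightarrow> 'r"
    and M :: "'r set"
    and \<Lambda> :: "'r dpoly set"
    and a :: 'a
  assumes "differentially_closed m D"
    and "fin_dim_algebra \<iota>"
    and "local_ring TYPE('r)"
    and "maximal_ideal M"
    and "comm_derivations m \<delta>"
    and "\<forall>i<m. \<forall>c. \<delta> i (\<iota> c) = \<iota> (D i c)"
    and "\<forall>i<m. \<forall>r\<in>M. \<delta> i r \<in> M"
    and "finite \<Lambda>"
    and "coherent m \<delta> \<Lambda>"
    and "\<forall>f\<in>\<Lambda>. deval m D (map_coeffs (res \<iota> M) f) a = 0"
    and "deval m D (map_coeffs (res \<iota> M) (H_prod m \<Lambda>)) a \<noteq> 0"
  shows "\<exists>b. res \<iota> M b = a \<and> (\<forall>f\<in>\<Lambda>. deval m \<delta> f b = 0)"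
proof -
  interpret coherent_system m D \<iota> \<delta> M \<Lambda> a
    by unfold_locales (use assms in auto)
  show ?thesis by (rule differential_solution)
qed

end
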